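(* Let $n\ge 1$ and let $(\hat W_\ell,d)$, $\ell=0,\dots,N$, be the hierarchical B-spline complexes (with homogeneous boundary conditions) on $\hat\Omega=(0,1)^n$ associated with a nested sequence of tensor-product spline spaces and a nested sequence of subdomains, as defined in the context. Then the hierarchical B-spline complex $(\hat W_{\ell+1},d)$ is exact for $\ell=0,\dots,N-1$ if and only if, for $\ell=0,\dots,N-1$, the inclusion $j:\hat X^k_{\ell,\ell+1}\to\hat X^k_{\ell+1,\ell+1}$ induces an isomorphism between the cohomology groups $H^k(\hat X_{\ell,\ell+1})$ and $H^k(\hat X_{\ell+1,\ell+1})$ for $k=1,\dots,n$.
   Context: **Univariate splines.** Let $p\ge1$ and let $\Xi=\{\xi_1,\dots,\xi_{m+p+1}\}$ be an open knot vector: $0=\xi_1=\dots=\xi_{p+1}<\xi_{p+2}\le\dots\le\xi_m<\xi_{m+1}=\dots=\xi_{m+p+1}=1$, with every internal knot of multiplicity at most $p$. Let $B_{i,p}$, $i=1,\dots,m$, be the B-splines given by the Cox-de Boor formula, and let $S_p(\Xi)$ be their span. For $i=2,\dots,m$ let $D_{i,p-1}=\frac{p}{\xi_{i+p}-\xi_i}B_{i,p-1}$, where $B_{i,p-1}$ is the B-spline of degree $p-1$ with local knot vector $\{\xi_i,\dots,\xi_{i+p}\}$; then $B_{i,p}'=D_{i,p-1}-D_{i+1,p-1}$ with the convention $D_{1,p-1}=D_{m+1,p-1}=0$. Supports are taken as open sets: $\mathrm{supp}(B_{i,p})=(\xi_i,\xi_{i+p+1})$ and $\mathrm{supp}(D_{i,p-1})=(\xi_i,\xi_{i+p})$.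 **Levels.** For $\ell=0,\dots,N$ let degrees $p_{q,\ell}\ge1$ and open knot vectors $\Xi_{q,\ell}$ ($q=1,\dots,n$) be given, where, with $p=p_{q,\ell}$ and some $m=m_{q,\ell}$, $\Xi_{q,\ell}=\{\xi_1,\dots,\xi_{m+p+1}\}$ (the knots depending on $q$ and $\ell$) satisfies $0=\xi_1=\dots=\xi_{p+1}<\xi_{p+2}\le\dots\le\xi_m<\xi_{m+1}=\dots=\xi_{m+p+1}=1$ with every internal knot of multiplicity at most $p$, and with nested tensor-product spline spaces $\bigotimes_q S_{p_{q,\ell}}(\Xi_{q,\ell})\subset\bigotimes_q S_{p_{q,\ell+1}}(\Xi_{q,\ell+1})$. Let $\mathcal M_\ell$ be the Bézier mesh of level $\ell$, i.e. the Cartesian grid of $\hat\Omega$ generated by the knots without repetitions. **Spline $k$-forms with homogeneous boundary conditions.** For $0\le k\le n$, $\mathcal B^k_\ell$ is the set of all forms $\left(\prod_{q=1}^n\beta_q(x_q)\right)dx_{\alpha_1}\wedge\dots\wedge dx_{\alpha_k}$ with $1\le\alpha_1<\dots<\alpha_k\le n$, where $\beta_q$ is one of the functions $D_{i,p_{q,\ell}-1}$ (all $i$) of $\Xi_{q,\ell}$ if $q\in\{\alpha_1,\dots,\alpha_k\}$, and one of the functions $B_{i,p_{q,\ell}}$ of $\Xi_{q,\ell}$ vanishing at $0$ and $1$ (i.e. not the first or last one) otherwise. The support of such a form is the product of the (open) univariate supports. Put $\hat X^k_{\ell,h}=\mathrm{span}\,\mathcal B^k_\ell$. The exterior derivative $d^k$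 maps $\hat X^k_{\ell,h}$ into $\hat X^{k+1}_{\ell,h}$. **Subdomains.** Let $\hat\Omega=\Omega_0\supset\Omega_1\supset\dots\supset\Omega_N\supset\Omega_{N+1}=\emptyset$ be open sets, each the interior of its closure, such that the closure of $\Omega_\ell$ is the union of closures of elements of $\mathcal M_{\ell-1}$, $\ell=1,\dots,N$. **Hierarchical spaces.** For each $k$: $\mathcal H^k_0=\mathcal B^k_0$ and, for $\ell=0,\dots,N-1$, $\mathcal H^k_{\ell+1}=\{\beta\in\mathcal H^k_\ell:\mathrm{supp}(\beta)\not\subset\Omega_{\ell+1}\}\cup\{\beta\in\mathcal B^k_{\ell+1}:\mathrm{supp}(\beta)\subset\Omega_{\ell+1}\}$; $\hat W^k_\ell=\mathrm{span}\,\mathcal H^k_\ell$. For $0\le\ell\le\ell'\le N$: $\mathcal B^k_{\ell,\ell'}=\{\beta\in\mathcal B^k_\ell:\mathrm{supp}(\beta)\subset\Omega_{\ell'}\}$ and $\hat X^k_{\ell,\ell'}=\mathrm{span}\,\mathcal B^k_{\ell,\ell'}$. With the exterior derivatives, $(\hat W_\ell,d)$ and $(\hat X_{\ell,\ell'},d)$ are complexes. **Cohomology and exactness.** For a complex $(V,d)$ of spaces $V^0,\dots,V^n$, $H^k(V)=\ker(d^k)/\mathrm{Im}(d^{k-1})$, with $d^{-1}=0$, $d^n=0$. Since homogeneous boundary conditions are imposed, exactness of $(\hat W_\ell,d)$ means exactness of the extended sequence $0\to\hat W^0_\ell\xrightarrow{d^0}\hat W^1_\ell\xrightarrow{d^1}\cdots\xrightarrow{d^{n-1}}\hat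 W^n_\ell\xrightarrow{\int}\mathbb R\to0$. *)

theory Defs
  imports "HOL-Analysis.Analysis" "HOL-Library.Function_Algebras"
begin

section \<open>Function spaces\<close>

text \<open>Pointwise scalar multiplication, so that \<^const>\<open>span\<close> is available for sets of functions and of
  differential forms.\<close>

instantiation "fun" :: (type, real_vector) real_vector
begin

definition scaleR_fun_def: "r *\<^sub>R f = (\<lambda>x. r *\<^sub>R f x)"

instance
  by standard (simp_all add: scaleR_fun_def fun_eq_iff scaleR_add_right scaleR_add_left)

end

lemma scaleR_fun_apply [simp]: "(r *\<^sub>R f) x = r *\<^sub>R f x"
  by (simp add: scaleR_fun_def)


section \<open>Univariate splines\<close>

text \<open>A knot vector \<open>\<xi>\<^sub>1, \<dots>, \<xi>\<^bsub>m+p+1\<^esub>\<close> of degree \<open>p\<close> with \<open>m\<close> B-splines. Knots are numbered from \<open>1\<close>; the values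
  of the field \<open>knot\<close> outside \<open>{1..m+p+1}\<close> play no role.\<close>

record knot_vector =
  deg :: nat
  num :: nat
  knot :: "nat \<Rightarrow> real"

definition open_knot_vector :: "knot_vector \<Rightarrow> bool" where
  "open_knot_vector K \<longleftrightarrow> (let p = deg K; m = num K; \<xi> = knot K in
     1 \<le> p \<and>
     (\<forall>i\<in>{1..p+1}. \<xi> i = 0) \<and>
     (\<forall>i\<in>{m+1..m+p+1}. \<xi> i = 1) \<and>
     (\<forall>i\<in>{1..m+p}. \<xi> i \<le> \<xi> (i+1)) \<and>
     0 < \<xi> (p+2) \<and> \<xi> m < 1 \<and>
     (\<forall>t. 0 < t \<and> t < 1 \<longrightarrow> card {i\<in>{1..m+p+1}. \<xi> i = t} \<le> p))"

text \<open>Cox-de Boor recursion. The usual convention \<open>0/0 = 0\<close> is that of HOL division. The half-open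
  intervals in degree \<open>0\<close> make all the functions below continuous from the right.\<close>

fun bspline :: "(nat \<Rightarrow> real) \<Rightarrow> nat \<Rightarrow> nat \<Rightarrow> real \<Rightarrow> real" where
  "bspline \<xi> 0 i x = (if \<xi> i \<le> x \<and> x < \<xi> (i+1) then 1 else 0)"
| "bspline \<xi> (Suc p) i x =
     (x - \<xi> i) / (\<xi> (i+p+1) - \<xi> i) * bspline \<xi> p i x +
     (\<xi> (i+p+2) - x) / (\<xi> (i+p+2) - \<xi> (i+1)) * bspline \<xi> p (i+1) x"

definition B_spline :: "knot_vector \<Rightarrow> nat \<Rightarrow> real \<Rightarrow> real" where
  "B_spline K i = bspline (knot K) (deg K) i"

definition D_spline :: "knot_vector \<Rightarrow> nat \<Rightarrow> real \<Rightarrow> real" where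
  "D_spline K i = (\<lambda>x. real (deg K) / (knot K (i + deg K) - knot K i) * bspline (knot K) (deg K - 1) i x)"

definition spline_space :: "knot_vector \<Rightarrow> (real \<Rightarrow> real) set" where
  "spline_space K = span (B_spline K ` {1..num K})"


section \<open>Tensor-product spaces and meshes\<close>

text \<open>The coordinate directions \<open>1, \<dots>, n\<close> are the elements of the finite linearly ordered type
  \<open>'n\<close>. Functions and forms on the unit cube are represented by their extension by zero.\<close>

definition unit_cube :: "(real ^ 'n) set" where
  "unit_cube = {x. \<forall>q. 0 < x $ q \<and> x $ q < 1}"

definition tensor_spline_space :: "('n::finite \<Rightarrow> knot_vector) \<Rightarrow> (real ^ 'n \<Rightarrow> real) set" where
  "tensor_spline_space K = span {\<lambda>x. if x \<in> unit_cube then \<Prod>q\<in>UNIV. f q (x $ q) else 0 |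
      f. \<forall>q. f q \<in> spline_space (K q)}"

definition breakpoints :: "knot_vector \<Rightarrow> real set" where
  "breakpoints K = knot K ` {1..num K + deg K + 1}"

definition bezier_mesh :: "('n::finite \<Rightarrow> knot_vector) \<Rightarrow> (real ^ 'n) set set" where
  "bezier_mesh K = {box a b | a b. \<forall>q. a $ q \<in> breakpoints (K q) \<and> b $ q \<in> breakpoints (K q) \<and>
      a $ q < b $ q \<and> breakpoints (K q) \<inter> {a $ q <..< b $ q} = {}}"


section \<open>Differential forms and the exterior derivative\<close>

text \<open>A form is given by its coefficients: \<open>\<omega> \<alpha>\<close> is the coefficient of
  \<open>dx\<^bsub>\<alpha>\<^sub>1\<^esub> \<and> \<dots> \<and> dx\<^bsub>\<alpha>\<^sub>k\<^esub>\<close> where \<open>\<alpha> = {\<alpha>\<^sub>1 < \<dots> < \<alpha>\<^sub>k}\<close>. A \<open>k\<close>-form has \<open>\<omega> \<alpha> = 0\<close> unless \<open>card \<alpha> = k\<close>.\<close>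

type_synonym 'n form = "'n set \<Rightarrow> real ^ 'n \<Rightarrow> real"

text \<open>Spline forms are only piecewise smooth, and the forms with factors \<^const>\<open>D_spline\<close> may
  jump across knot planes. As all splines here are continuous from the right, partial derivatives
  are taken from the right as well: this yields the (almost everywhere and weak) derivative of a
  spline form in its right-continuous representative, and the rule
  \<open>B\<^sub>i' = D\<^sub>i - D\<^bsub>i+1\<^esub>\<close> at every point.\<close>

definition partial_deriv :: "'n \<Rightarrow> (real ^ 'n \<Rightarrow> real) \<Rightarrow> real ^ 'n::finite \<Rightarrow> real" where
  "partial_deriv j f x = vector_derivative (\<lambda>t. f (x + t *\<^sub>R axis j 1)) (at_right 0)"

lemma partial_deriv_eq_classical:
  assumes "((\<lambda>t. f (x + t *\<^sub>R axis j 1)) has_vector_derivative D) (at 0)"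
  shows "partial_deriv j f x = D"
  unfolding partial_deriv_def
  by (rule vector_derivative_within)
     (use assms in \<open>auto intro: has_vector_derivative_at_within\<close>)

text \<open>The sign comes from moving \<open>dx\<^sub>j\<close> into increasing position in
  \<open>d (f dx\<^sub>\<alpha>) = (\<Sum>j. \<partial>\<^sub>j f dx\<^sub>j \<and> dx\<^sub>\<alpha>)\<close>, with \<open>\<gamma> = insert j \<alpha>\<close>. The exterior
  derivative of a form of top degree is \<open>0\<close>.\<close>

definition ext_deriv :: "'n::{finite,linorder} form \<Rightarrow> 'n form" where
  "ext_deriv \<omega> = (\<lambda>\<gamma> x. if x \<in> unit_cube
      then \<Sum>j\<in>\<gamma>. (- 1) ^ card {i\<in>\<gamma>. i < j} * partial_deriv j (\<omega> (\<gamma> - {j})) x else 0)"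

definition integral_form :: "'n::finite form \<Rightarrow> real" where
  "integral_form \<omega> = integral unit_cube (\<omega> UNIV)"


section \<open>Hierarchical spline forms with homogeneous boundary conditions\<close>

text \<open>The multi-index \<open>i\<close> selects \<open>D_spline (K q) (i q)\<close> for \<open>q \<in> \<alpha>\<close> and
  \<open>B_spline (K q) (i q)\<close> otherwise.\<close>

definition spline_form :: "('n::finite \<Rightarrow> knot_vector) \<Rightarrow> 'n set \<Rightarrow> ('n \<Rightarrow> nat) \<Rightarrow> 'n form" where
  "spline_form K \<alpha> i = (\<lambda>\<gamma> x. if \<gamma> = \<alpha> \<and> x \<in> unit_cube
      then \<Prod>q\<in>UNIV. (if q \<in> \<alpha> then D_spline (K q) (i q) else B_spline (K q) (i q)) (x $ q)
      else 0)"

definition spline_supp :: "('n::finite \<Rightarrow> knot_vector) \<Rightarrow> 'n set \<Rightarrow> ('n \<Rightarrow> nat) \<Rightarrow> (real ^ 'n) set" where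
  "spline_supp K \<alpha> i = {x. \<forall>q. knot (K q) (i q) < x $ q \<and>
      x $ q < knot (K q) (if q \<in> \<alpha> then i q + deg (K q) else i q + deg (K q) + 1)}"

text \<open>Elements of \<open>\<B>\<^sup>k\<^sub>l\<close> are paired with their open support: the members are pairs (form, support).
  The index range \<open>{2..num - 1}\<close> leaves out the first and the last B-spline.\<close>

definition spline_basis ::
    "(nat \<Rightarrow> 'n::finite \<Rightarrow> knot_vector) \<Rightarrow> nat \<Rightarrow> nat \<Rightarrow> ('n form \<times> (real ^ 'n) set) set" where
  "spline_basis \<Xi> l k = {(spline_form (\<Xi> l) \<alpha> i, spline_supp (\<Xi> l) \<alpha> i) | \<alpha> i. card \<alpha> = k \<and>
      (\<forall>q. i q \<in> (if q \<in> \<alpha> then {2..num (\<Xi> l q)} else {2..num (\<Xi> l q) - 1}))}"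

primrec hier_basis ::
    "(nat \<Rightarrow> 'n::finite \<Rightarrow> knot_vector) \<Rightarrow> (nat \<Rightarrow> (real ^ 'n) set) \<Rightarrow> nat \<Rightarrow> nat
      \<Rightarrow> ('n form \<times> (real ^ 'n) set) set" where
  "hier_basis \<Xi> \<Omega> 0 k = spline_basis \<Xi> 0 k"
| "hier_basis \<Xi> \<Omega> (Suc l) k =
     {\<beta> \<in> hier_basis \<Xi> \<Omega> l k. \<not> snd \<beta> \<subseteq> \<Omega> (Suc l)} \<union>
     {\<beta> \<in> spline_basis \<Xi> (Suc l) k. snd \<beta> \<subseteq> \<Omega> (Suc l)}"

definition hier_space ::
    "(nat \<Rightarrow> 'n::finite \<Rightarrow> knot_vector) \<Rightarrow> (nat \<Rightarrow> (real ^ 'n) set) \<Rightarrow> nat \<Rightarrow> nat \<Rightarrow> 'n form set" where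
  "hier_space \<Xi> \<Omega> l k = span (fst ` hier_basis \<Xi> \<Omega> l k)"

definition sub_basis ::
    "(nat \<Rightarrow> 'n::finite \<Rightarrow> knot_vector) \<Rightarrow> (nat \<Rightarrow> (real ^ 'n) set) \<Rightarrow> nat \<Rightarrow> nat \<Rightarrow> nat
      \<Rightarrow> ('n form \<times> (real ^ 'n) set) set" where
  "sub_basis \<Xi> \<Omega> l l' k = {\<beta> \<in> spline_basis \<Xi> l k. snd \<beta> \<subseteq> \<Omega> l'}"

definition sub_space ::
    "(nat \<Rightarrow> 'n::finite \<Rightarrow> knot_vector) \<Rightarrow> (nat \<Rightarrow> (real ^ 'n) set) \<Rightarrow> nat \<Rightarrow> nat \<Rightarrow> nat \<Rightarrow> 'n form set" where
  "sub_space \<Xi> \<Omega> l l' k = span (fst ` sub_basis \<Xi> \<Omega> l l' k)"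


section \<open>Cohomology and exactness\<close>

text \<open>A complex is given by its spaces \<open>V 0, \<dots>, V n\<close>; the differential is always
  \<^const>\<open>ext_deriv\<close>.\<close>

definition cocycles :: "(nat \<Rightarrow> 'n::{finite,linorder} form set) \<Rightarrow> nat \<Rightarrow> 'n form set" where
  "cocycles V k = {\<omega> \<in> V k. ext_deriv \<omega> = 0}"

definition coboundaries :: "(nat \<Rightarrow> 'n::{finite,linorder} form set) \<Rightarrow> nat \<Rightarrow> 'n form set" where
  "coboundaries V k = (if k = 0 then {0} else ext_deriv ` V (k - 1))"

definition coh_class ::
    "(nat \<Rightarrow> 'n::{finite,linorder} form set) \<Rightarrow> nat \<Rightarrow> 'n form \<Rightarrow> 'n form set" where
  "coh_class V k \<omega> = (\<lambda>\<eta>. \<omega> + \<eta>) ` coboundaries V k"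

definition cohomology :: "(nat \<Rightarrow> 'n::{finite,linorder} form set) \<Rightarrow> nat \<Rightarrow> 'n form set set" where
  "cohomology V k = coh_class V k ` cocycles V k"

text \<open>The vector space operations of \<open>H\<^sup>k(V)\<close>, written as unions over all representatives.\<close>

definition coh_add ::
    "(nat \<Rightarrow> 'n::{finite,linorder} form set) \<Rightarrow> nat \<Rightarrow> 'n form set \<Rightarrow> 'n form set \<Rightarrow> 'n form set" where
  "coh_add V k C C' = (\<Union>\<omega>\<in>C. \<Union>\<eta>\<in>C'. coh_class V k (\<omega> + \<eta>))"

definition coh_scale ::
    "(nat \<Rightarrow> 'n::{finite,linorder} form set) \<Rightarrow> nat \<Rightarrow> real \<Rightarrow> 'n form set \<Rightarrow> 'n form set" where
  "coh_scale V k r C = (\<Union>\<omega>\<in>C. coh_class V k (r *\<^sub>R \<omega>))"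

text \<open>For complexes \<open>V k \<subseteq> V' k\<close>, the map \<open>H\<^sup>k(V) \<rightarrow> H\<^sup>k(V')\<close> induced by the inclusion sends the class
  of \<open>\<omega>\<close> in \<open>V\<close> to the class of \<open>\<omega>\<close> in \<open>V'\<close>.\<close>

definition coh_induced ::
    "(nat \<Rightarrow> 'n::{finite,linorder} form set) \<Rightarrow> nat \<Rightarrow> 'n form set \<Rightarrow> 'n form set" where
  "coh_induced V' k C = (\<Union>\<omega>\<in>C. coh_class V' k \<omega>)"

definition inclusion_induces_iso ::
    "(nat \<Rightarrow> 'n::{finite,linorder} form set) \<Rightarrow> (nat \<Rightarrow> 'n form set) \<Rightarrow> nat \<Rightarrow> bool" where
  "inclusion_induces_iso V V' k \<longleftrightarrow>
     bij_betw (coh_induced V' k) (cohomology V k) (cohomology V' k) \<and>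
     (\<forall>C\<in>cohomology V k. \<forall>C'\<in>cohomology V k.
        coh_induced V' k (coh_add V k C C') = coh_add V' k (coh_induced V' k C) (coh_induced V' k C')) \<and>
     (\<forall>r. \<forall>C\<in>cohomology V k.
        coh_induced V' k (coh_scale V k r C) = coh_scale V' k r (coh_induced V' k C))"

text \<open>Exactness of \<open>0 \<rightarrow> V 0 \<rightarrow> V 1 \<rightarrow> \<dots> \<rightarrow> V n \<rightarrow> \<real> \<rightarrow> 0\<close> with the integral as last map, at \<open>V 0\<close>, at
  \<open>V k\<close> for \<open>0 < k < n\<close>, at \<open>V n\<close> and at \<open>\<real>\<close>.\<close>

definition exact_complex :: "(nat \<Rightarrow> 'n::{finite,linorder} form set) \<Rightarrow> bool" where
  "exact_complex V \<longleftrightarrow>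
     cocycles V 0 = {0} \<and>
     (\<forall>k\<in>{1..<CARD('n)}. cocycles V k = coboundaries V k) \<and>
     {\<omega> \<in> V CARD('n). integral_form \<omega> = 0} = coboundaries V CARD('n) \<and>
     integral_form ` V CARD('n) = UNIV"

end

theory Submission
  imports Defs
begin

text \<open>
  On each level the tensor-product forms are, through their coefficients, a cubical cochain complex: the
  derivative of a spline takes differences of neighbouring coefficients, so integrating in one direction at a time
  gives explicit homotopies onto a single top form of integral \<open>1\<close>. Hence \<open>W\<^sub>0\<close> is exact. Local linear
  independence of B-splines shows that a spline form of level \<open>l\<close> vanishing off \<open>\<Omega>\<^bsub>l'\<^esub>\<close> only uses basis forms
  supported in \<open>\<Omega>\<^bsub>l'\<^esub>\<close>; this yields \<open>W\<^bsub>l+1\<^esub> = W\<^sub>l + X\<^bsub>l+1,l+1\<^esub>\<close> and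
  \<open>W\<^sub>l \<inter> X\<^bsub>l+1,l+1\<^esub> = X\<^bsub>l,l+1\<^esub>\<close>. By the resulting Mayer-Vietoris argument, if \<open>W\<^sub>l\<close> is exact, then
  \<open>W\<^bsub>l+1\<^esub>\<close> is exact if and only if the inclusion \<open>X\<^bsub>l,l+1\<^esub> \<subseteq> X\<^bsub>l+1,l+1\<^esub>\<close> is an isomorphism on cohomology, and the
  theorem follows by induction on \<open>l\<close>.
\<close>

section \<open>Univariate B-splines\<close>

text \<open>No level can be treated in isolation: the step to \<open>W (Suc l)\<close> presupposes
  that \<open>W l\<close> is exact, and this is where the quantification over all levels enters.
  Three obstacles shape the rest. The derivative of a form is a pointwise one-sided one and is
  linear only on suitable forms, so every hierarchical space is kept inside the tensor-product space
  of its level, where the derivative is a difference operator on coefficients. The hypotheses nest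
  the full tensor-product spaces, boundary splines included, whereas the complexes need nested
  spaces of D-splines and of B-splines vanishing at 0 and 1; these are recovered from univariate
  derivatives, boundary values and integrals. Finally, a right-continuous spline may be non-zero on
  the boundary of its open support, so locality is expressed as vanishing off a closure, and the
  regularity of the subdomains turns this back into an inclusion of open supports.\<close>

lemma bspline_cong:
  assumes "\<And>j. i \<le> j \<Longrightarrow> j \<le> i + r + 1 \<Longrightarrow> \<xi> j = \<zeta> j"
  shows "bspline \<xi> r i x = bspline \<zeta> r i x"
  using assms
proof (induction r arbitrary: i)
  case (Suc r)
  have "bspline \<xi> r i x = bspline \<zeta> r i x" "bspline \<xi> r (i+1) x = bspline \<zeta> r (i+1) x"
    using Suc.prems by (auto intro!: Suc.IH)
  then show ?case using Suc.prems by simp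
qed simp

lemma bspline_outside:
  assumes "mono \<xi>" "x < \<xi> i \<or> \<xi> (i + r + 1) \<le> x"
  shows "bspline \<xi> r i x = 0"
  using assms(2)
proof (induction r arbitrary: i)
  case (Suc r)
  have "\<xi> i \<le> \<xi> (i+1)" "\<xi> (i + r + 1) \<le> \<xi> (i + r + 2)"
    using assms(1) by (auto intro: monoD)
  then have "bspline \<xi> r i x = 0" "bspline \<xi> r (i+1) x = 0"
    using Suc.prems by (auto intro!: Suc.IH)
  then show ?case by simp
qed auto

lemma bspline_nonneg:
  assumes "mono \<xi>"
  shows "0 \<le> bspline \<xi> r i x"
proof (induction r arbitrary: i)
  case (Suc r)
  have "0 \<le> (x - \<xi> i) / (\<xi> (i+r+1) - \<xi> i) * bspline \<xi> r i x"
  proof (cases "\<xi> i \<le> x")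
    case True
    moreover have "\<xi> i \<le> \<xi> (i+r+1)" by (auto intro: monoD[OF assms])
    ultimately show ?thesis using Suc by (intro mult_nonneg_nonneg divide_nonneg_nonneg) auto
  qed (simp add: bspline_outside[OF assms])
  moreover have "0 \<le> (\<xi> (i+r+2) - x) / (\<xi> (i+r+2) - \<xi> (i+1)) * bspline \<xi> r (i+1) x"
  proof (cases "x \<le> \<xi> (i+r+2)")
    case True
    moreover have "\<xi> (i+1) \<le> \<xi> (i+r+2)" by (auto intro: monoD[OF assms])
    ultimately show ?thesis using Suc by (intro mult_nonneg_nonneg divide_nonneg_nonneg) auto
  qed (simp add: bspline_outside[OF assms])
  ultimately show ?case by simp
qed simp

lemma borel_measurable_bspline [measurable]: "bspline \<xi> r i \<in> borel_measurable borel"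
proof (induction r arbitrary: i)
  case 0
  have "bspline \<xi> 0 i = indicator {\<xi> i..<\<xi> (i+1)}" by (auto simp: fun_eq_iff indicator_def)
  then show ?case by simp
next
  case (Suc r)
  have "bspline \<xi> (Suc r) i = (\<lambda>x. (x - \<xi> i) / (\<xi> (i+r+1) - \<xi> i) * bspline \<xi> r i x +
     (\<xi> (i+r+2) - x) / (\<xi> (i+r+2) - \<xi> (i+1)) * bspline \<xi> r (i+1) x)"
    by (rule ext) simp
  moreover note [measurable] = Suc
  ultimately show ?case by simp
qed

text \<open>In the recursion each B-spline of degree \<open>r\<close> enters two neighbours of
  degree \<open>Suc r\<close>, with weights adding up to 1. The unpaired ones at both ends of the
  sum vanish on the knot span.\<close>

lemma sum_bspline_eq_1:
  assumes "mono \<xi>" "\<xi> (k + r) \<le> x" "x < \<xi> (k + r + 1)"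
  shows "(\<Sum>i=k..k+r. bspline \<xi> r i x) = 1"
  using assms(2,3)
proof (induction r arbitrary: k)
  case (Suc r)
  let ?a = "\<lambda>i. (x - \<xi> i) / (\<xi> (i+r+1) - \<xi> i) * bspline \<xi> r i x"
  let ?b = "\<lambda>i. (\<xi> (i+r+1) - x) / (\<xi> (i+r+1) - \<xi> i) * bspline \<xi> r i x"
  have "(\<Sum>i=k..k+Suc r. bspline \<xi> (Suc r) i x) = (\<Sum>i=k..k+Suc r. ?a i) + (\<Sum>i=k..k+Suc r. ?b (Suc i))"
    by (simp add: sum.distrib)
  also have "(\<Sum>i=k..k+Suc r. ?a i) = (\<Sum>i=Suc k..Suc k+r. ?a i)"
    using bspline_outside[OF assms(1), of x k r] Suc.prems by (simp add: sum.atLeast_Suc_atMost)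
  also have "(\<Sum>i=k..k+Suc r. ?b (Suc i)) = (\<Sum>i=Suc k..Suc (k + Suc r). ?b i)"
    by (simp only: sum.shift_bounds_cl_Suc_ivl)
  also have "\<dots> = (\<Sum>i=Suc k..Suc k+r. ?b i)"
    using bspline_outside[OF assms(1), of x "k + Suc (Suc r)" r] Suc.prems by simp
  also have "(\<Sum>i=Suc k..Suc k+r. ?a i) + (\<Sum>i=Suc k..Suc k+r. ?b i)
      = (\<Sum>i=Suc k..Suc k+r. bspline \<xi> r i x)"
    unfolding sum.distrib[symmetric]
  proof (rule sum.cong[OF refl])
    fix i assume "i \<in> {Suc k..Suc k + r}"
    then have "\<xi> i \<le> \<xi> (k + Suc r)" "\<xi> (k + Suc r + 1) \<le> \<xi> (i+r+1)"
      by (auto intro!: monoD[OF assms(1)])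
    then have "\<xi> i < \<xi> (i+r+1)" using Suc.prems by linarith
    then have "(x - \<xi> i) / (\<xi> (i+r+1) - \<xi> i) + (\<xi> (i+r+1) - x) / (\<xi> (i+r+1) - \<xi> i) = 1"
      by (simp add: add_divide_distrib[symmetric])
    then show "?a i + ?b i = bspline \<xi> r i x"
      by (simp only: distrib_right[symmetric])
  qed
  also have "\<dots> = 1"
    using Suc.IH[of "Suc k"] Suc.prems by simp
  finally show ?case .
qed simp

section \<open>Derivatives and jumps of B-splines\<close>

lemma has_derivative_affine_mult:
  fixes f :: "real \<Rightarrow> real"
  assumes "(f has_field_derivative D) (at x within S)"
  shows "((\<lambda>y. (y - a) / e * f y) has_field_derivative f x / e + (x - a) / e * D) (at x within S)"
    and "((\<lambda>y. (a - y) / e * f y) has_field_derivative - f x / e + (a - x) / e * D) (at x within S)"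
proof -
  have "((\<lambda>y. (y - a) / e) has_field_derivative 1 / e) (at x within S)"
    "((\<lambda>y. (a - y) / e) has_field_derivative - 1 / e) (at x within S)"
    by (intro DERIV_cdivide; auto intro!: derivative_eq_intros)+
  from this[THEN DERIV_mult', OF assms]
  show "((\<lambda>y. (y - a) / e * f y) has_field_derivative f x / e + (x - a) / e * D) (at x within S)"
    "((\<lambda>y. (a - y) / e * f y) has_field_derivative - f x / e + (a - x) / e * D) (at x within S)"
    by (simp_all add: add.commute)
qed

text \<open>Stated for an arbitrary set within which the piecewise constant B-splines have derivative \<open>0\<close>, so as to
  cover both the right derivative everywhere and the two-sided derivative away from the knots.\<close>

lemma bspline_has_derivative:
  assumes "mono \<xi>"
    and base: "\<And>i. (bspline \<xi> 0 i has_field_derivative 0) (at x within S)"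
  shows "(bspline \<xi> (Suc r) i has_field_derivative
      real (Suc r) * (bspline \<xi> r i x / (\<xi> (i+r+1) - \<xi> i)
        - bspline \<xi> r (i+1) x / (\<xi> (i+r+2) - \<xi> (i+1)))) (at x within S)"
proof (induction r arbitrary: i)
  case 0
  have "((\<lambda>x. (x - \<xi> i) / (\<xi> (i+1) - \<xi> i) * bspline \<xi> 0 i x
      + (\<xi> (i+2) - x) / (\<xi> (i+2) - \<xi> (i+1)) * bspline \<xi> 0 (i+1) x) has_field_derivative
      (bspline \<xi> 0 i x / (\<xi> (i+1) - \<xi> i) - bspline \<xi> 0 (i+1) x / (\<xi> (i+2) - \<xi> (i+1)))) (at x within S)"
    using DERIV_add[OF has_derivative_affine_mult(1)[OF base, of "\<xi> i" "\<xi> (i+1) - \<xi> i" i]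
        has_derivative_affine_mult(2)[OF base, of "\<xi> (i+2)" "\<xi> (i+2) - \<xi> (i+1)" "i+1"]] by simp
  moreover have "bspline \<xi> (Suc 0) i = (\<lambda>x. (x - \<xi> i) / (\<xi> (i+1) - \<xi> i) * bspline \<xi> 0 i x
      + (\<xi> (i+2) - x) / (\<xi> (i+2) - \<xi> (i+1)) * bspline \<xi> 0 (i+1) x)"
    by (rule ext) (simp only: bspline.simps(2) add_0_right)
  ultimately show ?case by simp
next
  case (Suc r)
  define b where "b = bspline \<xi> r"
  define w where "w = (\<lambda>i. b i x / (\<xi> (i+r+1) - \<xi> i))"
  define e where "e = (\<lambda>i. \<xi> (i+r+2) - \<xi> i)"
  have IH: "(bspline \<xi> (Suc r) i has_field_derivative real (Suc r) * (w i - w (i+1))) (at x within S)" for i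
    using Suc[of i] by (simp add: b_def w_def del: bspline.simps(2))
  have eq: "bspline \<xi> (Suc (Suc r)) i = (\<lambda>x. (x - \<xi> i) / e i * bspline \<xi> (Suc r) i x
      + (\<xi> (i+r+3) - x) / e (i+1) * bspline \<xi> (Suc r) (i+1) x)"
    by (rule ext) (simp add: e_def eval_nat_numeral)
  have rec: "bspline \<xi> (Suc r) i x = (x - \<xi> i) * w i + (\<xi> (i+r+2) - x) * w (i+1)" for i
    by (simp add: w_def b_def)
  have alg: "(b + p * (R * W)) + (- b' + q * (R * V)) = R * (p * W + q * V) + (b - b')"
    for b b' p q R W V :: real
    by (simp add: algebra_simps)
  have alg2: "real (Suc r) * D + D = real (Suc (Suc r)) * D" for D
    by (simp add: algebra_simps)
  \<comment> \<open>The differentiated factors regroup into the very difference that comes from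
    differentiating the weights. The induction hypothesis thus contributes \<open>Suc r\<close>
    copies of it and the product rule one more.\<close>
  have key: "(x - \<xi> i) / e i * (w i - w (i+1)) + (\<xi> (i+r+3) - x) / e (i+1) * (w (i+1) - w (i+2))
      = bspline \<xi> (Suc r) i x / e i - bspline \<xi> (Suc r) (i+1) x / e (i+1)"
  \<comment> \<open>On a degenerate middle interval \<open>w (i+1)\<close> is a division by zero,
    hence 0; otherwise both \<open>e i\<close> and \<open>e (i+1)\<close> are positive.\<close>
  proof (cases "\<xi> (i+r+2) = \<xi> (i+1)")
    case True
    then have "w (i+1) = 0" by (simp add: w_def)
    then show ?thesis unfolding rec by (simp add: algebra_simps add_divide_distrib diff_divide_distrib eval_nat_numeral)
  next
    case False
    have "\<xi> i \<le> \<xi> (i+1)" "\<xi> (i+1) \<le> \<xi> (i+r+2)" "\<xi> (i+r+2) \<le> \<xi> (i+r+3)"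
      by (auto intro: monoD[OF assms(1)])
    then have pos: "e i > 0" "e (i+1) > 0" using False by (auto simp: e_def eval_nat_numeral)
    have e: "\<xi> (i+r+2) = e i + \<xi> i" "\<xi> (i+r+3) = e (i+1) + \<xi> (i+1)" by (auto simp: e_def eval_nat_numeral)
    have r2: "bspline \<xi> (Suc r) (i+1) x = (x - \<xi> (i+1)) * w (i+1) + (\<xi> (i+r+3) - x) * w (i+2)"
      unfolding rec by (simp add: eval_nat_numeral)
    show ?thesis unfolding r2 unfolding rec e using pos by (simp add: field_simps)
  qed
  have "(bspline \<xi> (Suc (Suc r)) i has_field_derivative
     (bspline \<xi> (Suc r) i x / e i + (x - \<xi> i) / e i * (real (Suc r) * (w i - w (i+1))))
     + (- bspline \<xi> (Suc r) (i+1) x / e (i+1) + (\<xi> (i+r+3) - x) / e (i+1) * (real (Suc r) * (w (i+1) - w (i+2)))))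
      (at x within S)"
    unfolding eq using IH[of i] IH[of "i+1"]
    by (intro DERIV_add has_derivative_affine_mult) (simp_all del: bspline.simps(2))
  moreover have "(bspline \<xi> (Suc r) i x / e i + (x - \<xi> i) / e i * (real (Suc r) * (w i - w (i+1))))
     + (- bspline \<xi> (Suc r) (i+1) x / e (i+1) + (\<xi> (i+r+3) - x) / e (i+1) * (real (Suc r) * (w (i+1) - w (i+2))))
    = real (Suc r) * ((x - \<xi> i) / e i * (w i - w (i+1)) + (\<xi> (i+r+3) - x) / e (i+1) * (w (i+1) - w (i+2)))
      + (bspline \<xi> (Suc r) i x / e i - bspline \<xi> (Suc r) (i+1) x / e (i+1))"
    unfolding minus_divide_left[symmetric] by (rule alg)
  also have "\<dots> = real (Suc (Suc r)) * (bspline \<xi> (Suc r) i x / e i - bspline \<xi> (Suc r) (i+1) x / e (i+1))"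
    unfolding key by (rule alg2)
  finally show ?case by (simp add: e_def eval_nat_numeral del: bspline.simps)
qed

lemma bspline_0_right_derivative: "(bspline \<xi> 0 i has_field_derivative 0) (at_right x)"
proof -
  \<comment> \<open>The next of the two knots to the right of \<open>x\<close>, if any: the function
    is constant from \<open>x\<close> up to \<open>b\<close>.\<close>
  define b where "b = (if x < \<xi> i then \<xi> i else if x < \<xi> (i+1) then \<xi> (i+1) else x + 1)"
  have "x < b" by (auto simp: b_def)
  have "((\<lambda>_. bspline \<xi> 0 i x) has_field_derivative 0) (at x within {x..})" by simp
  then have "(bspline \<xi> 0 i has_field_derivative 0) (at x within {x..})"
  proof (rule has_field_derivative_transform_within)
    show "0 < b - x" using \<open>x < b\<close> by simp
    fix y assume "y \<in> {x..}" "dist y x < b - x"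
    then have "x \<le> y" "y < b" by (auto simp: dist_real_def)
    then show "bspline \<xi> 0 i x = bspline \<xi> 0 i y" by (auto simp: b_def split: if_splits)
  qed auto
  then show ?thesis by (rule has_field_derivative_subset) auto
qed

lemma bspline_0_derivative:
  assumes "x \<notin> range \<xi>"
  shows "(bspline \<xi> 0 i has_field_derivative 0) (at x)"
proof -
  define e where "e = min \<bar>x - \<xi> i\<bar> \<bar>x - \<xi> (i+1)\<bar>"
  have "e > 0" using assms by (auto simp: e_def)
  have "((\<lambda>_. bspline \<xi> 0 i x) has_field_derivative 0) (at x)" by simp
  then show ?thesis
  proof (rule has_field_derivative_transform_within)
    show "0 < e" by fact
    fix y assume "dist y x < e"
    then show "bspline \<xi> 0 i x = bspline \<xi> 0 i y" by (auto simp: e_def dist_real_def)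
  qed auto
qed

text \<open>The correction terms are the jump at \<open>x\<close>; it only occurs when \<open>x\<close> is a knot of multiplicity greater than \<open>r\<close>.\<close>

lemma bspline_left_limit:
  assumes "mono \<xi>"
  shows "(bspline \<xi> r i \<longlongrightarrow> bspline \<xi> r i x - of_bool (\<xi> i = x \<and> \<xi> (i+r) = x)
      + of_bool (\<xi> (i+1) = x \<and> \<xi> (i+r+1) = x)) (at_left x)"
proof (induction r arbitrary: i)
  case 0
  define a where "a = (if x > \<xi> (i+1) then \<xi> (i+1) else if x > \<xi> i then \<xi> i else x - 1)"
  have "a < x" by (auto simp: a_def)
  have m: "\<xi> i \<le> \<xi> (i+1)" by (auto intro: monoD[OF assms(1)])
  have "eventually (\<lambda>y. y \<in> {a<..<x}) (at_left x)"
    using \<open>a < x\<close> by (auto simp: eventually_at_left_field)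
  then have "eventually (\<lambda>y. bspline \<xi> 0 i y = bspline \<xi> 0 i x - of_bool (\<xi> i = x)
      + of_bool (\<xi> (i+1) = x)) (at_left x)"
    by (rule eventually_mono) (use m in \<open>auto simp: a_def split: if_splits\<close>)
  then show ?case by (auto intro: tendsto_eventually)
next
  case (Suc r)
  define J where "J = (\<lambda>i. of_bool (\<xi> i = x \<and> \<xi> (i+r) = x) - of_bool (\<xi> (i+1) = x \<and> \<xi> (i+r+1) = x) :: real)"
  have eq: "bspline \<xi> (Suc r) i = (\<lambda>x. (x - \<xi> i) / (\<xi> (i+r+1) - \<xi> i) * bspline \<xi> r i x +
     (\<xi> (i+r+2) - x) / (\<xi> (i+r+2) - \<xi> (i+1)) * bspline \<xi> r (i+1) x)"
    by (rule ext) simp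
  have IH: "(bspline \<xi> r i \<longlongrightarrow> bspline \<xi> r i x - J i) (at_left x)" for i
    using Suc[of i] by (simp add: J_def algebra_simps)
  define u v where "u = (\<lambda>x. (x - \<xi> i) / (\<xi> (i+r+1) - \<xi> i))"
    and "v = (\<lambda>x. (\<xi> (i+r+2) - x) / (\<xi> (i+r+2) - \<xi> (i+1)))"
  have uv: "(u \<longlongrightarrow> u x) (at_left x)" "(v \<longlongrightarrow> v x) (at_left x)"
    unfolding u_def v_def divide_inverse by (intro tendsto_intros)+
  have eq': "bspline \<xi> (Suc r) i = (\<lambda>x. u x * bspline \<xi> r i x + v x * bspline \<xi> r (i+1) x)"
    unfolding eq u_def v_def ..
  have lim: "(bspline \<xi> (Suc r) i \<longlongrightarrow> u x * (bspline \<xi> r i x - J i) + v x * (bspline \<xi> r (i+1) x - J (i+1))) (at_left x)"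
    unfolding eq' by (intro tendsto_intros uv IH)
  have m: "\<xi> i \<le> \<xi> (i+1)" "\<xi> (i+1) \<le> \<xi> (i+r+1)" "\<xi> (i+r+1) \<le> \<xi> (i+r+2)" "\<xi> i \<le> \<xi> (i+r)" 
    "\<xi> (i+r) \<le> \<xi> (i+r+1)" "\<xi> (i+1) \<le> \<xi> (i+2)" "\<xi> (i+2) \<le> \<xi> (i+r+2)"
    by (auto intro: monoD[OF assms(1)])
  \<comment> \<open>Wherever a jump \<open>J i\<close> or \<open>J (i+1)\<close> is non-zero, its
    weight at \<open>x\<close> is 0 or 1, so the jump either disappears or is passed on
    unchanged.\<close>
  have key: "u x * J i + v x * J (i+1)
     = of_bool (\<xi> i = x \<and> \<xi> (i+r+1) = x) - of_bool (\<xi> (i+1) = x \<and> \<xi> (i+r+2) = x)"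
    using m by (auto simp: J_def u_def v_def divide_eq_minus_1_iff)
  have "u x * (bspline \<xi> r i x - J i) + v x * (bspline \<xi> r (i+1) x - J (i+1))
    = bspline \<xi> (Suc r) i x - (u x * J i + v x * J (i+1))"
    unfolding eq' by (simp only: algebra_simps)
  also have "\<dots> = bspline \<xi> (Suc r) i x - of_bool (\<xi> i = x \<and> \<xi> (i+Suc r) = x)
      + of_bool (\<xi> (i+1) = x \<and> \<xi> (i+Suc r+1) = x)"
    unfolding key by (simp del: bspline.simps)
  finally show ?case using lim by (simp only:)
qed

text \<open>Differentiating the relation lowers the degree and turns the coefficients into multiples
  of \<open>c i - c (i - 1)\<close>. These vanish by induction, so \<open>c\<close> is constant, and
  the partition of unity makes the constant 0.\<close>

lemma bspline_local_independence:
  assumes "mono \<xi>" "u < v" "\<xi> (k + r) \<le> u" "v \<le> \<xi> (k + r + 1)"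
    and "\<And>x. u < x \<Longrightarrow> x < v \<Longrightarrow> (\<Sum>i=k..k+r. c i * bspline \<xi> r i x) = 0"
    and "i \<in> {k..k+r}"
  shows "c i = 0"
  using assms(3-6)
proof (induction r arbitrary: k c i)
  case 0
  obtain x where "u < x" "x < v" using dense[OF assms(2)] by blast
  then show ?case using 0(1,2,4) 0(3)[of x] by (auto split: if_splits)
next
  case (Suc r)
  define e where "e = (\<lambda>i. \<xi> (i+r+1) - \<xi> i)"
  have e_pos: "e i > 0" if "i \<in> {Suc k..Suc k+r}" for i
  proof -
    have "\<xi> i \<le> \<xi> (k + Suc r)" "\<xi> (k + Suc r + 1) \<le> \<xi> (i+r+1)"
      using that by (auto intro!: monoD[OF assms(1)])
    then show ?thesis using Suc.prems(1,2) assms(2) by (simp add: e_def)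
  qed
  have deriv: "(\<Sum>i=Suc k..Suc k+r. (c i - c (i - 1)) / e i * bspline \<xi> r i x) = 0" if x: "u < x" "x < v" for x
  proof -
    have idx: "i + 1 + r + 1 = i + r + 2" for i by simp
    \<comment> \<open>The interval lies inside one knot span, so two-sided derivatives exist
      throughout it.\<close>
    have "x \<notin> range \<xi>"
    proof
      assume "x \<in> range \<xi>"
      then obtain j where j: "x = \<xi> j" by auto
      have "\<xi> j \<le> \<xi> (k + Suc r)" if "j \<le> k + Suc r" using that by (auto intro!: monoD[OF assms(1)])
      moreover have "\<xi> (k + Suc r + 1) \<le> \<xi> j" if "\<not> j \<le> k + Suc r" using that by (auto intro!: monoD[OF assms(1)])
      ultimately show False using x j Suc.prems(1,2) by fastforce
    qed
    then have "(bspline \<xi> (Suc r) i has_field_derivative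
      real (Suc r) * (bspline \<xi> r i x / e i - bspline \<xi> r (i+1) x / e (i+1))) (at x)" for i
      unfolding e_def idx by (intro bspline_has_derivative assms(1) bspline_0_derivative)
    then have "((\<lambda>x. \<Sum>i=k..k+Suc r. c i * bspline \<xi> (Suc r) i x) has_field_derivative
       (\<Sum>i=k..k+Suc r. c i * (real (Suc r) * (bspline \<xi> r i x / e i - bspline \<xi> r (i+1) x / e (i+1))))) (at x)"
      by (intro DERIV_sum DERIV_cmult)
    moreover have "((\<lambda>x. \<Sum>i=k..k+Suc r. c i * bspline \<xi> (Suc r) i x) has_field_derivative 0) (at x)"
    proof (rule has_field_derivative_transform_within_open[where f="\<lambda>_. 0"])
      show "open {u<..<v}" "x \<in> {u<..<v}" using x by auto
    qed (use Suc.prems(3) in auto)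
    ultimately have s0: "(\<Sum>i=k..k+Suc r. c i * (real (Suc r) * (bspline \<xi> r i x / e i - bspline \<xi> r (i+1) x / e (i+1)))) = 0"
      by (rule DERIV_unique)
    let ?A = "\<Sum>i=k..k+Suc r. c i * (bspline \<xi> r i x / e i)"
    let ?B = "\<Sum>i=k..k+Suc r. c i * (bspline \<xi> r (i+1) x / e (i+1))"
    have "(\<Sum>i=k..k+Suc r. c i * (real (Suc r) * (bspline \<xi> r i x / e i - bspline \<xi> r (i+1) x / e (i+1))))
      = real (Suc r) * (?A - ?B)"
      unfolding sum_subtractf[symmetric] sum_distrib_left
      by (intro sum.cong refl) (simp only: right_diff_distrib mult.left_commute)
    then have AB: "?A - ?B = 0" using s0 by simp
    have A: "?A = (\<Sum>i=Suc k..Suc k+r. c i * (bspline \<xi> r i x / e i))"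
      using bspline_outside[OF assms(1), of x k r] Suc.prems(1) x by (simp add: sum.atLeast_Suc_atMost)
    have "?B = (\<Sum>i=Suc k..Suc (k+Suc r). c (i - 1) * (bspline \<xi> r i x / e i))"
      unfolding sum.shift_bounds_cl_Suc_ivl by simp
    also have "\<dots> = (\<Sum>i=Suc k..Suc k+r. c (i - 1) * (bspline \<xi> r i x / e i))"
      using bspline_outside[OF assms(1), of x "k + Suc (Suc r)" r] Suc.prems(2) x by simp
    finally have B: "?B = (\<Sum>i=Suc k..Suc k+r. c (i - 1) * (bspline \<xi> r i x / e i))" .
    have "(\<Sum>i=Suc k..Suc k+r. (c i - c (i - 1)) / e i * bspline \<xi> r i x)
      = (\<Sum>i=Suc k..Suc k+r. c i * (bspline \<xi> r i x / e i)) - (\<Sum>i=Suc k..Suc k+r. c (i - 1) * (bspline \<xi> r i x / e i))"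
      unfolding sum_subtractf[symmetric] by (intro sum.cong refl) (simp add: left_diff_distrib diff_divide_distrib)
    then show ?thesis using AB unfolding A B by simp
  qed
  have "(c i - c (i - 1)) / e i = 0" if "i \<in> {Suc k..Suc k+r}" for i
    by (rule Suc.IH[of "Suc k" "\<lambda>i. (c i - c (i - 1)) / e i"]) (use that Suc.prems(1,2) deriv in auto)
  then have step: "c i = c (i - 1)" if "i \<in> {Suc k..Suc k+r}" for i using e_pos[OF that] that by fastforce
  have const: "c i = c k" if "i \<in> {k..k+Suc r}" for i
  proof -
    have "c (k + j) = c k" if "j \<le> Suc r" for j
      using that
    proof (induction j)
      case (Suc j)
      then show ?case using step[of "k + Suc j"] by simp
    qed simp
    from this[of "i - k"] show ?thesis using that by auto
  qed
  obtain x where x: "u < x" "x < v" using dense[OF assms(2)] by blast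
  have "0 = (\<Sum>i=k..k+Suc r. c i * bspline \<xi> (Suc r) i x)"
    using Suc.prems(3)[OF x] by (rule sym)
  also have "\<dots> = (\<Sum>i=k..k+Suc r. c k * bspline \<xi> (Suc r) i x)"
    using const by (intro sum.cong refl arg_cong2[where f = "(*)"]) blast
  also have "\<dots> = c k * (\<Sum>i=k..k+Suc r. bspline \<xi> (Suc r) i x)"
    by (rule sum_distrib_left[symmetric])
  also have "(\<Sum>i=k..k+Suc r. bspline \<xi> (Suc r) i x) = 1"
    using x Suc.prems(1,2) by (intro sum_bspline_eq_1 assms(1)) linarith+
  finally show ?case using const[OF Suc.prems(4)] by simp
qed

text \<open>Local independence for arbitrary index sets: it suffices to look immediately to the
  right of \<open>x\<close>, inside the knot span that contains \<open>x\<close>.\<close>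

lemma bspline_sum_eq_0_imp:
  assumes "mono \<xi>" "finite I" "\<xi> (r + 1) \<le> u"
    and eq0: "\<And>x. u < x \<Longrightarrow> x < v \<Longrightarrow> (\<Sum>i\<in>I. c i * bspline \<xi> r i x) = 0"
    and i: "i \<in> I" "1 \<le> i" and x: "u < x" "x < v" "\<xi> i < x" "x < \<xi> (i + r + 1)"
  shows "c i = 0"
proof -
  \<comment> \<open>The last knot not beyond \<open>x\<close>. The lower bound \<open>r + 1\<close>,
    admissible since \<open>\<xi> (r + 1) \<le> u\<close>, leaves room for \<open>r\<close> further
    B-splines to the left; the upper bound loses nothing because
    \<open>x < \<xi> (i + r + 1)\<close>.\<close>
  define j where "j = Max {j\<in>{r+1..i+r}. \<xi> j \<le> x}"
  have fin: "finite {j\<in>{r+1..i+r}. \<xi> j \<le> x}" by simp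
  have "r + 1 \<in> {j\<in>{r+1..i+r}. \<xi> j \<le> x}" using i x assms(3) by auto
  then have j: "j \<in> {j\<in>{r+1..i+r}. \<xi> j \<le> x}"
    unfolding j_def using fin by (intro Max_in) blast+
  have j1: "x < \<xi> (j+1)"
  proof (cases "j = i + r")
    case False
    then have "j + 1 \<in> {r+1..i+r}" using j by auto
    moreover have "j + 1 \<notin> {j\<in>{r+1..i+r}. \<xi> j \<le> x}" using Max_ge[OF fin, of "j+1", folded j_def] by linarith
    ultimately show ?thesis by auto
  qed (use x in auto)
  have "i \<le> j"
  proof (rule ccontr)
    assume "\<not> i \<le> j"
    then have "\<xi> (j+1) \<le> \<xi> i" by (intro monoD[OF assms(1)]) auto
    then show False using j1 x by auto
  qed
  define k where "k = j - r"
  have k: "j = k + r" using j by (auto simp: k_def)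
  \<comment> \<open>\<open>I\<close> need not contain the whole window \<open>{k..k+r}\<close>, and
    its members outside the window vanish on the span.\<close>
  define c' where "c' = (\<lambda>i. if i \<in> I then c i else 0)"
  have "c' i = 0"
  proof (rule bspline_local_independence[OF assms(1), of x "min v (\<xi> (j+1))"])
    show "x < min v (\<xi> (j+1))" using x j1 by simp
    show "\<xi> (k + r) \<le> x" "min v (\<xi> (j+1)) \<le> \<xi> (k + r + 1)" using k j by auto
    show "i \<in> {k..k+r}" using \<open>i \<le> j\<close> k j by auto
    fix y assume y: "x < y" "y < min v (\<xi> (j+1))"
    have out: "bspline \<xi> r i y = 0" if "i \<notin> {k..k+r}" for i
    proof (rule bspline_outside[OF assms(1)])
      have "\<xi> (i+r+1) \<le> \<xi> j" if "i < k" using that k by (intro monoD[OF assms(1)]) auto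
      moreover have "\<xi> (j+1) \<le> \<xi> i" if "i > j" using that k by (intro monoD[OF assms(1)]) auto
      ultimately show "y < \<xi> i \<or> \<xi> (i+r+1) \<le> y" using that y j k by fastforce
    qed
    have "(\<Sum>i=k..k+r. c' i * bspline \<xi> r i y) = (\<Sum>i\<in>I \<union> {k..k+r}. c' i * bspline \<xi> r i y)"
      by (rule sum.mono_neutral_left) (use assms(2) out in auto)
    also have "\<dots> = (\<Sum>i\<in>I. c i * bspline \<xi> r i y)"
      by (rule sum.mono_neutral_cong_right) (use assms(2) in \<open>auto simp: c'_def\<close>)
    also have "\<dots> = 0" using eq0 x y by auto
    finally show "(\<Sum>i=k..k+r. c' i * bspline \<xi> r i y) = 0" .
  qed
  then show ?thesis using i by (simp add: c'_def)
qed

section \<open>Open knot vectors\<close>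

text \<open>Extends the knots monotonically beyond the range in which they are significant.\<close>

definition ext_knot :: "knot_vector \<Rightarrow> nat \<Rightarrow> real" where
  "ext_knot K i = (if i = 0 then 0 else if i \<le> num K + deg K + 1 then knot K i else 1)"

lemma open_knot_vector_ends:
  assumes "open_knot_vector K"
  shows "1 \<le> deg K" "deg K + 1 \<le> num K"
    "\<And>i. i \<le> deg K + 1 \<Longrightarrow> ext_knot K i = 0"
    "\<And>i. num K + 1 \<le> i \<Longrightarrow> ext_knot K i = 1"
proof -
  note K = assms[unfolded open_knot_vector_def Let_def]
  show "1 \<le> deg K" using K by auto
  show m: "deg K + 1 \<le> num K"
  proof (rule ccontr)
    assume "\<not> deg K + 1 \<le> num K"
    then have "num K + 1 \<in> {1..deg K + 1}" by auto
    with K have "knot K (num K + 1) = 0" by blast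
    moreover have "knot K (num K + 1) = 1" using K by simp
    ultimately show False by simp
  qed
  show "ext_knot K i = 0" if "i \<le> deg K + 1" for i using K m that by (auto simp: ext_knot_def)
  show "ext_knot K i = 1" if "num K + 1 \<le> i" for i using K m that by (auto simp: ext_knot_def)
qed

lemma mono_ext_knot:
  assumes "open_knot_vector K"
  shows "mono (ext_knot K)"
proof (rule mono_iff_le_Suc[THEN iffD2], rule allI)
  fix i
  note K = assms[unfolded open_knot_vector_def Let_def]
  show "ext_knot K i \<le> ext_knot K (Suc i)"
  proof (cases "1 \<le> i \<and> i \<le> num K + deg K")
    case True
    then show ?thesis using K by (auto simp: ext_knot_def)
  next
    case False
    then show ?thesis using open_knot_vector_ends(3)[OF assms, of i] open_knot_vector_ends(3)[OF assms, of "Suc i"]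
        open_knot_vector_ends(4)[OF assms, of i] open_knot_vector_ends(4)[OF assms, of "Suc i"] open_knot_vector_ends(1)[OF assms]
      by (cases "i = 0") auto
  qed
qed

lemma ext_knot_bounds:
  assumes "open_knot_vector K"
  shows "0 \<le> ext_knot K i" "ext_knot K i \<le> 1"
proof -
  have "ext_knot K 0 \<le> ext_knot K i" "ext_knot K i \<le> ext_knot K (i + num K + 1)"
    by (auto intro: monoD[OF mono_ext_knot[OF assms]])
  then show "0 \<le> ext_knot K i" "ext_knot K i \<le> 1"
    using open_knot_vector_ends(3)[OF assms, of 0] open_knot_vector_ends(4)[OF assms, of "i + num K + 1"] by auto
qed

lemma finite_range_ext_knot: "finite (range (ext_knot K))"
proof (rule finite_subset)
  show "range (ext_knot K) \<subseteq> {0, 1} \<union> knot K ` {..num K + deg K + 1}" by (auto simp: ext_knot_def)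
qed simp

text \<open>Equality would give \<open>deg K + 1\<close> coincident knots. The lower bound on
  \<open>i\<close> forces their common value above 0, the upper bound forces it below 1, so they
  would violate the multiplicity bound for internal knots.\<close>

lemma ext_knot_strict:
  assumes "open_knot_vector K" "2 \<le> i" "i \<le> num K"
  shows "ext_knot K i < ext_knot K (i + deg K)"
proof (rule ccontr)
  let ?z = "ext_knot K" and ?p = "deg K" and ?m = "num K"
  note K = assms(1)[unfolded open_knot_vector_def Let_def]
  note mono = monoD[OF mono_ext_knot[OF assms(1)]]
  assume "\<not> ?z i < ?z (i + ?p)"
  moreover have "?z i \<le> ?z (i + ?p)" by (auto intro: mono)
  ultimately have eq: "?z (i + ?p) = ?z i" by simp
  have p: "?p + 1 \<le> ?m" using open_knot_vector_ends[OF assms(1)] by simp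
  have "0 < ?z (?p + 2)" using K p by (auto simp: ext_knot_def)
  also have "\<dots> \<le> ?z (i + ?p)" using assms by (auto intro: mono)
  finally have pos: "0 < ?z i" using eq by simp
  have "?z i \<le> ?z ?m" using assms by (auto intro: mono)
  also have "\<dots> < 1" using K p by (auto simp: ext_knot_def)
  finally have less: "?z i < 1" .
  have "{i..i+?p} \<subseteq> {j\<in>{1..?m+?p+1}. knot K j = ?z i}"
  proof
    fix j assume j: "j \<in> {i..i+?p}"
    then have "?z i \<le> ?z j" "?z j \<le> ?z (i + ?p)" by (auto intro: mono)
    then have "?z j = ?z i" using eq by simp
    then show "j \<in> {j\<in>{1..?m+?p+1}. knot K j = ?z i}"
      using j assms by (auto simp: ext_knot_def split: if_splits)
  qed
  then have "card {i..i+?p} \<le> card {j\<in>{1..?m+?p+1}. knot K j = ?z i}"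
    by (intro card_mono) auto
  also have "\<dots> \<le> ?p" using K pos less by blast
  finally show False by simp
qed

section \<open>B- and D-splines of an open knot vector\<close>

lemma B_spline_ext_knot:
  assumes "1 \<le> i" "i \<le> num K"
  shows "B_spline K i x = bspline (ext_knot K) (deg K) i x"
  unfolding B_spline_def by (rule bspline_cong) (use assms in \<open>auto simp: ext_knot_def\<close>)

lemma D_spline_ext_knot:
  assumes "open_knot_vector K" "1 \<le> i" "i \<le> num K + 1"
  shows "D_spline K i x = real (deg K) / (ext_knot K (i + deg K) - ext_knot K i) * bspline (ext_knot K) (deg K - 1) i x"
proof -
  have p: "1 \<le> deg K" using open_knot_vector_ends[OF assms(1)] by simp
  have "bspline (knot K) (deg K - 1) i x = bspline (ext_knot K) (deg K - 1) i x"
    by (rule bspline_cong) (use assms p in \<open>auto simp: ext_knot_def\<close>)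
  then show ?thesis using assms p by (simp add: D_spline_def ext_knot_def)
qed

text \<open>The convention for the two missing D-splines comes for free: their knot differences are
  0, and so is division by them.\<close>

lemma D_spline_ends:
  assumes "open_knot_vector K"
  shows "D_spline K 1 x = 0" "D_spline K (num K + 1) x = 0"
  using assms open_knot_vector_ends[OF assms] by (simp_all add: D_spline_ext_knot)

lemma B_spline_outside:
  assumes "open_knot_vector K" "1 \<le> i" "i \<le> num K" "x < ext_knot K i \<or> ext_knot K (i + deg K + 1) \<le> x"
  shows "B_spline K i x = 0"
  unfolding B_spline_ext_knot[OF assms(2,3)] by (rule bspline_outside[OF mono_ext_knot]) (use assms in auto)

lemma D_spline_outside:
  assumes "open_knot_vector K" "1 \<le> i" "i \<le> num K" "x < ext_knot K i \<or> ext_knot K (i + deg K) \<le> x"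
  shows "D_spline K i x = 0"
proof -
  have "1 \<le> deg K" using open_knot_vector_ends[OF assms(1)] by simp
  then have "bspline (ext_knot K) (deg K - 1) i x = 0"
    by (intro bspline_outside mono_ext_knot) (use assms in auto)
  then show ?thesis using assms by (simp add: D_spline_ext_knot)
qed

lemma B_spline_has_derivative:
  assumes "open_knot_vector K" "1 \<le> i" "i \<le> num K"
    and "\<And>i. (bspline (ext_knot K) 0 i has_field_derivative 0) (at x within S)"
  shows "(B_spline K i has_field_derivative D_spline K i x - D_spline K (i+1) x) (at x within S)"
proof -
  obtain r where r: "deg K = Suc r" using open_knot_vector_ends(1)[OF assms(1)] by (cases "deg K") auto
  have 1: "(bspline (ext_knot K) (Suc r) i has_field_derivative
      real (Suc r) * (bspline (ext_knot K) r i x / (ext_knot K (i+r+1) - ext_knot K i)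
        - bspline (ext_knot K) r (i+1) x / (ext_knot K (i+r+2) - ext_knot K (i+1)))) (at x within S)"
    by (intro bspline_has_derivative mono_ext_knot assms)
  have 2: "B_spline K i = bspline (ext_knot K) (Suc r) i"
    using B_spline_ext_knot[OF assms(2,3)] unfolding r by (rule ext)
  have 3: "real (Suc r) * (bspline (ext_knot K) r i x / (ext_knot K (i+r+1) - ext_knot K i)
        - bspline (ext_knot K) r (i+1) x / (ext_knot K (i+r+2) - ext_knot K (i+1)))
     = D_spline K i x - D_spline K (i+1) x"
    using assms by (simp add: D_spline_ext_knot r right_diff_distrib)
  show ?thesis using 1 unfolding 2 3 .
qed

lemma B_spline_right_derivative:
  assumes "open_knot_vector K" "1 \<le> i" "i \<le> num K"
  shows "(B_spline K i has_field_derivative D_spline K i x - D_spline K (i+1) x) (at_right x)"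
  by (intro B_spline_has_derivative bspline_0_right_derivative assms)

text \<open>A jump needs \<open>deg K + 1\<close> coincident knots, which occur only at 0 and 1. The
  jump of the first B-spline is avoided by \<open>0 < x\<close>, that of the last one by
  \<open>i < num K\<close>.\<close>

lemma B_spline_left_continuous:
  assumes "open_knot_vector K" "1 \<le> i" "i < num K" "0 < x"
  shows "(B_spline K i \<longlongrightarrow> B_spline K i x) (at_left x)"
proof -
  have B: "B_spline K i = bspline (ext_knot K) (deg K) i"
    using B_spline_ext_knot[of i K] assms by auto
  have "\<not> (ext_knot K i = x \<and> ext_knot K (i + deg K) = x)"
    using assms ext_knot_strict[of K i] open_knot_vector_ends(3)[OF assms(1), of i] by (cases "i = 1") auto
  moreover have "\<not> (ext_knot K (i+1) = x \<and> ext_knot K (i + deg K + 1) = x)"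
    using assms ext_knot_strict[of K "i+1"] by auto
  ultimately show ?thesis
    using bspline_left_limit[OF mono_ext_knot[OF assms(1)], of "deg K" i x] unfolding B
    by (simp only: of_bool_eq add_0_right diff_0_right)
qed

text \<open>All functions vanish to the left of 0, so the value at 0 is exactly the jump given by
  \<open>bspline_left_limit\<close>.\<close>

lemma B_spline_0:
  assumes "open_knot_vector K" "1 \<le> i" "i \<le> num K"
  shows "B_spline K i 0 = of_bool (i = 1)"
proof -
  have B: "B_spline K i = bspline (ext_knot K) (deg K) i"
    using B_spline_ext_knot[of i K] assms by auto
  have "eventually (\<lambda>x::real. x < 0) (at_left 0)" by (auto simp: eventually_at_left_field intro: exI[of _ "-1"])
  then have "eventually (\<lambda>x. B_spline K i x = 0) (at_left 0)"
  proof (rule eventually_mono)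
    fix x :: real assume "x < 0"
    then have "x < ext_knot K i" using ext_knot_bounds[OF assms(1), of i] by simp
    then show "B_spline K i x = 0" using assms by (intro B_spline_outside) auto
  qed
  then have "(B_spline K i \<longlongrightarrow> 0) (at_left 0)" by (rule tendsto_eventually)
  then have "0 = bspline (ext_knot K) (deg K) i 0 - of_bool (ext_knot K i = 0 \<and> ext_knot K (i + deg K) = 0)
      + of_bool (ext_knot K (i + 1) = 0 \<and> ext_knot K (i + deg K + 1) = 0)"
    using bspline_left_limit[OF mono_ext_knot[OF assms(1)], of "deg K" i 0] unfolding B
    by (intro tendsto_unique) auto
  moreover have "ext_knot K i = 0 \<and> ext_knot K (i + deg K) = 0 \<longleftrightarrow> i = 1"
    using assms ext_knot_strict[of K i] open_knot_vector_ends(3)[OF assms(1), of i] 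
      open_knot_vector_ends(3)[OF assms(1), of "i + deg K"] by (cases "i = 1") auto
  moreover have "\<not> (ext_knot K (i + 1) = 0 \<and> ext_knot K (i + deg K + 1) = 0)"
    using assms ext_knot_strict[of K "i+1"] open_knot_vector_ends(4)[OF assms(1), of "i+1"] by (cases "i = num K") auto
  ultimately show ?thesis unfolding B by (simp only: of_bool_eq)
qed

text \<open>This includes the last B-spline, although its limit from the left at 1 is 1: the
  half-open intervals hide the boundary value there.\<close>

lemma B_spline_1:
  assumes "open_knot_vector K" "1 \<le> i" "i \<le> num K"
  shows "B_spline K i 1 = 0"
  using assms ext_knot_bounds[OF assms(1)] by (intro B_spline_outside) auto

text \<open>The fundamental theorem of calculus with the knots as exceptional points. It needs
  continuity on the closed interval, hence excludes the last B-spline, which jumps at 1.\<close>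

lemma B_spline_deriv_has_integral:
  assumes "open_knot_vector K" "1 \<le> i" "i < num K"
  shows "((\<lambda>x. D_spline K i x - D_spline K (i+1) x) has_integral - of_bool (i = 1)) {0..1}"
proof -
  let ?D = "\<lambda>x. D_spline K i x - D_spline K (i+1) x"
  have right: "continuous (at_right x) (B_spline K i)" for x
    using B_spline_right_derivative[OF assms(1,2)] assms(3)
    by (intro DERIV_continuous[where D = "?D x"]) auto
  have "continuous_on {0..1} (B_spline K i)"
  proof (intro continuous_on_eq_continuous_within[THEN iffD2] ballI)
    fix x :: real assume x: "x \<in> {0..1}"
    show "continuous (at x within {0..1}) (B_spline K i)"
    proof (cases "x = 0")
      case True
      have "at x within {0..1} \<le> at_right x" using True
        by (auto simp: at_within_Icc_at_right)
      then show ?thesis using right[of x] by (auto simp: continuous_within intro: tendsto_mono)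
    next
      case False
      then have "(B_spline K i \<longlongrightarrow> B_spline K i x) (at_left x)"
        using assms x by (intro B_spline_left_continuous) auto
      then have "isCont (B_spline K i) x"
        using right[of x] by (simp add: continuous_within continuous_at filterlim_split_at)
      then show ?thesis by (rule continuous_at_imp_continuous_at_within)
    qed
  qed
  then have "(?D has_integral B_spline K i 1 - B_spline K i 0) {0..1}"
  proof (rule fundamental_theorem_of_calculus_interior_strong[where S = "range (ext_knot K)", rotated 3])
    fix x :: real assume x: "x \<in> {0<..<1} - range (ext_knot K)"
    show "(B_spline K i has_vector_derivative ?D x) (at x)"
      unfolding has_real_derivative_iff_has_vector_derivative[symmetric]
      using assms x by (intro B_spline_has_derivative bspline_0_derivative) auto
  qed (auto intro: finite_range_ext_knot)
  then show ?thesis using assms by (simp add: B_spline_0 B_spline_1)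
qed

text \<open>By the preceding integrals, consecutive D-splines have equal integrals from index 2 on.
  The first B-spline starts the chain, since the D-spline before it is 0.\<close>

lemma D_spline_has_integral:
  assumes "open_knot_vector K" "1 \<le> i" "i \<le> num K + 1"
  shows "(D_spline K i has_integral of_bool (i \<noteq> 1 \<and> i \<noteq> num K + 1)) {0..1}"
proof -
  have m: "2 \<le> num K" using open_knot_vector_ends[OF assms(1)] by auto
  have *: "(D_spline K i has_integral 1) {0..1}" if "2 \<le> i" "i \<le> num K" for i
    using that
  proof (induction i rule: nat_induct_at_least)
    case base
    have "((\<lambda>x. - (D_spline K 1 x - D_spline K (1+1) x)) has_integral - (- of_bool (1 = (1::nat)))) {0..1}"
      using assms m by (intro has_integral_neg B_spline_deriv_has_integral) auto
    moreover have "(\<lambda>x. - (D_spline K 1 x - D_spline K (1+1) x)) = D_spline K 2"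
      using D_spline_ends(1)[OF assms(1)] by (auto simp: fun_eq_iff numeral_2_eq_2)
    ultimately show ?case by simp
  next
    case (Suc i)
    have "((\<lambda>x. D_spline K i x - (D_spline K i x - D_spline K (i+1) x)) has_integral 1 - (- of_bool (i = 1))) {0..1}"
      using assms Suc by (intro has_integral_diff B_spline_deriv_has_integral) auto
    then show ?case using Suc by simp
  qed
  consider "i = 1" | "i = num K + 1" | "2 \<le> i" "i \<le> num K" using assms by linarith
  then show ?thesis
  proof cases
    case 1
    then have "D_spline K i = (\<lambda>_. 0)" using D_spline_ends[OF assms(1)] by auto
    then show ?thesis using 1 by simp
  next
    case 2
    then have "D_spline K i = (\<lambda>_. 0)" using D_spline_ends[OF assms(1)] by auto
    then show ?thesis using 2 by simp
  next
    case 3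
    then show ?thesis using * by simp
  qed
qed

lemma B_spline_sum_eq_0_imp:
  assumes "open_knot_vector K" "I \<subseteq> {1..num K}" "0 \<le> u"
    and "\<And>x. u < x \<Longrightarrow> x < v \<Longrightarrow> (\<Sum>i\<in>I. c i * B_spline K i x) = 0"
    and i: "i \<in> I" and x: "u < x" "x < v" "ext_knot K i < x" "x < ext_knot K (i + deg K + 1)"
  shows "c i = 0"
proof (rule bspline_sum_eq_0_imp[OF mono_ext_knot[OF assms(1)], where r = "deg K" and I = I and u = u and v = v])
  show "finite I" using assms(2) finite_subset by blast
  show "ext_knot K (deg K + 1) \<le> u" using assms open_knot_vector_ends(3)[OF assms(1)] by simp
  fix y assume "u < y" "y < v"
  then have "(\<Sum>i\<in>I. c i * B_spline K i y) = 0" by (rule assms(4))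
  moreover have "(\<Sum>i\<in>I. c i * B_spline K i y) = (\<Sum>i\<in>I. c i * bspline (ext_knot K) (deg K) i y)"
    using assms(2) by (intro sum.cong) (auto simp: B_spline_ext_knot)
  ultimately show "(\<Sum>i\<in>I. c i * bspline (ext_knot K) (deg K) i y) = 0" by simp
qed (use assms in auto)

lemma D_spline_sum_eq_0_imp:
  assumes "open_knot_vector K" "I \<subseteq> {2..num K}" "0 \<le> u"
    and "\<And>x. u < x \<Longrightarrow> x < v \<Longrightarrow> (\<Sum>i\<in>I. c i * D_spline K i x) = 0"
    and i: "i \<in> I" and x: "u < x" "x < v" "ext_knot K i < x" "x < ext_knot K (i + deg K)"
  shows "c i = 0"
proof -
  have p: "1 \<le> deg K" using open_knot_vector_ends[OF assms(1)] by simp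
  let ?w = "\<lambda>i. real (deg K) / (ext_knot K (i + deg K) - ext_knot K i)"
  have "c i * ?w i = 0"
  proof (rule bspline_sum_eq_0_imp[OF mono_ext_knot[OF assms(1)], where r = "deg K - 1" and I = I and u = u and v = v and c = "\<lambda>i. c i * ?w i"])
    show "finite I" using assms(2) finite_subset by blast
    show "ext_knot K (deg K - 1 + 1) \<le> u" using assms p open_knot_vector_ends(3)[OF assms(1), of "deg K"] by simp
    fix y assume "u < y" "y < v"
    then have "(\<Sum>i\<in>I. c i * D_spline K i y) = 0" by (rule assms(4))
    moreover have "(\<Sum>i\<in>I. c i * D_spline K i y) = (\<Sum>i\<in>I. c i * ?w i * bspline (ext_knot K) (deg K - 1) i y)"
      using assms(2) by (intro sum.cong refl) (subst D_spline_ext_knot[OF assms(1)]; auto)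
    ultimately show "(\<Sum>i\<in>I. c i * ?w i * bspline (ext_knot K) (deg K - 1) i y) = 0" by simp
  qed (use assms p in auto)
  moreover have "?w i \<noteq> 0"
    using ext_knot_strict[OF assms(1), of i] assms(2) i p by auto
  ultimately show ?thesis by simp
qed

section \<open>Coarse univariate splines in the fine basis\<close>

lemma span_image_eq_sums:
  fixes f :: "'a \<Rightarrow> 'b::real_vector"
  assumes "finite I"
  shows "span (f ` I) = {\<Sum>i\<in>I. c i *\<^sub>R f i | c. True}"
proof
  show "span (f ` I) \<subseteq> {\<Sum>i\<in>I. c i *\<^sub>R f i | c. True}"
  proof (rule span_minimal)
    show "f ` I \<subseteq> {\<Sum>i\<in>I. c i *\<^sub>R f i | c. True}"
    proof
      fix y assume "y \<in> f ` I"
      then obtain j where "j \<in> I" "y = f j" by auto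
      then have "y = (\<Sum>i\<in>I. of_bool (i = j) *\<^sub>R f i)"
        using assms by (simp add: of_bool_def if_distrib[where f="\<lambda>c. c *\<^sub>R _"] sum.delta cong: if_cong)
      then show "y \<in> {\<Sum>i\<in>I. c i *\<^sub>R f i | c. True}" by (intro CollectI exI[of _ "\<lambda>i. of_bool (i = j)"]) simp
    qed
    show "subspace {\<Sum>i\<in>I. c i *\<^sub>R f i | c. True}"
    proof (rule subspaceI)
      show "0 \<in> {\<Sum>i\<in>I. c i *\<^sub>R f i | c. True}" by (intro CollectI exI[of _ "\<lambda>_. 0"]) simp
    next
      fix x y assume "x \<in> {\<Sum>i\<in>I. c i *\<^sub>R f i | c. True}" "y \<in> {\<Sum>i\<in>I. c i *\<^sub>R f i | c. True}"
      then obtain c d where "x = (\<Sum>i\<in>I. c i *\<^sub>R f i)" "y = (\<Sum>i\<in>I. d i *\<^sub>R f i)" by auto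
      then have "x + y = (\<Sum>i\<in>I. (c i + d i) *\<^sub>R f i)" by (simp add: scaleR_add_left sum.distrib)
      then show "x + y \<in> {\<Sum>i\<in>I. c i *\<^sub>R f i | c. True}" by (intro CollectI exI[of _ "\<lambda>i. c i + d i"]) simp
    next
      fix r x assume "x \<in> {\<Sum>i\<in>I. c i *\<^sub>R f i | c. True}"
      then obtain c where "x = (\<Sum>i\<in>I. c i *\<^sub>R f i)" by auto
      then have "r *\<^sub>R x = (\<Sum>i\<in>I. (r * c i) *\<^sub>R f i)" by (simp add: scaleR_sum_right)
      then show "r *\<^sub>R x \<in> {\<Sum>i\<in>I. c i *\<^sub>R f i | c. True}" by (intro CollectI exI[of _ "\<lambda>i. r * c i"]) simp
    qed
  qed
  show "{\<Sum>i\<in>I. c i *\<^sub>R f i | c. True} \<subseteq> span (f ` I)"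
    by (auto intro: span_sum span_scale span_base)
qed

lemma sum_fun_apply: "(\<Sum>i\<in>I. f i) x = (\<Sum>i\<in>I. f i x)"
  by (induction I rule: infinite_finite_induct) auto

lemma spline_space_eq: "spline_space K = {\<lambda>x. \<Sum>i=1..num K. c i * B_spline K i x | c. True}"
  unfolding spline_space_def span_image_eq_sums[OF finite_atLeastAtMost]
  by (simp add: fun_eq_iff sum_fun_apply scaleR_fun_def)

context
  fixes K L :: knot_vector
  assumes K: "open_knot_vector K" and L: "open_knot_vector L"
    and nested: "\<And>s. s \<in> spline_space K \<Longrightarrow> \<exists>s'\<in>spline_space L. \<forall>t. 0 < t \<and> t < 1 \<longrightarrow> s t = s' t"
begin

text \<open>The second identity is the right derivative of the first, with the same coefficients.
  One-sided derivatives make it valid at knots as well.\<close>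

lemma B_spline_nested:
  assumes "1 \<le> i" "i \<le> num K"
  obtains c where "\<And>t. 0 < t \<Longrightarrow> t < 1 \<Longrightarrow> B_spline K i t = (\<Sum>a=1..num L. c a * B_spline L a t)"
    and "\<And>t. 0 < t \<Longrightarrow> t < 1 \<Longrightarrow>
      D_spline K i t - D_spline K (i+1) t = (\<Sum>a=1..num L. c a * (D_spline L a t - D_spline L (a+1) t))"
proof -
  have "B_spline K i \<in> spline_space K"
    unfolding spline_space_def using assms by (intro span_base) auto
  from nested[OF this] obtain c where
    c: "\<And>t. 0 < t \<Longrightarrow> t < 1 \<Longrightarrow> B_spline K i t = (\<Sum>a=1..num L. c a * B_spline L a t)"
    unfolding spline_space_eq by auto
  show ?thesis
  proof (rule that[OF c])
    fix t :: real assume t: "0 < t" "t < 1"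
    have "((\<lambda>t. \<Sum>a=1..num L. c a * B_spline L a t) has_field_derivative
        (\<Sum>a=1..num L. c a * (D_spline L a t - D_spline L (a+1) t))) (at_right t)"
      by (intro DERIV_sum DERIV_cmult B_spline_right_derivative L) auto
    moreover have "eventually (\<lambda>s. B_spline K i s = (\<Sum>a=1..num L. c a * B_spline L a s)) (at_right t)"
      using t c by (auto simp: eventually_at_right_field intro!: exI[of _ 1])
    ultimately have "(B_spline K i has_field_derivative
        (\<Sum>a=1..num L. c a * (D_spline L a t - D_spline L (a+1) t))) (at_right t)"
      using c[OF t] by (subst has_field_derivative_cong_eventually)
    with B_spline_right_derivative[OF K assms, of t]
    show "D_spline K i t - D_spline K (i+1) t = (\<Sum>a=1..num L. c a * (D_spline L a t - D_spline L (a+1) t))"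
      by (rule has_field_derivative_unique) simp
  qed
qed

text \<open>Summation by parts; the boundary terms drop out because the D-splines at both ends are
  0.\<close>

lemma sum_D_spline_diff:
  "(\<Sum>a=1..num L. c a * (D_spline L a t - D_spline L (a+1) t)) = (\<Sum>a=2..num L. (c a - c (a - 1)) * D_spline L a t)"
proof -
  have m: "2 \<le> num L" using open_knot_vector_ends[OF L] by auto
  have "(\<Sum>a=1..num L. c a * (D_spline L a t - D_spline L (a+1) t))
    = (\<Sum>a=1..num L. c a * D_spline L a t) - (\<Sum>a=1..num L. c a * D_spline L (Suc a) t)"
    by (simp add: right_diff_distrib sum_subtractf)
  also have "(\<Sum>a=1..num L. c a * D_spline L a t) = (\<Sum>a=2..num L. c a * D_spline L a t)"
    using m D_spline_ends(1)[OF L] by (simp add: sum.atLeast_Suc_atMost numeral_2_eq_2)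
  also have "(\<Sum>a=1..num L. c a * D_spline L (Suc a) t) = (\<Sum>a=Suc 1..Suc (num L). c (a - 1) * D_spline L a t)"
    unfolding sum.shift_bounds_cl_Suc_ivl by simp
  also have "\<dots> = (\<Sum>a=2..num L. c (a - 1) * D_spline L a t)"
    using m D_spline_ends(2)[OF L] by (simp add: numeral_2_eq_2)
  finally show ?thesis by (simp add: sum_subtractf left_diff_distrib)
qed

text \<open>Only differences of neighbouring D-splines are derivatives of B-splines. A single one is
  reached by subtracting these differences successively, starting from the D-spline of index 1,
  which is 0.\<close>

lemma D_spline_nested:
  assumes "2 \<le> i" "i \<le> num K"
  shows "\<exists>c. \<forall>t. 0 < t \<and> t < 1 \<longrightarrow> D_spline K i t = (\<Sum>a=2..num L. c a * D_spline L a t)"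
  using assms
proof (induction i rule: nat_induct_at_least)
  case base
  obtain c where c: "\<And>t. 0 < t \<Longrightarrow> t < 1 \<Longrightarrow>
      D_spline K 1 t - D_spline K (1+1) t = (\<Sum>a=1..num L. c a * (D_spline L a t - D_spline L (a+1) t))"
    by (rule B_spline_nested[of 1]) (use base in auto)
  show ?case
  proof (intro exI allI impI)
    fix t :: real assume "0 < t \<and> t < 1"
    then have "D_spline K 2 t = - (\<Sum>a=2..num L. (c a - c (a - 1)) * D_spline L a t)"
      using c[of t] D_spline_ends(1)[OF K, of t] unfolding sum_D_spline_diff by (simp add: numeral_2_eq_2)
    then show "D_spline K 2 t = (\<Sum>a=2..num L. - (c a - c (a - 1)) * D_spline L a t)"
      by (simp only: sum_negf minus_mult_left[symmetric])
  qed
next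
  case (Suc i)
  obtain c where c: "\<And>t. 0 < t \<Longrightarrow> t < 1 \<Longrightarrow>
      D_spline K i t - D_spline K (i+1) t = (\<Sum>a=1..num L. c a * (D_spline L a t - D_spline L (a+1) t))"
    by (rule B_spline_nested[of i]) (use Suc in auto)
  obtain d where d: "\<And>t. 0 < t \<Longrightarrow> t < 1 \<Longrightarrow> D_spline K i t = (\<Sum>a=2..num L. d a * D_spline L a t)"
    using Suc by auto
  show ?case
  proof (intro exI allI impI)
    fix t :: real assume "0 < t \<and> t < 1"
    then have "D_spline K (Suc i) t = (\<Sum>a=2..num L. d a * D_spline L a t) - (\<Sum>a=2..num L. (c a - c (a - 1)) * D_spline L a t)"
      using c[of t] d[of t] unfolding sum_D_spline_diff by simp
    then show "D_spline K (Suc i) t = (\<Sum>a=2..num L. (d a - (c a - c (a - 1))) * D_spline L a t)"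
      by (simp only: sum_subtractf left_diff_distrib)
  qed
qed

text \<open>The first and the last coefficient of a spline are its boundary values. The last one is reached through
  the integral of the derivative.\<close>

lemma interior_B_spline_nested:
  assumes "2 \<le> i" "i \<le> num K - 1"
  shows "\<exists>c. \<forall>t. 0 < t \<and> t < 1 \<longrightarrow> B_spline K i t = (\<Sum>a=2..num L - 1. c a * B_spline L a t)"
proof -
  have m: "2 \<le> num L" using open_knot_vector_ends[OF L] by auto
  have i: "1 \<le> i" "i < num K" using assms by auto
  obtain c where c: "\<And>t. 0 < t \<Longrightarrow> t < 1 \<Longrightarrow> B_spline K i t = (\<Sum>a=1..num L. c a * B_spline L a t)"
    and c': "\<And>t. 0 < t \<Longrightarrow> t < 1 \<Longrightarrow>
      D_spline K i t - D_spline K (i+1) t = (\<Sum>a=1..num L. c a * (D_spline L a t - D_spline L (a+1) t))"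
    by (rule B_spline_nested[of i]) (use i in auto)
  have lim: "(B_spline M a \<longlongrightarrow> of_bool (a = 1)) (at_right 0)"
    if "open_knot_vector M" "1 \<le> a" "a \<le> num M" for M a
  proof -
    have "continuous (at_right 0) (B_spline M a)"
      using B_spline_right_derivative[OF that] by (rule DERIV_continuous)
    then show ?thesis using that by (simp add: continuous_within B_spline_0)
  qed
  have "((\<lambda>t. \<Sum>a=1..num L. c a * B_spline L a t) \<longlongrightarrow> (\<Sum>a=1..num L. c a * of_bool (a = 1))) (at_right 0)"
    by (intro tendsto_intros lim L) auto
  moreover have "eventually (\<lambda>t. (\<Sum>a=1..num L. c a * B_spline L a t) = B_spline K i t) (at_right 0)"
    using c by (auto simp: eventually_at_right_field intro!: exI[of _ 1])
  ultimately have "(B_spline K i \<longlongrightarrow> (\<Sum>a=1..num L. c a * of_bool (a = 1))) (at_right 0)"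
    by (rule Lim_transform_eventually)
  then have "(\<Sum>a=1..num L. c a * of_bool (a = 1)) = of_bool (i = 1)"
    using lim[OF K, of i] i by (intro tendsto_unique) auto
  then have c1: "c 1 = 0" using m assms by (simp add: sum.atLeast_Suc_atMost of_bool_def sum.delta)
  \<comment> \<open>Among the differences of neighbouring D-splines only the first and the last have
    non-zero integral, so integrating reads off \<open>c (num L) - c 1\<close>.\<close>
  have "((\<lambda>t. \<Sum>a=1..num L. c a * (D_spline L a t - D_spline L (a+1) t)) has_integral
      (\<Sum>a=1..num L. c a * (of_bool (a \<noteq> 1 \<and> a \<noteq> num L + 1) - of_bool (a + 1 \<noteq> 1 \<and> a + 1 \<noteq> num L + 1)))) {0..1}"
    by (intro has_integral_sum has_integral_mult_right has_integral_diff D_spline_has_integral L) auto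
  moreover have "((\<lambda>t. \<Sum>a=1..num L. c a * (D_spline L a t - D_spline L (a+1) t)) has_integral
      - of_bool (i = 1)) {0..1}"
    using B_spline_deriv_has_integral[OF K i]
    by (rule has_integral_spike_finite[of "{0, 1}", rotated 2]) (use c' in \<open>auto simp: less_le\<close>)
  ultimately have "(\<Sum>a=1..num L. c a * (of_bool (a \<noteq> 1 \<and> a \<noteq> num L + 1) - of_bool (a + 1 \<noteq> 1 \<and> a + 1 \<noteq> num L + 1))) = - of_bool (i = 1)"
    by (rule has_integral_unique)
  moreover have "(\<Sum>a=1..num L. c a * (of_bool (a \<noteq> 1 \<and> a \<noteq> num L + 1) - of_bool (a + 1 \<noteq> 1 \<and> a + 1 \<noteq> num L + 1)))
     = (\<Sum>a=1..num L. (if a = num L then c a else 0) - (if a = 1 then c a else 0))"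
    using m by (intro sum.cong) auto
  moreover have "\<dots> = c (num L) - c 1"
    using m by (simp add: sum_subtractf sum.delta)
  ultimately have cm: "c (num L) = 0" using c1 assms by simp
  have "B_spline K i t = (\<Sum>a=2..num L - 1. c a * B_spline L a t)" if "0 < t" "t < 1" for t
    unfolding c[OF that]
  proof (rule sum.mono_neutral_right)
    show "\<forall>a\<in>{1..num L} - {2..num L - 1}. c a * B_spline L a t = 0"
    proof
      fix a assume "a \<in> {1..num L} - {2..num L - 1}"
      then have "a = 1 \<or> a = num L" by auto
      then show "c a * B_spline L a t = 0" using c1 cm by auto
    qed
  qed auto
  then show ?thesis by blast
qed

end

section \<open>Coefficients of spline forms\<close>

definition form_range :: "('n::finite \<Rightarrow> knot_vector) \<Rightarrow> 'n set \<Rightarrow> 'n \<Rightarrow> nat set" where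
  "form_range K \<alpha> q = (if q \<in> \<alpha> then {2..num (K q)} else {2..num (K q) - 1})"

text \<open>As a \<open>PiE\<close> set it fits both the expansion of a product of sums and the
  direction-by-direction induction of \<open>tensor_independence\<close>.\<close>

definition form_index :: "('n::finite \<Rightarrow> knot_vector) \<Rightarrow> 'n set \<Rightarrow> ('n \<Rightarrow> nat) set" where
  "form_index K \<alpha> = PiE UNIV (form_range K \<alpha>)"

definition factor :: "('n::finite \<Rightarrow> knot_vector) \<Rightarrow> 'n set \<Rightarrow> 'n \<Rightarrow> nat \<Rightarrow> real \<Rightarrow> real" where
  "factor K \<alpha> q a = (if q \<in> \<alpha> then D_spline (K q) a else B_spline (K q) a)"

type_synonym 'n coefs = "'n set \<Rightarrow> ('n \<Rightarrow> nat) \<Rightarrow> real"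

definition form_of :: "('n::finite \<Rightarrow> knot_vector) \<Rightarrow> 'n coefs \<Rightarrow> 'n form" where
  "form_of K c = (\<lambda>\<gamma> x. \<Sum>i\<in>form_index K \<gamma>. c \<gamma> i * spline_form K \<gamma> i \<gamma> x)"

text \<open>Coefficients vanish outside the admissible indices, so that a missing neighbour counts
  as 0 in differences and \<open>form_of\<close> can be injective. The predicate \<open>P\<close> is
  there to carry support conditions.\<close>

definition coef_space ::
    "('n::finite \<Rightarrow> knot_vector) \<Rightarrow> ('n set \<Rightarrow> ('n \<Rightarrow> nat) \<Rightarrow> bool) \<Rightarrow> nat \<Rightarrow> 'n coefs set" where
  "coef_space K P k = {c. \<forall>\<alpha> i. c \<alpha> i \<noteq> 0 \<longrightarrow> card \<alpha> = k \<and> i \<in> form_index K \<alpha> \<and> P \<alpha> i}"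

lemma form_index_iff: "i \<in> form_index K \<alpha> \<longleftrightarrow> (\<forall>q. i q \<in> form_range K \<alpha> q)"
  by (auto simp: form_index_def PiE_def Pi_def extensional_def)

lemma finite_form_index [simp]: "finite (form_index K \<alpha>)"
  unfolding form_index_def by (rule finite_PiE) (auto simp: form_range_def)

lemma spline_form_apply:
  "spline_form K \<alpha> i \<gamma> x = (if \<gamma> = \<alpha> \<and> x \<in> unit_cube then \<Prod>q\<in>UNIV. factor K \<alpha> q (i q) (x $ q) else 0)"
  by (simp add: spline_form_def factor_def)

lemma form_of_apply:
  "form_of K c \<gamma> x = (if x \<in> unit_cube then \<Sum>i\<in>form_index K \<gamma>. c \<gamma> i * (\<Prod>q\<in>UNIV. factor K \<gamma> q (i q) (x $ q)) else 0)"
  by (simp add: form_of_def spline_form_apply)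

lemma form_of_add: "form_of K (c + d) = form_of K c + form_of K d"
  by (auto simp: form_of_def fun_eq_iff distrib_right sum.distrib)

lemma form_of_scale: "form_of K (r *\<^sub>R c) = r *\<^sub>R form_of K c"
  by (auto simp: form_of_def fun_eq_iff sum_distrib_left mult.assoc)

lemma form_of_0 [simp]: "form_of K 0 = 0"
  by (auto simp: form_of_def fun_eq_iff)

lemma subspace_coef_space: "subspace (coef_space K P k)"
  by (rule subspaceI) (auto simp: coef_space_def, (metis add.left_neutral)+)

lemma subspace_form_of: "subspace (form_of K ` coef_space K P k)"
proof (rule subspaceI)
  show "0 \<in> form_of K ` coef_space K P k"
    using subspace_0[OF subspace_coef_space] by (intro image_eqI[where x = 0]) auto
  show "x + y \<in> form_of K ` coef_space K P k"
    if "x \<in> form_of K ` coef_space K P k" "y \<in> form_of K ` coef_space K P k" for x y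
    using that subspace_add[OF subspace_coef_space] by (fastforce simp: form_of_add[symmetric])
  show "r *\<^sub>R x \<in> form_of K ` coef_space K P k" if "x \<in> form_of K ` coef_space K P k" for r x
    using that subspace_scale[OF subspace_coef_space] by (fastforce simp: form_of_scale[symmetric])
qed

lemma form_of_single:
  assumes "i \<in> form_index K \<alpha>"
  shows "form_of K (\<lambda>\<gamma> j. of_bool (\<gamma> = \<alpha> \<and> j = i)) = spline_form K \<alpha> i"
proof (intro ext)
  fix \<gamma> x
  show "form_of K (\<lambda>\<gamma> j. of_bool (\<gamma> = \<alpha> \<and> j = i)) \<gamma> x = spline_form K \<alpha> i \<gamma> x"
  proof (cases "\<gamma> = \<alpha>")
    case True
    have "(\<Sum>j\<in>form_index K \<alpha>. of_bool (j = i) * spline_form K \<alpha> j \<alpha> x) 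
       = (\<Sum>j\<in>form_index K \<alpha>. if j = i then spline_form K \<alpha> j \<alpha> x else 0)"
      by (intro sum.cong) auto
    then show ?thesis using True assms by (simp add: form_of_def sum.delta)
  qed (simp add: form_of_def spline_form_apply)
qed

lemma span_spline_forms:
  "span {spline_form K \<alpha> i | \<alpha> i. card \<alpha> = k \<and> i \<in> form_index K \<alpha> \<and> P \<alpha> i} = form_of K ` coef_space K P k"
  (is "span ?S = _")
proof
  show "span ?S \<subseteq> form_of K ` coef_space K P k"
  proof (rule span_minimal[OF _ subspace_form_of])
    show "?S \<subseteq> form_of K ` coef_space K P k"
    proof
      fix \<omega> assume "\<omega> \<in> ?S"
      then obtain \<alpha> i where "\<omega> = spline_form K \<alpha> i" "card \<alpha> = k" "i \<in> form_index K \<alpha>" "P \<alpha> i" by auto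
      then show "\<omega> \<in> form_of K ` coef_space K P k"
        by (intro image_eqI[where x = "\<lambda>\<gamma> j. of_bool (\<gamma> = \<alpha> \<and> j = i)"]) (auto simp: form_of_single coef_space_def)
    qed
  qed
  show "form_of K ` coef_space K P k \<subseteq> span ?S"
  proof
    fix \<omega> assume "\<omega> \<in> form_of K ` coef_space K P k"
    then obtain c where c: "c \<in> coef_space K P k" "\<omega> = form_of K c" by auto
    have "\<omega> = (\<Sum>\<alpha>\<in>UNIV. \<Sum>i\<in>form_index K \<alpha>. c \<alpha> i *\<^sub>R spline_form K \<alpha> i)"
    proof (intro ext)
      fix \<gamma> x
      have "(\<Sum>\<alpha>\<in>UNIV. \<Sum>i\<in>form_index K \<alpha>. c \<alpha> i *\<^sub>R spline_form K \<alpha> i) \<gamma> x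
        = (\<Sum>\<alpha>\<in>UNIV. \<Sum>i\<in>form_index K \<alpha>. c \<alpha> i * spline_form K \<alpha> i \<gamma> x)"
        by (simp add: sum_fun_apply)
      also have "\<dots> = (\<Sum>\<alpha>\<in>UNIV. if \<alpha> = \<gamma> then \<Sum>i\<in>form_index K \<alpha>. c \<alpha> i * spline_form K \<alpha> i \<gamma> x else 0)"
        by (intro sum.cong) (auto simp: spline_form_apply)
      also have "\<dots> = form_of K c \<gamma> x" by (simp add: form_of_def)
      finally show "\<omega> \<gamma> x = (\<Sum>\<alpha>\<in>UNIV. \<Sum>i\<in>form_index K \<alpha>. c \<alpha> i *\<^sub>R spline_form K \<alpha> i) \<gamma> x"
        using c by simp
    qed
    also have "\<dots> \<in> span ?S"
    proof (intro span_sum)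
      fix \<alpha> i
      show "c \<alpha> i *\<^sub>R spline_form K \<alpha> i \<in> span ?S"
      proof (cases "c \<alpha> i = 0")
        case False
        then show ?thesis using c by (intro span_scale span_base) (auto simp: coef_space_def)
      qed (simp add: span_zero)
    qed
    finally show "\<omega> \<in> span ?S" .
  qed
qed

lemma fst_spline_basis:
  "fst ` {\<beta> \<in> spline_basis \<Xi> l k. Q (snd \<beta>)}
    = {spline_form (\<Xi> l) \<alpha> i | \<alpha> i. card \<alpha> = k \<and> i \<in> form_index (\<Xi> l) \<alpha> \<and> Q (spline_supp (\<Xi> l) \<alpha> i)}"
  unfolding spline_basis_def form_index_iff form_range_def by (auto 4 4 simp: image_iff)

lemma span_spline_basis: "span (fst ` spline_basis \<Xi> l k) = form_of (\<Xi> l) ` coef_space (\<Xi> l) (\<lambda>_ _. True) k"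
  using fst_spline_basis[of \<Xi> l k "\<lambda>_. True"] span_spline_forms[of "\<Xi> l" k "\<lambda>_ _. True"] by simp

lemma sub_space_eq:
  "sub_space \<Xi> \<Omega> l l' k = form_of (\<Xi> l) ` coef_space (\<Xi> l) (\<lambda>\<alpha> i. spline_supp (\<Xi> l) \<alpha> i \<subseteq> \<Omega> l') k"
  unfolding sub_space_def sub_basis_def fst_spline_basis[of \<Xi> l k "\<lambda>S. S \<subseteq> \<Omega> l'"] by (rule span_spline_forms)

text \<open>One direction is split off at a time. \<open>L q\<close> stands for the indices whose
  coefficients are determined by values on \<open>U q\<close>; the remaining functions may vanish
  there, so nothing is claimed about them.\<close>

lemma tensor_independence:
  fixes \<phi> :: "'q \<Rightarrow> 'a \<Rightarrow> real \<Rightarrow> real" and c :: "('q \<Rightarrow> 'a) \<Rightarrow> real"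
  assumes "finite Q" "\<And>q. q \<in> Q \<Longrightarrow> finite (I q)"
    and indep: "\<And>q d a. \<lbrakk>q \<in> Q; \<And>t. t \<in> U q \<Longrightarrow> (\<Sum>a\<in>I q. d a * \<phi> q a t) = 0; a \<in> L q\<rbrakk> \<Longrightarrow> d a = 0"
    and "\<And>x. (\<And>q. q \<in> Q \<Longrightarrow> x q \<in> U q) \<Longrightarrow> (\<Sum>i\<in>PiE Q I. c i * (\<Prod>q\<in>Q. \<phi> q (i q) (x q))) = 0"
    and "i \<in> PiE Q L"
  shows "c i = 0"
  using assms
proof (induction Q arbitrary: c i rule: finite_induct)
  case empty
  then show ?case by simp
next
  case (insert q Q)
  have fin: "finite (PiE Q I)" using insert.hyps insert.prems(1) by (intro finite_PiE) auto
  define j where "j = i(q := undefined)"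
  have j: "j \<in> PiE Q L" "i = j(q := i q)" "i q \<in> L q"
    using insert.prems(4) insert.hyps by (auto simp: j_def PiE_def extensional_def Pi_def)
  have "c (j(q := i q)) = 0"
  proof (rule insert.IH[of "\<lambda>j. c (j(q := i q))"])
    fix x assume x: "\<And>q. q \<in> Q \<Longrightarrow> x q \<in> U q"
    show "(\<Sum>j\<in>PiE Q I. c (j(q := i q)) * (\<Prod>q\<in>Q. \<phi> q (j q) (x q))) = 0"
    \<comment> \<open>With the coordinates in \<open>Q\<close> fixed at \<open>x\<close>, the inner
      sum is the coefficient of \<open>\<phi> q a\<close> in a relation in the single variable
      \<open>t\<close>.\<close>
    proof (rule insert.prems(2)[of q "\<lambda>a. \<Sum>j\<in>PiE Q I. c (j(q := a)) * (\<Prod>q\<in>Q. \<phi> q (j q) (x q))"])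
      fix t assume t: "t \<in> U q"
      have "0 = (\<Sum>i\<in>PiE (insert q Q) I. c i * (\<Prod>q'\<in>insert q Q. \<phi> q' (i q') ((x(q := t)) q')))"
        using x t by (intro insert.prems(3)[symmetric]) auto
      also have "\<dots> = (\<Sum>(a, j)\<in>I q \<times> PiE Q I. c (j(q := a)) * (\<Prod>q'\<in>insert q Q. \<phi> q' ((j(q := a)) q') ((x(q := t)) q')))"
        unfolding PiE_insert_eq using insert.hyps
        by (subst sum.reindex[OF inj_combinator]) (auto simp: case_prod_unfold)
      also have "\<dots> = (\<Sum>(a, j)\<in>I q \<times> PiE Q I. c (j(q := a)) * (\<Prod>q\<in>Q. \<phi> q (j q) (x q)) * \<phi> q a t)"
      proof (intro sum.cong refl, clarify)
        fix a j
        have "(\<Prod>q'\<in>Q. \<phi> q' ((j(q := a)) q') ((x(q := t)) q')) = (\<Prod>q\<in>Q. \<phi> q (j q) (x q))"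
          using insert.hyps by (intro prod.cong) auto
        then show "c (j(q := a)) * (\<Prod>q'\<in>insert q Q. \<phi> q' ((j(q := a)) q') ((x(q := t)) q'))
          = c (j(q := a)) * (\<Prod>q\<in>Q. \<phi> q (j q) (x q)) * \<phi> q a t"
          using insert.hyps by simp
      qed
      also have "\<dots> = (\<Sum>a\<in>I q. (\<Sum>j\<in>PiE Q I. c (j(q := a)) * (\<Prod>q\<in>Q. \<phi> q (j q) (x q))) * \<phi> q a t)"
        by (simp add: sum.cartesian_product[symmetric] sum_distrib_right)
      finally show "(\<Sum>a\<in>I q. (\<Sum>j\<in>PiE Q I. c (j(q := a)) * (\<Prod>q\<in>Q. \<phi> q (j q) (x q))) * \<phi> q a t) = 0" by simp
    qed (use j in auto)
  next
    fix q' d a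
    assume "q' \<in> Q" "\<And>t. t \<in> U q' \<Longrightarrow> (\<Sum>a\<in>I q'. d a * \<phi> q' a t) = 0" "a \<in> L q'"
    then show "d a = 0" by (intro insert.prems(2)[of q' d a]) blast+
  qed (use insert.prems(1) j(1) in auto)
  then show ?case using j by simp
qed

section \<open>Supports and locality of spline forms\<close>

definition factor_end :: "('n::finite \<Rightarrow> knot_vector) \<Rightarrow> 'n set \<Rightarrow> 'n \<Rightarrow> nat \<Rightarrow> real" where
  "factor_end K \<alpha> q a = ext_knot (K q) (if q \<in> \<alpha> then a + deg (K q) else a + deg (K q) + 1)"

context
  fixes K :: "'n::finite \<Rightarrow> knot_vector"
  assumes K: "\<And>q. open_knot_vector (K q)"
begin

lemma spline_supp_eq:
  assumes "i \<in> form_index K \<alpha>"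
  shows "spline_supp K \<alpha> i = {x. \<forall>q. ext_knot (K q) (i q) < x $ q \<and> x $ q < factor_end K \<alpha> q (i q)}"
proof -
  have "knot (K q) (i q) = ext_knot (K q) (i q)"
    "knot (K q) (if q \<in> \<alpha> then i q + deg (K q) else i q + deg (K q) + 1) = factor_end K \<alpha> q (i q)" for q
    using assms[unfolded form_index_iff, rule_format, of q]
    by (auto simp: form_range_def factor_end_def ext_knot_def split: if_splits)
  then show ?thesis unfolding spline_supp_def by simp
qed

lemma ext_knot_less_factor_end:
  assumes "a \<in> form_range K \<alpha> q"
  shows "ext_knot (K q) a < factor_end K \<alpha> q a"
proof -
  have "ext_knot (K q) a < ext_knot (K q) (a + deg (K q))"
    using assms by (intro ext_knot_strict K) (auto simp: form_range_def split: if_splits)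
  moreover have "ext_knot (K q) (a + deg (K q)) \<le> ext_knot (K q) (a + deg (K q) + 1)"
    by (intro monoD[OF mono_ext_knot] K) simp
  ultimately show ?thesis by (auto simp: factor_end_def)
qed

lemma factor_outside:
  assumes "a \<in> form_range K \<alpha> q" "t < ext_knot (K q) a \<or> factor_end K \<alpha> q a \<le> t"
  shows "factor K \<alpha> q a t = 0"
  using assms K[of q] by (auto simp: factor_def form_range_def factor_end_def B_spline_outside D_spline_outside split: if_splits)

lemma spline_supp_subset_cube:
  assumes "i \<in> form_index K \<alpha>"
  shows "spline_supp K \<alpha> i \<subseteq> unit_cube"
proof
  fix x assume "x \<in> spline_supp K \<alpha> i"
  then have "ext_knot (K q) (i q) < x $ q" "x $ q < factor_end K \<alpha> q (i q)" for q
    unfolding spline_supp_eq[OF assms] by auto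
  moreover have "0 \<le> ext_knot (K q) (i q)" "factor_end K \<alpha> q (i q) \<le> 1" for q
    by (auto simp: factor_end_def ext_knot_bounds K)
  ultimately show "x \<in> unit_cube" unfolding unit_cube_def by (blast intro: le_less_trans less_le_trans)
qed

lemma spline_supp_eq_box:
  assumes "i \<in> form_index K \<alpha>"
  shows "spline_supp K \<alpha> i = box (\<chi> q. ext_knot (K q) (i q)) (\<chi> q. factor_end K \<alpha> q (i q))"
  unfolding spline_supp_eq[OF assms] by (auto simp: mem_box_cart)

text \<open>The factors may be non-zero at the left ends of their open supports. Hence
  \<open>closure W\<close> is needed, not merely \<open>W\<close>.\<close>

lemma form_of_outside:
  assumes "c \<in> coef_space K (\<lambda>\<alpha> i. spline_supp K \<alpha> i \<subseteq> W) k" "x \<notin> closure W"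
  shows "form_of K c \<gamma> x = 0"
proof -
  have "c \<gamma> i * (\<Prod>q\<in>UNIV. factor K \<gamma> q (i q) (x $ q)) = 0" if i: "i \<in> form_index K \<gamma>" for i
  proof (rule ccontr)
    assume *: "c \<gamma> i * (\<Prod>q\<in>UNIV. factor K \<gamma> q (i q) (x $ q)) \<noteq> 0"
    then have "ext_knot (K q) (i q) \<le> x $ q \<and> x $ q \<le> factor_end K \<gamma> q (i q)" for q
      using factor_outside[of "i q" \<gamma> q "x $ q"] i by (force simp: form_index_iff)
    then have "x \<in> cbox (\<chi> q. ext_knot (K q) (i q)) (\<chi> q. factor_end K \<gamma> q (i q))"
      by (simp add: mem_box_cart)
    moreover have "box (\<chi> q. ext_knot (K q) (i q)) (\<chi> q. factor_end K \<gamma> q (i q)) \<noteq> {}"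
      using ext_knot_less_factor_end i unfolding interval_ne_empty_cart by (auto simp: form_index_iff)
    ultimately have "x \<in> closure (spline_supp K \<gamma> i)"
      unfolding spline_supp_eq_box[OF i] by simp
    moreover have "spline_supp K \<gamma> i \<subseteq> W" using assms(1) * by (auto simp: coef_space_def)
    ultimately show False using assms(2) closure_mono by blast
  qed
  then show ?thesis unfolding form_of_apply by (simp only: sum.neutral if_cancel cong: sum.cong) simp
qed

lemma factor_sum_eq_0_imp:
  assumes "0 \<le> u" "\<And>t. u < t \<Longrightarrow> t < v \<Longrightarrow> (\<Sum>a\<in>form_range K \<alpha> q. d a * factor K \<alpha> q a t) = 0"
    and "a \<in> form_range K \<alpha> q" "u < t" "t < v" "ext_knot (K q) a < t" "t < factor_end K \<alpha> q a"
  shows "d a = 0"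
proof (cases "q \<in> \<alpha>")
  case True
  show ?thesis
    by (rule D_spline_sum_eq_0_imp[OF K[of q], of "form_range K \<alpha> q" u v d a t])
       (use True assms in \<open>auto simp: form_range_def factor_def factor_end_def\<close>)
next
  case False
  show ?thesis
    by (rule B_spline_sum_eq_0_imp[OF K[of q], of "form_range K \<alpha> q" u v d a t])
       (use False assms in \<open>auto simp: form_range_def factor_def factor_end_def\<close>)
qed

text \<open>A support not inside \<open>W\<close> is not inside \<open>closure W\<close> either,
  since an open subset of the closure lies in its interior, which is \<open>W\<close>. Part of the
  support therefore lies where the form vanishes, and local independence there forces the
  coefficient to be 0.\<close>

lemma form_of_local:
  assumes c: "c \<in> coef_space K P k"
    and W: "W = interior (closure W)"
    and zero: "\<And>\<gamma> x. x \<in> unit_cube \<Longrightarrow> x \<notin> closure W \<Longrightarrow> form_of K c \<gamma> x = 0"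
  shows "c \<in> coef_space K (\<lambda>\<alpha> i. spline_supp K \<alpha> i \<subseteq> W) k"
proof -
  have "spline_supp K \<alpha> i \<subseteq> W" if "c \<alpha> i \<noteq> 0" for \<alpha> i
  proof (rule ccontr)
    have i: "i \<in> form_index K \<alpha>" using c that by (auto simp: coef_space_def)
    let ?S = "spline_supp K \<alpha> i"
    have op: "open ?S" unfolding spline_supp_eq_box[OF i] by (rule open_box)
    assume "\<not> ?S \<subseteq> W"
    then have "\<not> ?S \<subseteq> closure W" using interior_maximal[OF _ op] W by blast
    then obtain x where x: "x \<in> ?S - closure W" by auto
    moreover have "open (?S - closure W)" using op by (intro open_Diff) auto
    ultimately obtain e where "e > 0" and e: "ball x e \<subseteq> ?S - closure W"
      by (meson openE)
    from rational_boxes[OF \<open>e > 0\<close>, of x] obtain a b where "x \<in> box a b" "box a b \<subseteq> ball x e"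
      by blast
    with e have ab: "x \<in> box a b" "box a b \<subseteq> ?S - closure W" by auto
    have sub: "box a b \<subseteq> unit_cube - closure W" using ab spline_supp_subset_cube[OF i] by auto
    \<comment> \<open>The box around \<open>x\<close> supplies the intervals, cut off at 0 as
      univariate independence requires. The indices in \<open>L\<close> are those whose univariate
      supports contain the coordinates of \<open>x\<close>.\<close>
    have "c \<alpha> i = 0"
    proof (rule tensor_independence[where Q = UNIV and I = "form_range K \<alpha>" and \<phi> = "factor K \<alpha>"
            and U = "\<lambda>q. {max 0 (a $ q) <..< b $ q}"
            and L = "\<lambda>q. {a' \<in> form_range K \<alpha> q. ext_knot (K q) a' < x $ q \<and> x $ q < factor_end K \<alpha> q a'}"])
      fix y :: "'n \<Rightarrow> real" assume "\<And>q. q \<in> UNIV \<Longrightarrow> y q \<in> {max 0 (a $ q) <..< b $ q}"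
      then have "(\<chi> q. y q) \<in> box a b" by (auto simp: mem_box_cart)
      then have "(\<chi> q. y q) \<in> unit_cube" "(\<chi> q. y q) \<notin> closure W" using sub by auto
      then show "(\<Sum>i\<in>PiE UNIV (form_range K \<alpha>). c \<alpha> i * (\<Prod>q\<in>UNIV. factor K \<alpha> q (i q) (y q))) = 0"
        using zero[of "\<chi> q. y q" \<alpha>] by (simp add: form_of_apply form_index_def)
    next
      fix q d a' assume d: "\<And>t. t \<in> {max 0 (a $ q) <..< b $ q} \<Longrightarrow> (\<Sum>a\<in>form_range K \<alpha> q. d a * factor K \<alpha> q a t) = 0"
        and a': "a' \<in> {a' \<in> form_range K \<alpha> q. ext_knot (K q) a' < x $ q \<and> x $ q < factor_end K \<alpha> q a'}"
      have "0 < x $ q" using x spline_supp_subset_cube[OF i] by (auto simp: unit_cube_def)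
      then have "max 0 (a $ q) < x $ q" "x $ q < b $ q" using ab(1) by (auto simp: mem_box_cart)
      moreover have "(\<Sum>a\<in>form_range K \<alpha> q. d a * factor K \<alpha> q a t) = 0" if "max 0 (a $ q) < t" "t < b $ q" for t
        by (rule d) (use that in simp)
      ultimately show "d a' = 0"
        using factor_sum_eq_0_imp[of "max 0 (a $ q)" "b $ q" d \<alpha> q a' "x $ q"] a' by simp
    next
      show "i \<in> (\<Pi>\<^sub>E q\<in>UNIV. {a' \<in> form_range K \<alpha> q. ext_knot (K q) a' < x $ q \<and> x $ q < factor_end K \<alpha> q a'})"
        using i x by (auto simp: form_index_iff spline_supp_eq)
    qed (auto simp: form_range_def)
    with that show False by simp
  qed
  then show ?thesis using c by (auto simp: coef_space_def)
qed

text \<open>The case \<open>W = {}\<close> of \<open>form_of_local\<close>, as no basis form has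
  empty support. It makes \<open>form_of\<close> injective on coefficient spaces.\<close>

lemma form_of_eq_0_imp:
  assumes "c \<in> coef_space K P k" "\<And>\<gamma> x. x \<in> unit_cube \<Longrightarrow> form_of K c \<gamma> x = 0"
  shows "c = 0"
proof -
  have "c \<in> coef_space K (\<lambda>\<alpha> i. spline_supp K \<alpha> i \<subseteq> {}) k"
    by (rule form_of_local[OF assms(1)]) (use assms in auto)
  moreover have "spline_supp K \<alpha> i \<noteq> {}" if "i \<in> form_index K \<alpha>" for \<alpha> i
    using ext_knot_less_factor_end that unfolding spline_supp_eq_box[OF that] interval_ne_empty_cart
    by (auto simp: form_index_iff)
  ultimately have "c \<alpha> i = 0" for \<alpha> i unfolding coef_space_def by blast
  then show ?thesis by (simp add: fun_eq_iff)
qed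

end

text \<open>Multiply \<open>s\<close> by first B-splines in the other directions and restrict to a
  line in direction \<open>q\<close> on which these factors are non-zero constants. On such a line
  every function of the fine tensor-product space is a spline of \<open>L q\<close>.\<close>

lemma tensor_spline_space_nested:
  fixes K L :: "'n::finite \<Rightarrow> knot_vector"
  assumes K: "\<And>q. open_knot_vector (K q)"
    and nested: "tensor_spline_space K \<subseteq> tensor_spline_space L"
    and s: "s \<in> spline_space (K q)"
  shows "\<exists>s'\<in>spline_space (L q). \<forall>t. 0 < t \<and> t < 1 \<longrightarrow> s t = s' t"
proof -
  \<comment> \<open>The first B-spline tends to 1 at 0 from the right, so it is positive somewhere
    inside the interval.\<close>
  have "\<exists>t. 0 < t \<and> t < 1 \<and> B_spline (K r) 1 t \<noteq> 0" for r
  proof -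
    have m: "deg (K r) + 1 \<le> num (K r)" using open_knot_vector_ends[OF K] by simp
    have 0: "(B_spline (K r) 1 \<longlongrightarrow> 1) (at_right 0)"
      using DERIV_continuous[OF B_spline_right_derivative[OF K[of r], of 1 0]] m
      by (simp add: continuous_within B_spline_0[OF K])
    have "eventually (\<lambda>t. 0 < B_spline (K r) 1 t) (at_right 0)"
      by (rule order_tendstoD[OF 0]) simp
    moreover have "eventually (\<lambda>t. 0 < t \<and> t < 1) (at_right (0::real))"
      by (auto simp: eventually_at_right_field intro!: exI[of _ 1])
    ultimately have "eventually (\<lambda>t. 0 < t \<and> t < 1 \<and> B_spline (K r) 1 t \<noteq> 0) (at_right 0)"
      by eventually_elim auto
    from eventually_happens'[OF _ this] show ?thesis by simp
  qed
  then obtain x where x: "\<And>r. 0 < x r" "\<And>r. x r < (1::real)" "\<And>r. B_spline (K r) 1 (x r) \<noteq> 0" by metis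
  define f where "f = (\<lambda>r. if r = q then s else B_spline (K r) 1)"
  have "f r \<in> spline_space (K r)" for r
    using s open_knot_vector_ends[OF K[of r]] by (auto simp: f_def spline_space_def intro!: span_base)
  then have "(\<lambda>y. if y \<in> unit_cube then \<Prod>r\<in>UNIV. f r (y $ r) else 0) \<in> tensor_spline_space K"
    unfolding tensor_spline_space_def by (intro span_base) auto
  then have F: "(\<lambda>y. if y \<in> unit_cube then \<Prod>r\<in>UNIV. f r (y $ r) else 0) \<in> tensor_spline_space L" (is "?F \<in> _")
    using nested by auto
  define e where "e = (\<lambda>t. \<chi> r. if r = q then t else x r)"
  have e: "e t \<in> unit_cube" if "0 < t" "t < 1" for t using that x by (auto simp: e_def unit_cube_def)
  \<comment> \<open>Functions whose restriction to the line through the \<open>x r\<close> agrees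
    with a fine spline: a subspace, so only the product generators have to be checked.\<close>
  define S where "S = {G. \<exists>s'\<in>spline_space (L q). \<forall>t. 0 < t \<and> t < 1 \<longrightarrow> G (e t) = s' t}"
  have sub: "subspace (spline_space (L q))" unfolding spline_space_def by (rule subspace_span)
  have split: "(\<Prod>r\<in>UNIV. g r (e t $ r)) = (\<Prod>r\<in>UNIV - {q}. g r (x r)) * g q t" for g :: "'n \<Rightarrow> real \<Rightarrow> real" and t
  proof -
    have "(\<Prod>r\<in>UNIV. g r (e t $ r)) = g q (e t $ q) * (\<Prod>r\<in>UNIV - {q}. g r (e t $ r))"
      by (rule prod.remove) auto
    also have "(\<Prod>r\<in>UNIV - {q}. g r (e t $ r)) = (\<Prod>r\<in>UNIV - {q}. g r (x r))"
      by (rule prod.cong) (auto simp: e_def)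
    finally show ?thesis by (simp add: e_def)
  qed
  have "tensor_spline_space L \<subseteq> S"
    unfolding tensor_spline_space_def
  proof (rule span_minimal)
    show "subspace S"
    proof (rule subspaceI)
      show "0 \<in> S" using subspace_0[OF sub] by (auto simp: S_def intro!: bexI[of _ 0])
    next
      fix G H assume "G \<in> S" "H \<in> S"
      then obtain g h where "g \<in> spline_space (L q)" "h \<in> spline_space (L q)"
        "\<And>t. 0 < t \<Longrightarrow> t < 1 \<Longrightarrow> G (e t) = g t" "\<And>t. 0 < t \<Longrightarrow> t < 1 \<Longrightarrow> H (e t) = h t" by (auto simp: S_def)
      then show "G + H \<in> S" using subspace_add[OF sub] by (auto simp: S_def intro!: bexI[of _ "g + h"])
    next
      fix a G assume "G \<in> S"
      then obtain g where "g \<in> spline_space (L q)" "\<And>t. 0 < t \<Longrightarrow> t < 1 \<Longrightarrow> G (e t) = g t" by (auto simp: S_def)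
      then show "a *\<^sub>R G \<in> S" using subspace_scale[OF sub] by (auto simp: S_def intro!: bexI[of _ "a *\<^sub>R g"])
    qed
    show "{\<lambda>y. if y \<in> unit_cube then \<Prod>r\<in>UNIV. g r (y $ r) else 0 | g. \<forall>r. g r \<in> spline_space (L r)} \<subseteq> S"
    proof clarify
      fix g assume g: "\<forall>r. g r \<in> spline_space (L r)"
      let ?c = "\<Prod>r\<in>UNIV - {q}. g r (x r)"
      have "?c *\<^sub>R g q \<in> spline_space (L q)" using g subspace_scale[OF sub] by auto
      then show "(\<lambda>y. if y \<in> unit_cube then \<Prod>r\<in>UNIV. g r (y $ r) else 0) \<in> S"
        unfolding S_def using e by (auto simp: split intro!: bexI[of _ "?c *\<^sub>R g q"])
    qed
  qed
  with F obtain s' where s': "s' \<in> spline_space (L q)" "\<And>t. 0 < t \<Longrightarrow> t < 1 \<Longrightarrow> ?F (e t) = s' t"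
    by (auto simp: S_def)
  define c where "c = (\<Prod>r\<in>UNIV - {q}. f r (x r))"
  have c: "c \<noteq> 0" using x by (auto simp: c_def f_def)
  have "s t = ((1 / c) *\<^sub>R s') t" if "0 < t" "t < 1" for t
  proof -
    have "c * f q t = s' t" using s'(2)[OF that] e[OF that] by (simp add: split c_def)
    then have "c * s t = s' t" by (simp add: f_def)
    then show ?thesis using c by (simp add: field_simps)
  qed
  then show ?thesis using subspace_scale[OF sub s'(1)] by blast
qed

text \<open>Each univariate factor is expanded in fine factors of the same kind and the product is
  multiplied out. The boundary conditions survive because interior B-splines only use interior
  ones.\<close>

lemma form_of_nested:
  fixes K L :: "'n::finite \<Rightarrow> knot_vector"
  assumes K: "\<And>q. open_knot_vector (K q)" and L: "\<And>q. open_knot_vector (L q)"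
    and nested: "tensor_spline_space K \<subseteq> tensor_spline_space L"
  shows "form_of K ` coef_space K P k \<subseteq> form_of L ` coef_space L (\<lambda>_ _. True) k"
  unfolding span_spline_forms[symmetric]
proof (rule span_minimal)
  show "subspace (span {spline_form L \<alpha> i |\<alpha> i. card \<alpha> = k \<and> i \<in> form_index L \<alpha> \<and> True})"
    by (rule subspace_span)
  show "{spline_form K \<alpha> i |\<alpha> i. card \<alpha> = k \<and> i \<in> form_index K \<alpha> \<and> P \<alpha> i}
      \<subseteq> span {spline_form L \<alpha> i |\<alpha> i. card \<alpha> = k \<and> i \<in> form_index L \<alpha> \<and> True}"
    unfolding span_spline_forms
  proof clarify
    fix \<alpha> i assume k: "k = card \<alpha>" and i: "i \<in> form_index K \<alpha>"
    have "\<exists>d. \<forall>t. 0 < t \<and> t < 1 \<longrightarrow> factor K \<alpha> q (i q) t = (\<Sum>b\<in>form_range L \<alpha> q. d b * factor L \<alpha> q b t)" for q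
    proof -
      note * = tensor_spline_space_nested[OF K nested, of _ q]
      have "i q \<in> form_range K \<alpha> q" using i by (simp add: form_index_iff)
      then show ?thesis
        using D_spline_nested[OF K[of q] L[of q] *, of "i q"] interior_B_spline_nested[OF K[of q] L[of q] *, of "i q"]
        by (auto simp: factor_def form_range_def split: if_splits)
    qed
    then obtain d where d: "\<And>q t. 0 < t \<Longrightarrow> t < 1 \<Longrightarrow>
        factor K \<alpha> q (i q) t = (\<Sum>b\<in>form_range L \<alpha> q. d q b * factor L \<alpha> q b t)" by metis
    define c where "c = (\<lambda>\<gamma> j. if \<gamma> = \<alpha> \<and> j \<in> form_index L \<alpha> then \<Prod>q\<in>UNIV. d q (j q) else 0)"
    have "spline_form K \<alpha> i \<gamma> x = form_of L c \<gamma> x" for \<gamma> x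
    proof (cases "\<gamma> = \<alpha> \<and> x \<in> unit_cube")
      case True
      have "(\<Prod>q\<in>UNIV. factor K \<alpha> q (i q) (x $ q)) = (\<Prod>q\<in>UNIV. \<Sum>b\<in>form_range L \<alpha> q. d q b * factor L \<alpha> q b (x $ q))"
        using True by (intro prod.cong refl d) (auto simp: unit_cube_def)
      also have "\<dots> = (\<Sum>j\<in>form_index L \<alpha>. \<Prod>q\<in>UNIV. d q (j q) * factor L \<alpha> q (j q) (x $ q))"
        unfolding form_index_def by (rule prod_sum_PiE) (auto simp: form_range_def)
      finally show ?thesis using True by (simp add: spline_form_apply form_of_apply c_def prod.distrib)
    qed (auto simp: spline_form_apply form_of_apply c_def)
    then have "spline_form K \<alpha> i = form_of L c" by (intro ext)
    moreover have "c \<in> coef_space L (\<lambda>_ _. True) k" by (auto simp: coef_space_def c_def k)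
    ultimately show "spline_form K \<alpha> i \<in> form_of L ` coef_space L (\<lambda>_ _. True) (card \<alpha>)" using k by blast
  qed
qed

section \<open>The cochain complex of coefficients\<close>

definition pos_sign :: "'n::{finite,linorder} set \<Rightarrow> 'n \<Rightarrow> real" where
  "pos_sign \<gamma> j = (- 1) ^ card {i\<in>\<gamma>. i < j}"

lemma pos_sign_remove:
  assumes "r \<in> \<gamma>"
  shows "pos_sign (\<gamma> - {r}) j = (if r < j then - pos_sign \<gamma> j else pos_sign \<gamma> j)"
proof (cases "r < j")
  case True
  then have "{i\<in>\<gamma>. i < j} = insert r {i\<in>\<gamma> - {r}. i < j}" using assms by auto
  then have "card {i\<in>\<gamma>. i < j} = Suc (card {i\<in>\<gamma> - {r}. i < j})" by simp
  then show ?thesis using True by (simp add: pos_sign_def)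
next
  case False
  then have "{i\<in>\<gamma>. i < j} = {i\<in>\<gamma> - {r}. i < j}" by auto
  then show ?thesis using False by (simp add: pos_sign_def)
qed

lemma pos_sign_insert:
  assumes "r \<notin> \<gamma>"
  shows "pos_sign (insert r \<gamma>) j = (if r < j then - pos_sign \<gamma> j else pos_sign \<gamma> j)"
  using pos_sign_remove[of r "insert r \<gamma>" j] assms by (auto split: if_splits)

lemma pos_sign_square [simp]: "pos_sign \<gamma> j * pos_sign \<gamma> j = 1" "pos_sign \<gamma> j * (pos_sign \<gamma> j * x) = x"
  by (simp_all add: pos_sign_def power_add[symmetric] mult.assoc[symmetric] flip: mult_2)

definition back_diff :: "'n \<Rightarrow> (('n \<Rightarrow> nat) \<Rightarrow> real) \<Rightarrow> ('n \<Rightarrow> nat) \<Rightarrow> real" where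
  "back_diff j g i = g i - g (i(j := i j - 1))"

definition coef_d :: "'n::{finite,linorder} coefs \<Rightarrow> 'n coefs" where
  "coef_d c = (\<lambda>\<gamma> i. \<Sum>j\<in>\<gamma>. pos_sign \<gamma> j * back_diff j (c (\<gamma> - {j})) i)"

lemma coef_d_add: "coef_d (c + d) = coef_d c + coef_d d"
  by (simp add: coef_d_def back_diff_def fun_eq_iff algebra_simps sum.distrib sum_subtractf)

lemma coef_d_0 [simp]: "coef_d 0 = 0"
  by (simp add: coef_d_def back_diff_def fun_eq_iff)

lemma coef_d_scale: "coef_d (r *\<^sub>R c) = r *\<^sub>R coef_d c"
  by (simp add: coef_d_def back_diff_def fun_eq_iff algebra_simps sum_distrib_left)

lemma sum_antisymmetric_eq_0:
  fixes T :: "'q \<Rightarrow> 'q \<Rightarrow> real"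
  assumes "finite S" "\<And>a b. a \<in> S \<Longrightarrow> b \<in> S \<Longrightarrow> T a b = - T b a"
  shows "(\<Sum>a\<in>S. \<Sum>b\<in>S. T a b) = 0"
proof -
  have "(\<Sum>a\<in>S. \<Sum>b\<in>S. T a b) = (\<Sum>a\<in>S. \<Sum>b\<in>S. - T b a)"
    by (intro sum.cong refl assms(2))
  also have "\<dots> = - (\<Sum>a\<in>S. \<Sum>b\<in>S. T b a)" by (simp add: sum_negf)
  also have "(\<Sum>a\<in>S. \<Sum>b\<in>S. T b a) = (\<Sum>a\<in>S. \<Sum>b\<in>S. T a b)" by (rule sum.swap)
  finally show ?thesis by simp
qed

text \<open>Differences in two directions commute, whereas removing the two directions in either
  order gives opposite signs.\<close>

lemma coef_d_coef_d: "coef_d (coef_d c) = 0"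
proof (intro ext)
  fix \<gamma> :: "'a set" and i
  define D where "D = (\<lambda>j r. back_diff j (back_diff r (c (\<gamma> - {j} - {r}))) i)"
  \<comment> \<open>The diagonal is filled with 0 so that both sums range over all of
    \<open>\<gamma>\<close> and antisymmetry applies.\<close>
  define T where "T = (\<lambda>j r. if r = j then 0 else pos_sign \<gamma> j * pos_sign (\<gamma> - {j}) r * D j r)"
  have bd_sum: "back_diff j (\<lambda>i. \<Sum>r\<in>S. a r * f r i) i = (\<Sum>r\<in>S. a r * back_diff j (f r) i)"
    for j :: 'a and S :: "'a set" and a f
    by (simp add: back_diff_def sum_subtractf right_diff_distrib)
  have "coef_d (coef_d c) \<gamma> i
      = (\<Sum>j\<in>\<gamma>. \<Sum>r\<in>\<gamma> - {j}. pos_sign \<gamma> j * pos_sign (\<gamma> - {j}) r * D j r)"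
    unfolding coef_d_def[of "coef_d c"] unfolding coef_d_def D_def bd_sum by (simp add: sum_distrib_left mult.assoc)
  also have "\<dots> = (\<Sum>j\<in>\<gamma>. \<Sum>r\<in>\<gamma>. T j r)"
    by (intro sum.cong refl sum.mono_neutral_cong_left) (auto simp: T_def)
  also have "\<dots> = 0"
  proof (rule sum_antisymmetric_eq_0)
    fix j r assume jr: "j \<in> \<gamma>" "r \<in> \<gamma>"
    show "T j r = - T r j"
    proof (cases "j = r")
      case False
      have "\<gamma> - {j} - {r} = \<gamma> - {r} - {j}" by auto
      then have "D j r = D r j"
        using False by (simp add: D_def back_diff_def fun_upd_twist)
      then show ?thesis using False jr by (cases j r rule: linorder_cases) (auto simp: T_def pos_sign_remove)
    qed (simp add: T_def)
  qed simp
  finally show "coef_d (coef_d c) \<gamma> i = 0 \<gamma> i" by simp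
qed

text \<open>In direction \<open>j\<close>, \<open>tail_sum\<close> gives the coefficients of the antiderivative of \<open>s - (\<integral> s) D\<^sub>2\<close> and
  \<open>first_total\<close> those of \<open>(\<integral> s) D\<^sub>2\<close>; \<open>M\<close> is the number of B-splines.\<close>

definition tail_sum :: "nat \<Rightarrow> 'n \<Rightarrow> (('n \<Rightarrow> nat) \<Rightarrow> real) \<Rightarrow> ('n \<Rightarrow> nat) \<Rightarrow> real" where
  "tail_sum M j g i = (if 2 \<le> i j then - (\<Sum>a\<in>{i j<..M}. g (i(j := a))) else 0)"

definition first_total :: "nat \<Rightarrow> 'n \<Rightarrow> (('n \<Rightarrow> nat) \<Rightarrow> real) \<Rightarrow> ('n \<Rightarrow> nat) \<Rightarrow> real" where
  "first_total M j g i = (if i j = 2 then \<Sum>a=2..M. g (i(j := a)) else 0)"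

text \<open>The tail sums telescope. The defect sits at index 2: its left neighbour is cut off to 0,
  which leaves the whole sum.\<close>

lemma back_diff_tail_sum:
  assumes "\<And>i. g i \<noteq> 0 \<Longrightarrow> i j \<in> {2..M}"
  shows "back_diff j (tail_sum M j g) i = g i - first_total M j g i"
proof -
  have g0: "g i = 0" if "i j \<notin> {2..M}" for i using assms that by blast
  consider "i j < 2" | "i j = 2" | "2 < i j" "i j \<le> M" | "2 < i j" "M < i j" by linarith
  then show ?thesis
  proof cases
    case 1
    then show ?thesis using g0[of i] by (simp add: back_diff_def tail_sum_def first_total_def)
  next
    case 2
    show ?thesis
    proof (cases "2 \<le> M")
      case True
      have "(\<Sum>a=2..M. g (i(j := a))) = g (i(j := 2)) + (\<Sum>a\<in>{2<..M}. g (i(j := a)))"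
        using True by (rule sum.head)
      moreover have "i(j := 2) = i" using 2 by (metis fun_upd_triv)
      ultimately show ?thesis using 2 by (simp add: back_diff_def tail_sum_def first_total_def)
    next
      case False
      then show ?thesis using 2 g0[of i] by (simp add: back_diff_def tail_sum_def first_total_def)
    qed
  next
    case 3
    then have "{i j - 1<..M} = insert (i j) {i j<..M}" by auto
    then show ?thesis using 3 by (simp add: back_diff_def tail_sum_def first_total_def)
  next
    case 4
    then show ?thesis using g0[of i] by (simp add: back_diff_def tail_sum_def first_total_def)
  qed
qed

text \<open>Here the boundary condition enters: the telescoping sum ends with the coefficient at
  \<open>M\<close>, which is 0 because the last B-spline is excluded.\<close>

lemma tail_sum_back_diff:
  assumes "\<And>i. g i \<noteq> 0 \<Longrightarrow> i j \<in> {2..M - 1}"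
  shows "tail_sum M j (back_diff j g) i = g i"
proof -
  have g0: "g i = 0" if "i j \<notin> {2..M - 1}" for i using assms that by blast
  show ?thesis
  proof (cases "2 \<le> i j \<and> i j \<le> M")
    case True
    have "(\<Sum>a\<in>{i j<..M}. g (i(j := a)) - g (i(j := a - 1))) = g (i(j := M)) - g (i(j := i j))"
      using True sum_Suc_diff'[of "i j" M "\<lambda>a. g (i(j := a))"]
        sum.shift_bounds_Suc_ivl[of "\<lambda>a. g (i(j := a)) - g (i(j := a - 1))" "i j" M]
      by (simp add: atLeastLessThanSuc_atLeastAtMost atLeastSucAtMost_greaterThanAtMost)
    moreover have "g (i(j := M)) = 0" using True by (intro g0) auto
    ultimately show ?thesis using True by (simp add: tail_sum_def back_diff_def)
  next
    case False
    then have "i j \<notin> {2..M - 1}" by auto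
    then have "g i = 0" by (rule g0)
    moreover have "i j < 2 \<or> {i j<..M} = {}" using False by auto
    ultimately show ?thesis by (auto simp: tail_sum_def)
  qed
qed

lemma back_diff_tail_sum_commute:
  assumes "r \<noteq> j"
  shows "back_diff r (tail_sum M j g) i = tail_sum M j (back_diff r g) i"
  using assms by (simp add: back_diff_def tail_sum_def sum_subtractf fun_upd_twist)

lemma tail_sum_linear: "tail_sum M j (\<lambda>i. \<Sum>r\<in>S. a r * f r i) i = (\<Sum>r\<in>S. a r * tail_sum M j (f r) i)"
proof -
  have "(\<Sum>b\<in>{i j<..M}. \<Sum>r\<in>S. a r * f r (i(j := b))) = (\<Sum>r\<in>S. a r * (\<Sum>b\<in>{i j<..M}. f r (i(j := b))))"
    unfolding sum_distrib_left by (rule sum.swap)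
  then show ?thesis by (simp add: tail_sum_def sum_negf)
qed

section \<open>The homotopy in one direction\<close>

context
  fixes K :: "'n::{finite,linorder} \<Rightarrow> knot_vector"
begin

text \<open>Contraction with the \<open>j\<close>-th coordinate vector followed by integration in
  that direction; the sign comes from moving \<open>dx\<^sub>j\<close> to the front.\<close>

definition coef_hom :: "'n \<Rightarrow> 'n coefs \<Rightarrow> 'n coefs" where
  "coef_hom j c = (\<lambda>\<alpha> i. if j \<in> \<alpha> then 0 else pos_sign \<alpha> j * tail_sum (num (K j)) j (c (insert j \<alpha>)) i)"

definition coef_proj :: "'n \<Rightarrow> 'n coefs \<Rightarrow> 'n coefs" where
  "coef_proj j c = (\<lambda>\<gamma> i. if j \<in> \<gamma> then first_total (num (K j)) j (c \<gamma>) i else 0)"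

text \<open>In components containing \<open>j\<close>, only the derivative in direction
  \<open>j\<close> of the antiderivative survives, and its defect is \<open>coef_proj\<close>. In
  the other components the \<open>j\<close>-term of the second summand restores \<open>c\<close>,
  and the rest cancels, as tail sums commute with differences in other directions.\<close>

lemma coef_hom_homotopy:
  assumes c: "c \<in> coef_space K P k"
  shows "coef_d (coef_hom j c) + coef_hom j (coef_d c) = c - coef_proj j c"
proof (intro ext)
  fix \<gamma> :: "'n set" and i :: "'n \<Rightarrow> nat"
  let ?M = "num (K j)"
  have supp: "i j \<in> form_range K \<alpha> j" if "c \<alpha> i \<noteq> 0" for \<alpha> i
    using that c by (auto simp: coef_space_def form_index_iff)
  have bd_scale: "back_diff r (\<lambda>i. a * g i) i = a * back_diff r g i" for r a g
    by (simp add: back_diff_def right_diff_distrib)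
  have bd_0: "back_diff r (\<lambda>i. 0) i = 0" for r :: 'n by (simp add: back_diff_def)
  show "(coef_d (coef_hom j c) + coef_hom j (coef_d c)) \<gamma> i = (c - coef_proj j c) \<gamma> i"
  proof (cases "j \<in> \<gamma>")
    case True
    have "coef_d (coef_hom j c) \<gamma> i = (\<Sum>r\<in>\<gamma>. if r = j then back_diff j (tail_sum ?M j (c \<gamma>)) i else 0)"
      unfolding coef_d_def
    proof (intro sum.cong refl)
      fix r assume "r \<in> \<gamma>"
      show "pos_sign \<gamma> r * back_diff r (coef_hom j c (\<gamma> - {r})) i = (if r = j then back_diff j (tail_sum ?M j (c \<gamma>)) i else 0)"
      proof (cases "r = j")
        case r: True
        have "coef_hom j c (\<gamma> - {j}) = (\<lambda>i. pos_sign \<gamma> j * tail_sum ?M j (c \<gamma>) i)"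
          using True by (simp add: coef_hom_def pos_sign_remove insert_absorb)
        then show ?thesis using r by (simp add: bd_scale)
      next
        case False
        then have "coef_hom j c (\<gamma> - {r}) = (\<lambda>i. 0)" using True by (simp add: coef_hom_def fun_eq_iff)
        then show ?thesis using False by (simp add: bd_0)
      qed
    qed
    also have "\<dots> = back_diff j (tail_sum ?M j (c \<gamma>)) i" using True by simp
    also have "\<dots> = c \<gamma> i - first_total ?M j (c \<gamma>) i"
      by (rule back_diff_tail_sum) (use supp[of \<gamma>] True in \<open>auto simp: form_range_def\<close>)
    finally show ?thesis using True by (simp add: coef_hom_def coef_proj_def)
  next
    case False
    define A where "A = (\<lambda>r. tail_sum ?M j (back_diff r (c (insert j \<gamma> - {r}))) i)"
    have "coef_d (coef_hom j c) \<gamma> i = (\<Sum>r\<in>\<gamma>. pos_sign \<gamma> r * pos_sign (\<gamma> - {r}) j * A r)"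
      unfolding coef_d_def
    proof (intro sum.cong refl)
      fix r assume r: "r \<in> \<gamma>"
      then have "r \<noteq> j" "insert j (\<gamma> - {r}) = insert j \<gamma> - {r}" using False by auto
      then show "pos_sign \<gamma> r * back_diff r (coef_hom j c (\<gamma> - {r})) i = pos_sign \<gamma> r * pos_sign (\<gamma> - {r}) j * A r"
        using False by (simp add: coef_hom_def bd_scale A_def back_diff_tail_sum_commute)
    qed
    moreover have "coef_hom j (coef_d c) \<gamma> i = pos_sign \<gamma> j * (\<Sum>r\<in>insert j \<gamma>. pos_sign (insert j \<gamma>) r * A r)"
      using False unfolding coef_d_def coef_hom_def A_def tail_sum_linear by simp
    moreover have "pos_sign \<gamma> j * (\<Sum>r\<in>insert j \<gamma>. pos_sign (insert j \<gamma>) r * A r)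
        = A j + (\<Sum>r\<in>\<gamma>. pos_sign \<gamma> j * pos_sign (insert j \<gamma>) r * A r)"
      using False by (simp add: pos_sign_insert distrib_left sum_distrib_left mult.assoc)
    \<comment> \<open>The opposite sign reflects the anticommutation of \<open>dx\<^sub>j\<close>
      and \<open>dx\<^sub>r\<close>.\<close>
    moreover have "(\<Sum>r\<in>\<gamma>. pos_sign \<gamma> j * pos_sign (insert j \<gamma>) r * A r) = (\<Sum>r\<in>\<gamma>. - (pos_sign \<gamma> r * pos_sign (\<gamma> - {r}) j * A r))"
    proof (intro sum.cong refl)
      fix r assume r: "r \<in> \<gamma>"
      then have "r \<noteq> j" using False by auto
      then show "pos_sign \<gamma> j * pos_sign (insert j \<gamma>) r * A r = - (pos_sign \<gamma> r * pos_sign (\<gamma> - {r}) j * A r)"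
        using r False by (cases r j rule: linorder_cases) (auto simp: pos_sign_insert pos_sign_remove)
    qed
    moreover have "A j = c \<gamma> i"
      unfolding A_def using False tail_sum_back_diff[of "c \<gamma>" j ?M i] supp[of \<gamma>] by (auto simp: form_range_def)
    ultimately show ?thesis using False by (simp add: coef_proj_def sum_negf)
  qed
qed

text \<open>A D-spline of index \<open>a\<close> arises only from the B-splines \<open>a\<close> and
  \<open>a - 1\<close>, and both of their supports contain its own. Hence differentiation respects
  every restriction to a subdomain.\<close>

lemma coef_d_mem:
  assumes K: "\<And>q. open_knot_vector (K q)"
    and c: "c \<in> coef_space K (\<lambda>\<alpha> i. spline_supp K \<alpha> i \<subseteq> W) k"
  shows "coef_d c \<in> coef_space K (\<lambda>\<alpha> i. spline_supp K \<alpha> i \<subseteq> W) (Suc k)"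
  unfolding coef_space_def
proof (intro CollectI allI impI)
  fix \<gamma> i assume "coef_d c \<gamma> i \<noteq> 0"
  then have "\<exists>j\<in>\<gamma>. pos_sign \<gamma> j * back_diff j (c (\<gamma> - {j})) i \<noteq> 0"
    unfolding coef_d_def by (rule contrapos_np) (auto intro: sum.neutral)
  then obtain j where j: "j \<in> \<gamma>" "back_diff j (c (\<gamma> - {j})) i \<noteq> 0" by auto
  then have "c (\<gamma> - {j}) i \<noteq> 0 \<or> c (\<gamma> - {j}) (i(j := i j - 1)) \<noteq> 0"
    unfolding back_diff_def by auto
  then obtain i' where i': "c (\<gamma> - {j}) i' \<noteq> 0" "i' = i \<or> i' = i(j := i j - 1)"
    by blast
  then have *: "card (\<gamma> - {j}) = k" "i' \<in> form_index K (\<gamma> - {j})" "spline_supp K (\<gamma> - {j}) i' \<subseteq> W"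
    using c by (auto simp: coef_space_def)
  have "i q \<in> form_range K \<gamma> q" for q
    using *(2)[unfolded form_index_iff, rule_format, of q] i'(2) j(1) by (auto simp: form_range_def split: if_splits)
  then have i: "i \<in> form_index K \<gamma>" by (simp add: form_index_iff)
  have "spline_supp K \<gamma> i \<subseteq> spline_supp K (\<gamma> - {j}) i'"
  proof
    fix x assume x: "x \<in> spline_supp K \<gamma> i"
    have "ext_knot (K q) (i' q) < x $ q \<and> x $ q < factor_end K (\<gamma> - {j}) q (i' q)" for q
    proof (cases "q = j")
      case False
      then have "i' q = i q" using i'(2) by auto
      then show ?thesis using x False unfolding spline_supp_eq[OF K i] by (auto simp: factor_end_def)
    next
      case True
      have "i' j = i j \<or> i' j = i j - 1" using i'(2) by auto
      moreover have "i' j \<ge> 2" using *(2)[unfolded form_index_iff, rule_format, of j] by (auto simp: form_range_def)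
      ultimately have "i' j \<le> i j" "i j + deg (K j) \<le> i' j + deg (K j) + 1" by auto
      then have "ext_knot (K j) (i' j) \<le> ext_knot (K j) (i j)"
        "ext_knot (K j) (i j + deg (K j)) \<le> ext_knot (K j) (i' j + deg (K j) + 1)"
        by (auto intro!: monoD[OF mono_ext_knot[OF K]])
      moreover have "ext_knot (K j) (i j) < x $ j" "x $ j < ext_knot (K j) (i j + deg (K j))"
        using x j(1) unfolding spline_supp_eq[OF K i] factor_end_def by (auto dest: spec[of _ j])
      ultimately show ?thesis using True by (simp add: factor_end_def)
    qed
    then show "x \<in> spline_supp K (\<gamma> - {j}) i'" unfolding spline_supp_eq[OF K *(2)] by simp
  qed
  then show "card \<gamma> = Suc k \<and> i \<in> form_index K \<gamma> \<and> spline_supp K \<gamma> i \<subseteq> W"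
    using * i j(1) card_Suc_Diff1[of \<gamma> j] by auto
qed

text \<open>Unlike \<open>coef_d_mem\<close> this keeps no support condition: tail sums spread a
  coefficient to smaller indices in direction \<open>j\<close>. The second claim covers degree 0,
  where \<open>k - 1\<close> is truncated.\<close>

lemma coef_hom_mem:
  assumes "c \<in> coef_space K (\<lambda>_ _. True) k"
  shows "coef_hom j c \<in> coef_space K (\<lambda>_ _. True) (k - 1)" "k = 0 \<Longrightarrow> coef_hom j c = 0"
proof -
  have *: "card \<alpha> = k - 1 \<and> 0 < k \<and> i \<in> form_index K \<alpha>" if "coef_hom j c \<alpha> i \<noteq> 0" for \<alpha> i
  proof -
    have j: "j \<notin> \<alpha>" "2 \<le> i j" "(\<Sum>a\<in>{i j<..num (K j)}. c (insert j \<alpha>) (i(j := a))) \<noteq> 0"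
      using that by (auto simp: coef_hom_def tail_sum_def split: if_splits)
    from j(3) obtain a where a: "a \<in> {i j<..num (K j)}" "c (insert j \<alpha>) (i(j := a)) \<noteq> 0"
      by (rule sum.not_neutral_contains_not_neutral)
    then have c: "card (insert j \<alpha>) = k" "i(j := a) \<in> form_index K (insert j \<alpha>)"
      using assms by (auto simp: coef_space_def)
    have "i q \<in> form_range K \<alpha> q" for q
      using c(2)[unfolded form_index_iff, rule_format, of q] j a(1) by (auto simp: form_range_def split: if_splits)
    then show ?thesis using c(1) j(1) by (auto simp: form_index_iff)
  qed
  show "coef_hom j c \<in> coef_space K (\<lambda>_ _. True) (k - 1)" using * by (auto simp: coef_space_def)
  show "coef_hom j c = 0" if "k = 0" using * that by (auto simp: fun_eq_iff)
qed

lemma coef_proj_nonzero: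
  assumes "c \<in> coef_space K (\<lambda>_ _. True) k" "coef_proj j c \<gamma> i \<noteq> 0"
  shows "card \<gamma> = k" "i \<in> form_index K \<gamma>" "j \<in> \<gamma>" "i j = 2" "\<exists>a. c \<gamma> (i(j := a)) \<noteq> 0"
proof -
  show j: "j \<in> \<gamma>" "i j = 2" using assms(2) by (auto simp: coef_proj_def first_total_def split: if_splits)
  then have "(\<Sum>a=2..num (K j). c \<gamma> (i(j := a))) \<noteq> 0" using assms(2) by (simp add: coef_proj_def first_total_def)
  then obtain a where a: "a \<in> {2..num (K j)}" "c \<gamma> (i(j := a)) \<noteq> 0"
    by (rule sum.not_neutral_contains_not_neutral)
  then show "\<exists>a. c \<gamma> (i(j := a)) \<noteq> 0" by blast
  have c: "card \<gamma> = k" "i(j := a) \<in> form_index K \<gamma>"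
    using assms(1) a by (auto simp: coef_space_def)
  have "i q \<in> form_range K \<gamma> q" for q
    using c(2)[unfolded form_index_iff, rule_format, of q] j a(1) by (auto simp: form_range_def split: if_splits)
  then show "card \<gamma> = k" "i \<in> form_index K \<gamma>" using c(1) by (simp_all add: form_index_iff)
qed

text \<open>Each direction in turn replaces the cocycle by a cohomologous one concentrated at index
  2 in that direction and containing its differential. In the end only multiples of the single top
  form built from D-splines of index 2 remain.\<close>

lemma coef_cocycle_decomposition:
  assumes "c \<in> coef_space K (\<lambda>_ _. True) k" "coef_d c = 0"
  obtains e c' where "c = c' + coef_d e" "e \<in> coef_space K (\<lambda>_ _. True) (k - 1)" "k = 0 \<Longrightarrow> e = 0"
    "c' \<in> coef_space K (\<lambda>_ _. True) k" "\<And>\<gamma> i. c' \<gamma> i \<noteq> 0 \<Longrightarrow> \<gamma> = UNIV \<and> i = (\<lambda>_. 2)"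
proof -
  have "\<exists>e c'. c = c' + coef_d e \<and> e \<in> coef_space K (\<lambda>_ _. True) (k - 1) \<and> (k = 0 \<longrightarrow> e = 0) \<and>
    c' \<in> coef_space K (\<lambda>_ _. True) k \<and> (\<forall>\<gamma> i. c' \<gamma> i \<noteq> 0 \<longrightarrow> Q \<subseteq> \<gamma> \<and> (\<forall>q\<in>Q. i q = 2))" if "finite Q" for Q :: "'n set"
    using that
  proof (induction Q rule: finite_induct)
    case empty
    show ?case
    proof (intro exI conjI)
      show "c = c + coef_d 0" by (simp only: coef_d_0 add_0_right)
      show "0 \<in> coef_space K (\<lambda>_ _. True) (k - 1)" by (rule subspace_0[OF subspace_coef_space])
    qed (use assms in auto)
  next
    case (insert j Q)
    then obtain e c' where e: "c = c' + coef_d e" "e \<in> coef_space K (\<lambda>_ _. True) (k - 1)" "k = 0 \<longrightarrow> e = 0"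
      and c': "c' \<in> coef_space K (\<lambda>_ _. True) k" "\<And>\<gamma> i. c' \<gamma> i \<noteq> 0 \<Longrightarrow> Q \<subseteq> \<gamma> \<and> (\<forall>q\<in>Q. i q = 2)"
      by blast
    have "coef_d c' = 0"
      using assms(2) unfolding e(1) coef_d_add coef_d_coef_d by simp
    then have "coef_hom j (coef_d c') = 0"
      by (simp add: coef_hom_def tail_sum_def fun_eq_iff)
    then have "c' = coef_proj j c' + coef_d (coef_hom j c')"
      using coef_hom_homotopy[OF c'(1), of j] by (simp add: algebra_simps)
    then have "c = coef_proj j c' + coef_d (coef_hom j c' + e)"
      using e(1) by (simp add: coef_d_add add.assoc)
    moreover have "coef_hom j c' + e \<in> coef_space K (\<lambda>_ _. True) (k - 1)"
      by (intro subspace_add[OF subspace_coef_space] coef_hom_mem c' e)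
    moreover have "k = 0 \<longrightarrow> coef_hom j c' + e = 0"
      using coef_hom_mem(2)[OF c'(1)] e(3) by simp
    moreover have "coef_proj j c' \<in> coef_space K (\<lambda>_ _. True) k"
      using coef_proj_nonzero(1,2)[OF c'(1)] by (simp add: coef_space_def)
    moreover have "insert j Q \<subseteq> \<gamma> \<and> (\<forall>q\<in>insert j Q. i q = 2)" if nz: "coef_proj j c' \<gamma> i \<noteq> 0" for \<gamma> i
    proof -
      note n = coef_proj_nonzero[OF c'(1) nz]
      obtain a where "c' \<gamma> (i(j := a)) \<noteq> 0" using n(5) by blast
      then have Q: "Q \<subseteq> \<gamma>" "\<And>q. q \<in> Q \<Longrightarrow> (i(j := a)) q = 2" using c'(2) by blast+
      have "i q = 2" if "q \<in> Q" for q using Q(2)[OF that] insert.hyps(2) that by (auto split: if_splits)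
      then show ?thesis using Q(1) n(3,4) by blast
    qed
    ultimately show ?case by blast
  qed
  from this[OF finite] obtain e c' where e: "c = c' + coef_d e" "e \<in> coef_space K (\<lambda>_ _. True) (k - 1)" "k = 0 \<longrightarrow> e = 0"
    "c' \<in> coef_space K (\<lambda>_ _. True) k" and c': "\<And>\<gamma> i. c' \<gamma> i \<noteq> 0 \<Longrightarrow> UNIV \<subseteq> \<gamma> \<and> (\<forall>q\<in>UNIV. i q = 2)"
    by blast
  show ?thesis
  proof (rule that[OF e(1,2) _ e(4)])
    fix \<gamma> i assume "c' \<gamma> i \<noteq> 0"
    from c'[OF this] show "\<gamma> = UNIV \<and> i = (\<lambda>_. 2)" by (auto simp: fun_eq_iff intro: top.extremum_uniqueI)
  qed (use e(3) in blast)
qed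

text \<open>Direction \<open>j\<close> has one more admissible index with \<open>dx\<^sub>j\<close>
  than without. The smaller range embeds into the larger one in place and shifted by one,
  corresponding to the two terms of \<open>back_diff\<close>.\<close>

lemma sum_form_index_remove:
  fixes g \<phi> :: "('n \<Rightarrow> nat) \<Rightarrow> real"
  assumes "j \<in> \<gamma>" "\<And>i. g i \<noteq> 0 \<Longrightarrow> i \<in> form_index K (\<gamma> - {j})"
  shows "(\<Sum>i\<in>form_index K \<gamma>. g i * \<phi> i) = (\<Sum>i\<in>form_index K (\<gamma> - {j}). g i * \<phi> i)"
    and "(\<Sum>i\<in>form_index K \<gamma>. g (i(j := i j - 1)) * \<phi> i) = (\<Sum>i\<in>form_index K (\<gamma> - {j}). g i * \<phi> (i(j := i j + 1)))"
proof -
  have sub: "form_index K (\<gamma> - {j}) \<subseteq> form_index K \<gamma>"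
  proof
    fix i assume i: "i \<in> form_index K (\<gamma> - {j})"
    have "i q \<in> form_range K \<gamma> q" for q
      using i[unfolded form_index_iff, rule_format, of q] by (auto simp: form_range_def split: if_splits)
    then show "i \<in> form_index K \<gamma>" by (simp add: form_index_iff)
  qed
  show "(\<Sum>i\<in>form_index K \<gamma>. g i * \<phi> i) = (\<Sum>i\<in>form_index K (\<gamma> - {j}). g i * \<phi> i)"
  proof (rule sum.mono_neutral_right[OF finite_form_index sub], rule ballI)
    fix i assume "i \<in> form_index K \<gamma> - form_index K (\<gamma> - {j})"
    then have "g i = 0" using assms(2)[of i] by auto
    then show "g i * \<phi> i = 0" by simp
  qed
  let ?s = "\<lambda>i :: 'n \<Rightarrow> nat. i(j := i j + 1)"
  have inj: "inj_on ?s (form_index K (\<gamma> - {j}))"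
  proof (rule inj_onI)
    fix a b assume "?s a = ?s b"
    then have *: "?s a q = ?s b q" for q by simp
    have "a q = b q" for q using *[of q] by (cases "q = j") auto
    then show "a = b" by auto
  qed
  have sub': "?s ` form_index K (\<gamma> - {j}) \<subseteq> form_index K \<gamma>"
  proof
    fix i assume "i \<in> ?s ` form_index K (\<gamma> - {j})"
    then obtain i' where i: "i' \<in> form_index K (\<gamma> - {j})" "i = ?s i'" by auto
    have "i q \<in> form_range K \<gamma> q" for q
    proof (cases "q = j")
      case True
      then show ?thesis using i(1)[unfolded form_index_iff, rule_format, of j] assms(1)
        by (auto simp: form_range_def i(2))
    next
      case False
      then show ?thesis using i(1)[unfolded form_index_iff, rule_format, of q]
        by (simp add: form_range_def i(2))
    qed
    then show "i \<in> form_index K \<gamma>" by (simp add: form_index_iff)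
  qed
  have "(\<Sum>i\<in>form_index K \<gamma>. g (i(j := i j - 1)) * \<phi> i) = (\<Sum>i\<in>?s ` form_index K (\<gamma> - {j}). g (i(j := i j - 1)) * \<phi> i)"
  proof (rule sum.mono_neutral_right[OF finite_form_index sub'], rule ballI)
    fix i assume i: "i \<in> form_index K \<gamma> - ?s ` form_index K (\<gamma> - {j})"
    have "g (i(j := i j - 1)) = 0"
    proof (rule ccontr)
      assume "g (i(j := i j - 1)) \<noteq> 0"
      then have *: "i(j := i j - 1) \<in> form_index K (\<gamma> - {j})" by (rule assms(2))
      have "i j \<in> form_range K \<gamma> j" using i by (auto simp: form_index_iff)
      \<comment> \<open>This keeps the natural subtraction \<open>i j - 1\<close> from being
        truncated, so the shift can be undone.\<close>
      then have "i j \<ge> 2" by (auto simp: form_range_def split: if_splits)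
      then have "i = ?s (i(j := i j - 1))" by auto
      then show False using i * by blast
    qed
    then show "g (i(j := i j - 1)) * \<phi> i = 0" by simp
  qed
  also have "\<dots> = (\<Sum>i\<in>form_index K (\<gamma> - {j}). g i * \<phi> (?s i))"
    by (subst sum.reindex[OF inj]) simp
  finally show "(\<Sum>i\<in>form_index K \<gamma>. g (i(j := i j - 1)) * \<phi> i) = (\<Sum>i\<in>form_index K (\<gamma> - {j}). g i * \<phi> (?s i))" .
qed

text \<open>Summation by parts moves the difference from the coefficients to the functions, which
  turns it into a difference of neighbouring D-splines. The homogeneous boundary conditions leave no
  boundary terms.\<close>

lemma sum_back_diff:
  assumes "j \<in> \<gamma>" "\<And>i. g i \<noteq> 0 \<Longrightarrow> i \<in> form_index K (\<gamma> - {j})"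
  shows "(\<Sum>i\<in>form_index K \<gamma>. back_diff j g i * \<phi> i) = (\<Sum>i\<in>form_index K (\<gamma> - {j}). g i * (\<phi> i - \<phi> (i(j := i j + 1))))"
  using sum_form_index_remove[OF assms(1), of g \<phi>] assms(2)
  by (simp add: back_diff_def left_diff_distrib right_diff_distrib sum_subtractf)

text \<open>This is the integral in terms of coefficients, since every D-spline used has integral
  1.\<close>

definition coef_total :: "'n coefs \<Rightarrow> real" where
  "coef_total c = (\<Sum>i\<in>form_index K UNIV. c UNIV i)"

text \<open>Stokes' theorem on coefficients: summation by parts against the constant function
  1.\<close>

lemma coef_total_coef_d:
  assumes "c \<in> coef_space K P k"
  shows "coef_total (coef_d c) = 0"
proof -
  have "coef_total (coef_d c) = (\<Sum>i\<in>form_index K UNIV. \<Sum>j\<in>UNIV. pos_sign UNIV j * back_diff j (c (UNIV - {j})) i)"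
    by (simp add: coef_total_def coef_d_def)
  also have "\<dots> = (\<Sum>j\<in>UNIV. \<Sum>i\<in>form_index K UNIV. pos_sign UNIV j * back_diff j (c (UNIV - {j})) i)"
    by (rule sum.swap)
  also have "\<dots> = (\<Sum>j\<in>UNIV. pos_sign UNIV j * (\<Sum>i\<in>form_index K UNIV. back_diff j (c (UNIV - {j})) i * 1))"
    by (simp add: sum_distrib_left)
  also have "\<dots> = 0"
  proof (intro sum.neutral ballI)
    fix j :: 'n
    show "pos_sign UNIV j * (\<Sum>i\<in>form_index K UNIV. back_diff j (c (UNIV - {j})) i * 1) = 0"
      using assms by (subst sum_back_diff) (auto simp: coef_space_def)
  qed
  finally show ?thesis .
qed

text \<open>Only the factor in direction \<open>j\<close> varies. Passing to
  \<open>insert j \<beta>\<close> replaces this B-spline by D-splines and leaves all other factors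
  unchanged.\<close>

lemma partial_deriv_form_of:
  assumes K: "\<And>q. open_knot_vector (K q)" and x: "x \<in> unit_cube" and j: "j \<notin> \<beta>"
  shows "partial_deriv j (form_of K c \<beta>) x = (\<Sum>i\<in>form_index K \<beta>. c \<beta> i *
    ((\<Prod>q\<in>UNIV. factor K (insert j \<beta>) q (i q) (x $ q)) - (\<Prod>q\<in>UNIV. factor K (insert j \<beta>) q ((i(j := i j + 1)) q) (x $ q))))"
proof -
  define R where "R = (\<lambda>i. \<Prod>q\<in>UNIV - {j}. factor K \<beta> q (i q) (x $ q))"
  have split: "(\<Prod>q\<in>UNIV. factor K (insert j \<beta>) q (i q) (x $ q)) = D_spline (K j) (i j) (x $ j) * R i" for i
  proof -
    have "(\<Prod>q\<in>UNIV. factor K (insert j \<beta>) q (i q) (x $ q)) = factor K (insert j \<beta>) j (i j) (x $ j) * (\<Prod>q\<in>UNIV - {j}. factor K (insert j \<beta>) q (i q) (x $ q))"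
      by (rule prod.remove) auto
    also have "(\<Prod>q\<in>UNIV - {j}. factor K (insert j \<beta>) q (i q) (x $ q)) = R i"
      unfolding R_def by (rule prod.cong) (auto simp: factor_def)
    finally show ?thesis by (simp add: factor_def)
  qed
  have R_upd: "R (i(j := a)) = R i" for i a unfolding R_def by (rule prod.cong) auto
  have split_t: "(\<Prod>q\<in>UNIV. factor K \<beta> q (i q) ((x + t *\<^sub>R axis j 1) $ q)) = B_spline (K j) (i j) (x $ j + t) * R i" for i t
  proof -
    have "(\<Prod>q\<in>UNIV. factor K \<beta> q (i q) ((x + t *\<^sub>R axis j 1) $ q))
       = factor K \<beta> j (i j) ((x + t *\<^sub>R axis j 1) $ j) * (\<Prod>q\<in>UNIV - {j}. factor K \<beta> q (i q) ((x + t *\<^sub>R axis j 1) $ q))"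
      by (rule prod.remove) auto
    also have "(\<Prod>q\<in>UNIV - {j}. factor K \<beta> q (i q) ((x + t *\<^sub>R axis j 1) $ q)) = R i"
      unfolding R_def by (rule prod.cong) (auto simp: axis_def)
    finally show ?thesis using j by (simp add: factor_def axis_def)
  qed
  let ?f = "\<lambda>t. \<Sum>i\<in>form_index K \<beta>. c \<beta> i * (B_spline (K j) (i j) (x $ j + t) * R i)"
  let ?D = "\<Sum>i\<in>form_index K \<beta>. c \<beta> i * ((D_spline (K j) (i j) (x $ j) - D_spline (K j) (i j + 1) (x $ j)) * R i)"
  \<comment> \<open>Forms are cut off outside the cube, so the product formula holds only until the
    line leaves the cube at coordinate 1.\<close>
  have f: "form_of K c \<beta> (x + t *\<^sub>R axis j 1) = ?f t" if "x $ j + t < 1" "0 \<le> t" for t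
  proof -
    have "x + t *\<^sub>R axis j 1 \<in> unit_cube" using x that by (auto simp: unit_cube_def axis_def intro: add_pos_nonneg)
    then show ?thesis unfolding form_of_apply split_t by simp
  qed
  have "(?f has_field_derivative ?D) (at_right 0)"
  proof (intro DERIV_sum DERIV_cmult DERIV_cmult_right)
    fix i assume "i \<in> form_index K \<beta>"
    then have "i j \<in> form_range K \<beta> j" by (auto simp: form_index_iff)
    then have "(B_spline (K j) (i j) has_field_derivative D_spline (K j) (i j) (x $ j) - D_spline (K j) (i j + 1) (x $ j)) (at_right (x $ j))"
      by (intro B_spline_right_derivative K) (auto simp: form_range_def split: if_splits)
    moreover have "(+) (x $ j) ` {0<..} = {x $ j<..}"
    proof (intro set_eqI iffI)
      fix y assume "y \<in> {x $ j<..}"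
      then show "y \<in> (+) (x $ j) ` {0<..}" by (intro image_eqI[of _ _ "y - x $ j"]) auto
    qed auto
    ultimately show "((\<lambda>t. B_spline (K j) (i j) (x $ j + t)) has_field_derivative
        D_spline (K j) (i j) (x $ j) - D_spline (K j) (i j + 1) (x $ j)) (at_right 0)"
      using DERIV_at_within_shift[of "B_spline (K j) (i j)" _ "x $ j" 0 "{0<..}"] by simp
  qed
  moreover have "eventually (\<lambda>t. form_of K c \<beta> (x + t *\<^sub>R axis j 1) = ?f t) (at_right 0)"
  proof -
    have "x $ j < 1" using x by (auto simp: unit_cube_def)
    then have "eventually (\<lambda>t. x $ j + t < 1 \<and> 0 \<le> t) (at_right 0)"
      unfolding eventually_at_right_field by (intro exI[of _ "1 - x $ j"]) auto
    then show ?thesis by (rule eventually_mono) (use f in blast)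
  qed
  moreover have "form_of K c \<beta> (x + 0 *\<^sub>R axis j 1) = ?f 0"
    using x by (intro f) (auto simp: unit_cube_def)
  ultimately have "((\<lambda>t. form_of K c \<beta> (x + t *\<^sub>R axis j 1)) has_field_derivative ?D) (at_right 0)"
    by (subst has_field_derivative_cong_eventually)
  then have "partial_deriv j (form_of K c \<beta>) x = ?D"
    unfolding partial_deriv_def has_real_derivative_iff_has_vector_derivative
    by (intro vector_derivative_within) auto
  also have "\<dots> = (\<Sum>i\<in>form_index K \<beta>. c \<beta> i *
    ((\<Prod>q\<in>UNIV. factor K (insert j \<beta>) q (i q) (x $ q)) - (\<Prod>q\<in>UNIV. factor K (insert j \<beta>) q ((i(j := i j + 1)) q) (x $ q))))"
    unfolding split R_upd by (simp add: left_diff_distrib)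
  finally show ?thesis .
qed

text \<open>The bridge from analysis to coefficients. It holds at every point, including those on
  knot planes, because the derivatives are taken from the right.\<close>

lemma ext_deriv_form_of:
  assumes K: "\<And>q. open_knot_vector (K q)" and c: "c \<in> coef_space K P k"
  shows "ext_deriv (form_of K c) = form_of K (coef_d c)"
proof (intro ext)
  fix \<gamma> x
  let ?\<phi> = "\<lambda>i. \<Prod>q\<in>UNIV. factor K \<gamma> q (i q) (x $ q)"
  show "ext_deriv (form_of K c) \<gamma> x = form_of K (coef_d c) \<gamma> x"
  proof (cases "x \<in> unit_cube")
    case True
    have "ext_deriv (form_of K c) \<gamma> x = (\<Sum>j\<in>\<gamma>. pos_sign \<gamma> j * partial_deriv j (form_of K c (\<gamma> - {j})) x)"
      using True by (simp add: ext_deriv_def pos_sign_def)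
    also have "\<dots> = (\<Sum>j\<in>\<gamma>. pos_sign \<gamma> j * (\<Sum>i\<in>form_index K \<gamma>. back_diff j (c (\<gamma> - {j})) i * ?\<phi> i))"
    proof (intro sum.cong refl arg_cong2[where f = "(*)"])
      fix j assume j: "j \<in> \<gamma>"
      then have "insert j (\<gamma> - {j}) = \<gamma>" by auto
      then have "partial_deriv j (form_of K c (\<gamma> - {j})) x = (\<Sum>i\<in>form_index K (\<gamma> - {j}). c (\<gamma> - {j}) i * (?\<phi> i - ?\<phi> (i(j := i j + 1))))"
        using partial_deriv_form_of[OF K True, of j "\<gamma> - {j}" c] by simp
      also have "\<dots> = (\<Sum>i\<in>form_index K \<gamma>. back_diff j (c (\<gamma> - {j})) i * ?\<phi> i)"
        using c by (intro sum_back_diff[OF j, symmetric]) (auto simp: coef_space_def)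
      finally show "partial_deriv j (form_of K c (\<gamma> - {j})) x = (\<Sum>i\<in>form_index K \<gamma>. back_diff j (c (\<gamma> - {j})) i * ?\<phi> i)" .
    qed
    also have "\<dots> = (\<Sum>j\<in>\<gamma>. \<Sum>i\<in>form_index K \<gamma>. pos_sign \<gamma> j * back_diff j (c (\<gamma> - {j})) i * ?\<phi> i)"
      by (simp add: sum_distrib_left mult.assoc)
    also have "\<dots> = (\<Sum>i\<in>form_index K \<gamma>. coef_d c \<gamma> i * ?\<phi> i)"
      unfolding coef_d_def sum_distrib_right by (rule sum.swap)
    finally show ?thesis using True by (simp add: form_of_apply)
  qed (simp add: ext_deriv_def form_of_apply)
qed

end

section \<open>Integration and exactness of the tensor-product complex\<close>

text \<open>For non-negative measurable factors, the product formula for the non-negative Lebesgue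
  integral applies without a prior proof of integrability.\<close>

lemma has_integral_tensor_product:
  fixes g :: "'n::finite \<Rightarrow> real \<Rightarrow> real"
  assumes [measurable]: "\<And>q. g q \<in> borel_measurable borel"
    and nonneg: "\<And>q t. 0 \<le> g q t" and int: "\<And>q. (g q has_integral I q) UNIV"
  shows "((\<lambda>x. \<Prod>q\<in>UNIV. g q (x $ q)) has_integral (\<Prod>q\<in>UNIV. I q)) (UNIV :: (real ^ 'n) set)"
proof (rule nn_integral_has_integral)
  have I: "0 \<le> I q" for q using has_integral_nonneg[OF int] nonneg by blast
  have Basis: "(Basis :: (real ^ 'n) set) = range (\<lambda>q. axis q 1)"
    by (auto simp: Basis_vec_def)
  have inj: "inj (\<lambda>q::'n. axis q (1::real))"
    by (rule injI) (metis axis_index_axis)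
  have reindex: "(\<Prod>b\<in>(Basis :: (real ^ 'n) set). h b) = (\<Prod>q\<in>UNIV. h (axis q 1))" for h :: "real ^ 'n \<Rightarrow> ennreal"
    unfolding Basis by (subst prod.reindex[OF inj]) simp
  have "(\<integral>\<^sup>+x. ennreal (\<Prod>q\<in>UNIV. g q (x $ q)) \<partial>(lborel :: (real ^ 'n) measure))
     = (\<integral>\<^sup>+x. (\<Prod>b\<in>Basis. ennreal (g (axis_index b) (x \<bullet> b))) \<partial>(lborel :: (real ^ 'n) measure))"
    by (intro nn_integral_cong) (simp add: reindex prod_ennreal nonneg cart_eq_inner_axis del: prod_ennreal, simp add: prod_ennreal nonneg)
  also have "\<dots> = (\<Prod>b\<in>(Basis :: (real ^ 'n) set). \<integral>\<^sup>+t. ennreal (g (axis_index b) t) \<partial>lborel)"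
    by (rule nn_integral_lborel_prod) auto
  also have "\<dots> = (\<Prod>q\<in>UNIV. ennreal (I q))"
    unfolding reindex using nn_integral_has_integral_lborel[OF assms(1) nonneg int] by simp
  also have "\<dots> = ennreal (\<Prod>q\<in>UNIV. I q)"
    using I by (simp add: prod_ennreal)
  finally show "(\<integral>\<^sup>+x. ennreal (\<Prod>q\<in>UNIV. g q (x $ q)) \<partial>(lborel :: (real ^ 'n) measure)) = ennreal (\<Prod>q\<in>UNIV. I q)" .
  show "0 \<le> (\<Prod>q\<in>UNIV. I q)" using I by (intro prod_nonneg) auto
  show "0 \<le> (\<Prod>q\<in>UNIV. g q (x $ q))" for x :: "real ^ 'n" using nonneg by (intro prod_nonneg) auto
  show "(\<lambda>x::real ^ 'n. \<Prod>q\<in>UNIV. g q (x $ q)) \<in> borel_measurable borel" by measurable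
qed

lemma integral_form_of:
  fixes K :: "'n::{finite,linorder} \<Rightarrow> knot_vector"
  assumes K: "\<And>q. open_knot_vector (K q)"
  shows "integral_form (form_of K c) = coef_total K c"
proof -
  have int: "((\<lambda>x. \<Prod>q\<in>UNIV. factor K UNIV q (i q) (x $ q)) has_integral 1) unit_cube"
    if i: "i \<in> form_index K UNIV" for i
  proof -
    have rng: "2 \<le> i q" "i q \<le> num (K q)" for q using i by (auto simp: form_index_iff form_range_def)
    \<comment> \<open>With the cut-off in each factor, the product over the whole space is the form
      extended by 0 off the cube.\<close>
    define g where "g = (\<lambda>q t. D_spline (K q) (i q) t * indicator {0<..<1} t)"
    have eq: "D_spline (K q) (i q) = (\<lambda>t. real (deg (K q)) / (ext_knot (K q) (i q + deg (K q)) - ext_knot (K q) (i q))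
        * bspline (ext_knot (K q)) (deg (K q) - 1) (i q) t)" for q
      using rng[of q] by (intro ext D_spline_ext_knot K) auto
    have [measurable]: "g q \<in> borel_measurable borel" for q unfolding g_def eq by measurable
    have "0 \<le> D_spline (K q) (i q) t" for q t
      unfolding eq using ext_knot_strict[OF K, of "i q" q] rng[of q]
      by (intro mult_nonneg_nonneg divide_nonneg_nonneg bspline_nonneg mono_ext_knot K) auto
    then have nonneg: "0 \<le> g q t" for q t by (simp add: g_def)
    have "(g q has_integral 1) UNIV" for q
    proof -
      have "(D_spline (K q) (i q) has_integral 1) {0..1}"
        using D_spline_has_integral[OF K, of "i q" q] rng[of q] by simp
      then have "(D_spline (K q) (i q) has_integral 1) {0<..<1}"
        using has_integral_Icc_iff_Ioo by blast
      moreover have "g q = (\<lambda>t. if t \<in> {0<..<1} then D_spline (K q) (i q) t else 0)"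
        by (auto simp: g_def fun_eq_iff)
      ultimately show ?thesis by (simp only: has_integral_restrict_UNIV)
    qed
    then have "((\<lambda>x. \<Prod>q\<in>UNIV. g q (x $ q)) has_integral (\<Prod>q\<in>(UNIV :: 'n set). 1)) (UNIV :: (real ^ ('n::{finite,linorder})) set)"
      by (intro has_integral_tensor_product nonneg) auto
    moreover have "(\<lambda>x::real ^ ('n::{finite,linorder}). \<Prod>q\<in>UNIV. g q (x $ q))
        = (\<lambda>x. if x \<in> unit_cube then \<Prod>q\<in>UNIV. factor K UNIV q (i q) (x $ q) else 0)"
    proof
      fix x :: "real ^ ('n::{finite,linorder})"
      show "(\<Prod>q\<in>UNIV. g q (x $ q)) = (if x \<in> unit_cube then \<Prod>q\<in>UNIV. factor K UNIV q (i q) (x $ q) else 0)"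
      proof (cases "x \<in> unit_cube")
        case True
        then show ?thesis by (auto simp: g_def factor_def unit_cube_def intro!: prod.cong)
      next
        case False
        then obtain q where "x $ q \<notin> {0<..<1}" unfolding unit_cube_def by auto
        then have "g q (x $ q) = 0" by (simp add: g_def)
        then show ?thesis using False by (auto intro!: prod_zero)
      qed
    qed
    ultimately show ?thesis by (simp only: has_integral_restrict_UNIV prod.neutral_const)
  qed
  have "((\<lambda>x. \<Sum>i\<in>form_index K UNIV. c UNIV i * (\<Prod>q\<in>UNIV. factor K UNIV q (i q) (x $ q)))
      has_integral (\<Sum>i\<in>form_index K UNIV. c UNIV i * 1)) unit_cube"
    by (intro has_integral_sum has_integral_mult_right int finite_form_index)
  then have "((\<lambda>x. \<Sum>i\<in>form_index K UNIV. c UNIV i * (\<Prod>q\<in>UNIV. factor K UNIV q (i q) (x $ q)))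
      has_integral coef_total K c) unit_cube"
    by (simp add: coef_total_def)
  then have "(form_of K c UNIV has_integral coef_total K c) unit_cube"
    by (rule has_integral_eq[rotated]) (simp add: form_of_apply)
  then show ?thesis unfolding integral_form_def by (rule integral_unique)
qed

definition tensor_forms :: "('n::finite \<Rightarrow> knot_vector) \<Rightarrow> nat \<Rightarrow> 'n form set" where
  "tensor_forms K k = form_of K ` coef_space K (\<lambda>_ _. True) k"

text \<open>Injectivity of \<open>form_of\<close> carries closedness over to coefficients. The
  decomposition of cocycles then leaves one possible class, in top degree, and the integral detects
  it.\<close>

lemma exact_tensor_forms:
  fixes K :: "'n::{finite,linorder} \<Rightarrow> knot_vector"
  assumes K: "\<And>q. open_knot_vector (K q)"
  shows "exact_complex (tensor_forms K)"
proof -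
  let ?C = "coef_space K (\<lambda>_ _. True)"
  let ?n = "CARD('n)"
  have d: "ext_deriv (form_of K c) = form_of K (coef_d c)" if "c \<in> ?C k" for c k
    using ext_deriv_form_of[OF K that] .
  have mem_d: "coef_d c \<in> ?C (Suc k)" if "c \<in> ?C k" for c k
    using coef_d_mem[OF K, where W = UNIV and c = c and k = k] that by (simp only: subset_UNIV)
  have d0: "coef_d c = 0" if "c \<in> ?C k" "ext_deriv (form_of K c) = 0" for c k
  proof (rule form_of_eq_0_imp[OF K mem_d[OF that(1)]])
    show "form_of K (coef_d c) \<gamma> x = 0" for \<gamma> x
      using that(2) unfolding d[OF that(1)] by (simp add: fun_eq_iff)
  qed
  have cob: "coboundaries (tensor_forms K) k = (if k = 0 then {0} else form_of K ` coef_d ` ?C (k - 1))" for k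
  proof -
    have "ext_deriv ` tensor_forms K (k - 1) = form_of K ` coef_d ` ?C (k - 1)"
      unfolding tensor_forms_def image_image by (intro image_cong refl d)
    then show ?thesis by (simp add: coboundaries_def)
  qed
  have dd: "ext_deriv (form_of K (coef_d c)) = 0" if "c \<in> ?C k" for c k
    unfolding d[OF mem_d[OF that]] coef_d_coef_d by simp
  have cob_sub: "coboundaries (tensor_forms K) k \<subseteq> cocycles (tensor_forms K) k" if k: "1 \<le> k" for k
  proof
    fix \<omega> assume "\<omega> \<in> coboundaries (tensor_forms K) k"
    then obtain c where c: "c \<in> ?C (k - 1)" "\<omega> = form_of K (coef_d c)" using k unfolding cob by auto
    then show "\<omega> \<in> cocycles (tensor_forms K) k"
      using dd[OF c(1)] mem_d[OF c(1)] k by (simp add: cocycles_def tensor_forms_def)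
  qed
  have decomp: "\<exists>e c'. c = c' + coef_d e \<and> e \<in> ?C (k - 1) \<and> (k = 0 \<longrightarrow> e = 0) \<and> c' \<in> ?C k \<and>
      (\<forall>\<gamma> i. c' \<gamma> i \<noteq> 0 \<longrightarrow> \<gamma> = UNIV \<and> i = (\<lambda>_. 2))" if "c \<in> ?C k" "coef_d c = 0" for c k
    by (rule coef_cocycle_decomposition[OF that]) blast
  \<comment> \<open>The remainder of the decomposition lives on \<open>UNIV\<close> only, hence
    vanishes in every degree other than \<open>CARD('n)\<close>.\<close>
  have low: "\<exists>e. c = coef_d e \<and> e \<in> ?C (k - 1) \<and> (k = 0 \<longrightarrow> e = 0)"
    if k: "k \<noteq> ?n" and c: "c \<in> ?C k" "coef_d c = 0" for c k
  proof -
    obtain e c' where e: "c = c' + coef_d e" "e \<in> ?C (k - 1)" "k = 0 \<longrightarrow> e = 0" "c' \<in> ?C k"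
      "\<And>\<gamma> i. c' \<gamma> i \<noteq> 0 \<Longrightarrow> \<gamma> = UNIV \<and> i = (\<lambda>_. 2)" using decomp[OF c] by blast
    have "c' \<gamma> i = 0" for \<gamma> i using e(4) e(5)[of \<gamma> i] k unfolding coef_space_def by blast
    then have "c' = 0" by (simp add: fun_eq_iff)
    then show ?thesis using e by auto
  qed
  have exact_0: "cocycles (tensor_forms K) 0 = {0}"
  proof -
    have "\<omega> = 0" if \<omega>: "\<omega> \<in> cocycles (tensor_forms K) 0" for \<omega>
    proof -
      obtain c where c: "c \<in> ?C 0" "\<omega> = form_of K c" "ext_deriv \<omega> = 0"
        using \<omega> by (auto simp: cocycles_def tensor_forms_def)
      then show ?thesis using low[of 0 c] d0[of c 0] by auto
    qed
    moreover have "0 \<in> cocycles (tensor_forms K) 0"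
      using d[of 0 0] subspace_0[OF subspace_coef_space, of K] by (auto simp: cocycles_def tensor_forms_def intro!: image_eqI[of _ _ 0])
    ultimately show ?thesis by auto
  qed
  have exact_k: "cocycles (tensor_forms K) k = coboundaries (tensor_forms K) k" if "k \<in> {1..<?n}" for k
  proof (rule equalityI[OF subsetI cob_sub])
    fix \<omega> assume "\<omega> \<in> cocycles (tensor_forms K) k"
    then obtain c where c: "c \<in> ?C k" "\<omega> = form_of K c" "ext_deriv \<omega> = 0"
      by (auto simp: cocycles_def tensor_forms_def)
    then show "\<omega> \<in> coboundaries (tensor_forms K) k"
      using low[of k c] d0[of c k] that unfolding cob by auto
  qed (use that in auto)
  have exact_n: "{\<omega> \<in> tensor_forms K ?n. integral_form \<omega> = 0} = coboundaries (tensor_forms K) ?n"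
  proof (intro equalityI subsetI)
    fix \<omega> assume "\<omega> \<in> {\<omega> \<in> tensor_forms K ?n. integral_form \<omega> = 0}"
    then obtain c where c: "c \<in> ?C ?n" "\<omega> = form_of K c" "coef_total K c = 0"
      by (auto simp: tensor_forms_def integral_form_of[OF K])
    have "coef_d c \<gamma> i = 0" for \<gamma> i
    proof (rule ccontr)
      assume "coef_d c \<gamma> i \<noteq> 0"
      then have "card \<gamma> = Suc ?n" using mem_d[OF c(1)] by (simp add: coef_space_def)
      moreover have "card \<gamma> \<le> ?n" by (intro card_mono) auto
      ultimately show False by simp
    qed
    then have "coef_d c = 0" by (simp add: fun_eq_iff)
    from decomp[OF c(1) this] obtain e c' where e: "c = c' + coef_d e" "e \<in> ?C (?n - 1)" "c' \<in> ?C ?n"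
      "\<And>\<gamma> i. c' \<gamma> i \<noteq> 0 \<Longrightarrow> \<gamma> = UNIV \<and> i = (\<lambda>_. 2)" by blast
    \<comment> \<open>Coboundaries have total 0, so the remainder inherits the total of
      \<open>c\<close>; having at most one non-zero coefficient, it is then 0.\<close>
    have "coef_total K c' = 0"
      using c(3) coef_total_coef_d[OF e(2)] unfolding e(1) by (simp add: coef_total_def sum.distrib)
    have "c' \<gamma> i = 0" for \<gamma> i
    proof (rule ccontr)
      assume nz: "c' \<gamma> i \<noteq> 0"
      then have \<gamma>: "\<gamma> = UNIV" "i \<in> form_index K UNIV" using e(3,4) by (auto simp: coef_space_def)
      have "c' UNIV i' = 0" if "i' \<noteq> i" for i' using e(4)[of UNIV i'] e(4)[OF nz] that by auto
      then have "coef_total K c' = (\<Sum>i'\<in>form_index K UNIV. if i' = i then c' UNIV i else 0)"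
        unfolding coef_total_def by (intro sum.cong) auto
      also have "\<dots> = c' UNIV i" using \<gamma> by simp
      finally show False using \<open>coef_total K c' = 0\<close> nz \<gamma> by simp
    qed
    then have "c' = 0" by (simp add: fun_eq_iff)
    then show "\<omega> \<in> coboundaries (tensor_forms K) ?n"
      using c(2) e(1,2) unfolding cob by auto
  next
    fix \<omega> assume "\<omega> \<in> coboundaries (tensor_forms K) ?n"
    then obtain c where "c \<in> ?C (?n - 1)" "\<omega> = form_of K (coef_d c)" unfolding cob by auto
    then show "\<omega> \<in> {\<omega> \<in> tensor_forms K ?n. integral_form \<omega> = 0}"
      using mem_d[of c "?n - 1"] coef_total_coef_d[of c K] by (auto simp: tensor_forms_def integral_form_of[OF K])
  qed
  have onto: "integral_form ` tensor_forms K ?n = UNIV"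
  proof (intro equalityI subsetI UNIV_I)
    fix r :: real
    \<comment> \<open>A multiple of the top form whose factors are all D-splines of index 2; its
      integral is the multiple \<open>r\<close>.\<close>
    let ?c = "\<lambda>\<gamma> i. if \<gamma> = UNIV \<and> i = (\<lambda>_. 2) then r else 0"
    have i: "(\<lambda>_. 2) \<in> form_index K UNIV"
      unfolding form_index_iff
    proof
      fix q
      have "2 \<le> num (K q)" using open_knot_vector_ends(1,2)[OF K[of q]] by linarith
      then show "2 \<in> form_range K UNIV q" by (simp add: form_range_def)
    qed
    then have "?c \<in> ?C ?n" by (auto simp: coef_space_def)
    moreover have "coef_total K ?c = r" using i by (simp add: coef_total_def)
    ultimately show "r \<in> integral_form ` tensor_forms K ?n"
      unfolding tensor_forms_def image_image integral_form_of[OF K] by (intro image_eqI[of _ _ ?c]) auto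
  qed
  show ?thesis unfolding exact_complex_def using exact_0 exact_k exact_n onto by simp
qed

section \<open>Cohomology of subcomplexes\<close>

text \<open>Linearity is part of the definition because \<open>ext_deriv\<close> need not be linear
  on arbitrary forms: one-sided derivatives may fail to exist.\<close>

definition cochain_complex :: "(nat \<Rightarrow> 'n::{finite,linorder} form set) \<Rightarrow> bool" where
  "cochain_complex V \<longleftrightarrow> (\<forall>k. subspace (V k)) \<and> (\<forall>k. \<forall>\<omega>\<in>V k. ext_deriv \<omega> \<in> V (Suc k)) \<and>
    (\<forall>k. \<forall>\<omega>\<in>V k. \<forall>\<eta>\<in>V k. ext_deriv (\<omega> + \<eta>) = ext_deriv \<omega> + ext_deriv \<eta>) \<and>
    (\<forall>k r. \<forall>\<omega>\<in>V k. ext_deriv (r *\<^sub>R \<omega>) = r *\<^sub>R ext_deriv \<omega>) \<and>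
    (\<forall>k. \<forall>\<omega>\<in>V k. ext_deriv (ext_deriv \<omega>) = 0)"

text \<open>The identities for the derivative pass to smaller spaces, so only closure under the
  derivative has to be checked.\<close>

lemma cochain_complex_subcomplex:
  assumes "cochain_complex T" "\<And>k. V k \<subseteq> T k" "\<And>k. subspace (V k)"
    and "\<And>k \<omega>. \<omega> \<in> V k \<Longrightarrow> ext_deriv \<omega> \<in> V (Suc k)"
  shows "cochain_complex V"
  unfolding cochain_complex_def
proof (intro conjI allI ballI)
  note T = assms(1)[unfolded cochain_complex_def]
  show "subspace (V k)" for k by (rule assms(3))
  show "ext_deriv \<omega> \<in> V (Suc k)" if "\<omega> \<in> V k" for k \<omega> by (rule assms(4)[OF that])
  show "ext_deriv (\<omega> + \<eta>) = ext_deriv \<omega> + ext_deriv \<eta>" if "\<omega> \<in> V k" "\<eta> \<in> V k" for k \<omega> \<eta>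
    using T that assms(2)[of k] by blast
  show "ext_deriv (r *\<^sub>R \<omega>) = r *\<^sub>R ext_deriv \<omega>" if "\<omega> \<in> V k" for k r \<omega>
    using T that assms(2)[of k] by blast
  show "ext_deriv (ext_deriv \<omega>) = 0" if "\<omega> \<in> V k" for k \<omega>
    using T that assms(2)[of k] by blast
qed

section \<open>Cohomology classes of one complex\<close>

context
  fixes V :: "nat \<Rightarrow> 'n::{finite,linorder} form set"
  assumes V: "cochain_complex V"
begin

lemma complex_subspace: "subspace (V k)"
  using V by (simp add: cochain_complex_def)

lemmas complex_0 = subspace_0[OF complex_subspace]
  and complex_add = subspace_add[OF complex_subspace]
  and complex_diff = subspace_diff[OF complex_subspace]
  and complex_scale = subspace_scale[OF complex_subspace]

lemma complex_d: "\<omega> \<in> V k \<Longrightarrow> ext_deriv \<omega> \<in> V (Suc k)"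
  using V by (simp add: cochain_complex_def)

lemma complex_d_pred: "\<omega> \<in> V (k - 1) \<Longrightarrow> 1 \<le> k \<Longrightarrow> ext_deriv \<omega> \<in> V k"
  using complex_d[of \<omega> "k - 1"] by simp

lemma complex_dd: "\<omega> \<in> V k \<Longrightarrow> ext_deriv (ext_deriv \<omega>) = 0"
  using V by (simp add: cochain_complex_def)

lemma ext_deriv_add: "\<omega> \<in> V k \<Longrightarrow> \<eta> \<in> V k \<Longrightarrow> ext_deriv (\<omega> + \<eta>) = ext_deriv \<omega> + ext_deriv \<eta>"
  using V by (simp add: cochain_complex_def)

lemma ext_deriv_scale: "\<omega> \<in> V k \<Longrightarrow> ext_deriv (r *\<^sub>R \<omega>) = r *\<^sub>R ext_deriv \<omega>"
  using V unfolding cochain_complex_def by blast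

lemma ext_deriv_0: "ext_deriv 0 = (0 :: 'n form)"
  using ext_deriv_scale[OF complex_0, where r = 0] by (simp only: scaleR_zero_left)

lemma ext_deriv_diff:
  assumes "\<omega> \<in> V k" "\<eta> \<in> V k"
  shows "ext_deriv (\<omega> - \<eta>) = ext_deriv \<omega> - ext_deriv \<eta>"
proof -
  have "ext_deriv \<omega> = ext_deriv (\<omega> - \<eta>) + ext_deriv \<eta>"
    using ext_deriv_add[OF complex_diff[OF assms] assms(2)] by (simp only: diff_add_cancel)
  then show ?thesis by (simp only: add_diff_cancel)
qed

lemma subspace_cocycles: "subspace (cocycles V k)"
  by (rule subspaceI)
     (auto simp only: cocycles_def mem_Collect_eq ext_deriv_0 ext_deriv_add ext_deriv_scale add_0_right scaleR_zero_right
       intro: complex_0 complex_add complex_scale)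

lemma subspace_coboundaries: "subspace (coboundaries V k)"
proof (cases "k = 0")
  case False
  show ?thesis
  proof (rule subspaceI)
    show "0 \<in> coboundaries V k"
      using False complex_0[of "k - 1"] ext_deriv_0 by (auto simp only: coboundaries_def if_False intro!: image_eqI[of _ _ 0])
  next
    fix x y assume "x \<in> coboundaries V k" "y \<in> coboundaries V k"
    then obtain a b where "a \<in> V (k - 1)" "b \<in> V (k - 1)" "x = ext_deriv a" "y = ext_deriv b"
      using False by (auto simp only: coboundaries_def if_False)
    then show "x + y \<in> coboundaries V k"
      using False complex_add ext_deriv_add by (auto simp only: coboundaries_def if_False intro!: image_eqI[of _ _ "a + b"])
  next
    fix r x assume "x \<in> coboundaries V k"
    then obtain a where "a \<in> V (k - 1)" "x = ext_deriv a"
      using False by (auto simp only: coboundaries_def if_False)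
    then show "r *\<^sub>R x \<in> coboundaries V k"
      using False complex_scale ext_deriv_scale by (auto simp only: coboundaries_def if_False intro!: image_eqI[of _ _ "r *\<^sub>R a"])
  qed
qed (simp add: coboundaries_def subspace_single_0)

lemma coboundaries_subset_cocycles: "coboundaries V k \<subseteq> cocycles V k"
proof (cases "k = 0")
  case True
  then show ?thesis using subspace_0[OF subspace_cocycles] by (simp add: coboundaries_def)
next
  case False
  then show ?thesis
    using complex_d_pred complex_dd by (auto simp only: coboundaries_def cocycles_def if_False)
qed

lemma mem_coh_class: "x \<in> coh_class V k \<omega> \<longleftrightarrow> x - \<omega> \<in> coboundaries V k"
proof
  assume "x \<in> coh_class V k \<omega>"
  then obtain \<eta> where "\<eta> \<in> coboundaries V k" "x = \<omega> + \<eta>" unfolding coh_class_def by blast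
  then show "x - \<omega> \<in> coboundaries V k" by (simp only: add_diff_cancel_left')
next
  assume "x - \<omega> \<in> coboundaries V k"
  moreover have "x = \<omega> + (x - \<omega>)" by (simp only: add_diff_eq add_diff_cancel_left')
  ultimately show "x \<in> coh_class V k \<omega>" unfolding coh_class_def by blast
qed

lemma coh_class_eq_iff: "coh_class V k \<omega> = coh_class V k \<eta> \<longleftrightarrow> \<omega> - \<eta> \<in> coboundaries V k"
proof
  assume "coh_class V k \<omega> = coh_class V k \<eta>"
  moreover have "\<omega> \<in> coh_class V k \<omega>" using subspace_0[OF subspace_coboundaries] by (simp only: mem_coh_class diff_self)
  ultimately show "\<omega> - \<eta> \<in> coboundaries V k" by (simp only: mem_coh_class)
next
  assume *: "\<omega> - \<eta> \<in> coboundaries V k"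
  have "x - \<omega> \<in> coboundaries V k \<longleftrightarrow> x - \<eta> \<in> coboundaries V k" for x
  proof
    assume "x - \<omega> \<in> coboundaries V k"
    from subspace_add[OF subspace_coboundaries this *] show "x - \<eta> \<in> coboundaries V k" by (simp only: diff_add_cancel add_diff_eq)
  next
    assume "x - \<eta> \<in> coboundaries V k"
    from subspace_diff[OF subspace_coboundaries this *] show "x - \<omega> \<in> coboundaries V k" by (simp only: diff_diff_eq2 diff_add_cancel)
  qed
  then show "coh_class V k \<omega> = coh_class V k \<eta>" unfolding set_eq_iff mem_coh_class by blast
qed

lemma coh_add_class: "coh_add V k (coh_class V k \<omega>) (coh_class V k \<eta>) = coh_class V k (\<omega> + \<eta>)"
proof -
  have "coh_class V k (x + y) = coh_class V k (\<omega> + \<eta>)" if "x \<in> coh_class V k \<omega>" "y \<in> coh_class V k \<eta>" for x y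
    using subspace_add[OF subspace_coboundaries that[unfolded mem_coh_class]]
    by (simp only: coh_class_eq_iff add_diff_add)
  moreover have "\<omega> \<in> coh_class V k \<omega>" for \<omega> using subspace_0[OF subspace_coboundaries] by (simp only: mem_coh_class diff_self)
  ultimately show ?thesis unfolding coh_add_def by blast
qed

lemma coh_scale_class: "coh_scale V k r (coh_class V k \<omega>) = coh_class V k (r *\<^sub>R \<omega>)"
proof -
  have "coh_class V k (r *\<^sub>R x) = coh_class V k (r *\<^sub>R \<omega>)" if "x \<in> coh_class V k \<omega>" for x
    using subspace_scale[OF subspace_coboundaries that[unfolded mem_coh_class], of r]
    by (simp only: coh_class_eq_iff scaleR_diff_right)
  moreover have "\<omega> \<in> coh_class V k \<omega>" for \<omega> using subspace_0[OF subspace_coboundaries] by (simp only: mem_coh_class diff_self)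
  ultimately show ?thesis unfolding coh_scale_def by blast
qed

end

section \<open>Maps induced by inclusions\<close>

lemma coboundaries_mono:
  assumes "\<And>k. V k \<subseteq> V' k"
  shows "coboundaries V k \<subseteq> coboundaries V' k"
  using assms[of "k - 1"] by (auto simp: coboundaries_def)

lemma cocycles_mono:
  assumes "\<And>k. V k \<subseteq> V' k"
  shows "cocycles V k \<subseteq> cocycles V' k"
  using assms[of k] by (auto simp: cocycles_def)

text \<open>The induced map is automatically linear, so only bijectivity remains; in terms of
  representatives its two halves are the two conjuncts.\<close>

lemma inclusion_induces_iso_iff:
  assumes V: "cochain_complex V" and V': "cochain_complex V'" and sub: "\<And>k. V k \<subseteq> V' k"
  shows "inclusion_induces_iso V V' k \<longleftrightarrow>
    cocycles V k \<inter> coboundaries V' k \<subseteq> coboundaries V k \<and>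
    (\<forall>\<omega>\<in>cocycles V' k. \<exists>\<eta>\<in>cocycles V k. \<omega> - \<eta> \<in> coboundaries V' k)"
proof -
  have mem: "\<omega> \<in> coh_class V k \<omega>" for \<omega>
    using subspace_0[OF subspace_coboundaries[OF V]] by (simp only: mem_coh_class[OF V] diff_self)
  have ind: "coh_induced V' k (coh_class V k \<omega>) = coh_class V' k \<omega>" for \<omega>
  proof -
    have "coh_class V' k x = coh_class V' k \<omega>" if "x \<in> coh_class V k \<omega>" for x
      using that coboundaries_mono[of V V' k, OF sub] by (auto simp only: mem_coh_class[OF V] coh_class_eq_iff[OF V'])
    then show ?thesis unfolding coh_induced_def using mem[of \<omega>] by blast
  qed
  have inj: "inj_on (coh_induced V' k) (cohomology V k) \<longleftrightarrow> cocycles V k \<inter> coboundaries V' k \<subseteq> coboundaries V k"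
  proof
    assume *: "inj_on (coh_induced V' k) (cohomology V k)"
    show "cocycles V k \<inter> coboundaries V' k \<subseteq> coboundaries V k"
    proof
      fix \<omega> assume \<omega>: "\<omega> \<in> cocycles V k \<inter> coboundaries V' k"
      have "coh_class V' k \<omega> = coh_class V' k 0"
        using \<omega> unfolding coh_class_eq_iff[OF V'] diff_0_right by blast
      then have "coh_induced V' k (coh_class V k \<omega>) = coh_induced V' k (coh_class V k 0)" by (simp only: ind)
      moreover have "coh_class V k \<omega> \<in> cohomology V k" "coh_class V k 0 \<in> cohomology V k"
        using \<omega> subspace_0[OF subspace_cocycles[OF V]] unfolding cohomology_def by blast+
      ultimately have "coh_class V k \<omega> = coh_class V k 0" using * by (blast dest: inj_onD)
      then show "\<omega> \<in> coboundaries V k" unfolding coh_class_eq_iff[OF V] diff_0_right .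
    qed
  next
    assume *: "cocycles V k \<inter> coboundaries V' k \<subseteq> coboundaries V k"
    show "inj_on (coh_induced V' k) (cohomology V k)"
    proof (rule inj_onI)
      fix C C' assume "C \<in> cohomology V k" "C' \<in> cohomology V k" and eq: "coh_induced V' k C = coh_induced V' k C'"
      then obtain \<omega> \<eta> where \<omega>: "\<omega> \<in> cocycles V k" "\<eta> \<in> cocycles V k" "C = coh_class V k \<omega>" "C' = coh_class V k \<eta>"
        unfolding cohomology_def by blast
      then have "\<omega> - \<eta> \<in> coboundaries V' k" using eq by (simp only: ind coh_class_eq_iff[OF V'])
      moreover have "\<omega> - \<eta> \<in> cocycles V k" using \<omega> by (intro subspace_diff subspace_cocycles V)
      ultimately have "\<omega> - \<eta> \<in> coboundaries V k" using * by blast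
      then show "C = C'" using \<omega> by (simp only: coh_class_eq_iff[OF V])
    qed
  qed
  have surj: "coh_induced V' k ` cohomology V k = cohomology V' k \<longleftrightarrow>
      (\<forall>\<omega>\<in>cocycles V' k. \<exists>\<eta>\<in>cocycles V k. \<omega> - \<eta> \<in> coboundaries V' k)"
  proof -
    have img: "coh_induced V' k ` cohomology V k = coh_class V' k ` cocycles V k"
      unfolding cohomology_def image_image by (simp only: ind)
    have "coh_class V' k ` cocycles V k \<subseteq> coh_class V' k ` cocycles V' k"
      by (intro image_mono cocycles_mono sub)
    then have "coh_induced V' k ` cohomology V k = cohomology V' k \<longleftrightarrow>
       coh_class V' k ` cocycles V' k \<subseteq> coh_class V' k ` cocycles V k"
      unfolding img cohomology_def[of V'] set_eq_subset by simp
    also have "\<dots> \<longleftrightarrow> (\<forall>\<omega>\<in>cocycles V' k. \<exists>\<eta>\<in>cocycles V k. coh_class V' k \<omega> = coh_class V' k \<eta>)"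
      by blast
    finally show ?thesis unfolding coh_class_eq_iff[OF V'] .
  qed
  have lin: "(\<forall>C\<in>cohomology V k. \<forall>C'\<in>cohomology V k.
        coh_induced V' k (coh_add V k C C') = coh_add V' k (coh_induced V' k C) (coh_induced V' k C')) \<and>
     (\<forall>r. \<forall>C\<in>cohomology V k.
        coh_induced V' k (coh_scale V k r C) = coh_scale V' k r (coh_induced V' k C))"
  proof (intro conjI ballI allI)
    fix C C' assume "C \<in> cohomology V k" "C' \<in> cohomology V k"
    then obtain \<omega> \<eta> where C: "C = coh_class V k \<omega>" "C' = coh_class V k \<eta>" unfolding cohomology_def by blast
    show "coh_induced V' k (coh_add V k C C') = coh_add V' k (coh_induced V' k C) (coh_induced V' k C')"
      unfolding C coh_add_class[OF V] ind coh_add_class[OF V'] ..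
  next
    fix r C assume "C \<in> cohomology V k"
    then obtain \<omega> where C: "C = coh_class V k \<omega>" unfolding cohomology_def by blast
    show "coh_induced V' k (coh_scale V k r C) = coh_scale V' k r (coh_induced V' k C)"
      unfolding C coh_scale_class[OF V] ind coh_scale_class[OF V'] ..
  qed
  show ?thesis unfolding inclusion_induces_iso_def bij_betw_def inj surj
    by (rule iffI, erule conjunct1, rule conjI[OF _ lin])
qed

text \<open>For the short exact sequence \<open>0 \<rightarrow> X \<rightarrow> A \<oplus> Y
  \<rightarrow> B \<rightarrow> 0\<close>. Its long exact sequence is replaced by direct chases that
  also handle the integral at the right end. The assumptions on degree 0, degree n and the integral
  express what \<open>B\<close> inherits from a tensor-product complex.\<close>

locale mayer_vietoris =
  fixes A Y X B :: "nat \<Rightarrow> 'n::{finite,linorder} form set"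
  assumes A: "cochain_complex A" and Y: "cochain_complex Y" and X: "cochain_complex X" and B: "cochain_complex B"
    and AB: "\<And>k. A k \<subseteq> B k" and YB: "\<And>k. Y k \<subseteq> B k"
    and inter: "\<And>k. A k \<inter> Y k = X k"
    and sum: "\<And>k \<omega>. \<omega> \<in> B k \<Longrightarrow> \<exists>a\<in>A k. \<exists>y\<in>Y k. \<omega> = a + y"
    and injective_0: "\<And>\<omega>. \<omega> \<in> B 0 \<Longrightarrow> ext_deriv \<omega> = 0 \<Longrightarrow> \<omega> = 0"
    and top_closed: "\<And>\<omega>. \<omega> \<in> B CARD('n) \<Longrightarrow> ext_deriv \<omega> = 0"
    and integral_diff: "\<And>\<omega> \<eta>. \<omega> \<in> B CARD('n) \<Longrightarrow> \<eta> \<in> B CARD('n) \<Longrightarrow>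
      integral_form (\<omega> - \<eta>) = integral_form \<omega> - integral_form \<eta>"
    and stokes: "\<And>\<omega>. \<omega> \<in> B (CARD('n) - 1) \<Longrightarrow> integral_form (ext_deriv \<omega>) = 0"
    and exact_A: "exact_complex A"
begin

lemma XY: "X k \<subseteq> Y k" and XA: "X k \<subseteq> A k"
  using inter[of k] by blast+

lemma n_pos: "1 \<le> CARD('n)"
  by (simp add: Suc_leI)

lemma coboundary: "1 \<le> k \<Longrightarrow> \<omega> \<in> V (k - 1) \<Longrightarrow> ext_deriv \<omega> \<in> coboundaries V k"
  by (auto simp: coboundaries_def)

lemma coboundaryE:
  assumes "\<omega> \<in> coboundaries V k" "1 \<le> k"
  obtains \<eta> where "\<eta> \<in> V (k - 1)" "\<omega> = ext_deriv \<eta>"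
  using assms by (auto simp: coboundaries_def)

text \<open>Two primitives of the same form, one in \<open>A\<close> and one in \<open>Y\<close>,
  differ by a closed form of \<open>B\<close>. For injectivity its own primitive is split to make
  them agree, hence lie in \<open>X\<close>. Surjectivity splits a primitive of the given class in
  the same way.\<close>

lemma exact_imp_iso:
  assumes "exact_complex B" "1 \<le> k" "k \<le> CARD('n)"
  shows "inclusion_induces_iso X Y k"
  unfolding inclusion_induces_iso_iff[OF X Y XY]
proof (intro conjI subsetI ballI)
  let ?n = "CARD('n)"
  note d = ext_deriv_diff[OF B]
  note ex_A = exact_A[unfolded exact_complex_def] and ex_B = assms(1)[unfolded exact_complex_def]
  fix \<omega> assume \<omega>: "\<omega> \<in> cocycles X k \<inter> coboundaries Y k"
  then obtain y where y: "y \<in> Y (k - 1)" "\<omega> = ext_deriv y" using assms(2) coboundaryE by blast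
  have X\<omega>: "\<omega> \<in> X k" "ext_deriv \<omega> = 0" using \<omega> by (auto simp: cocycles_def)
  then have A\<omega>: "\<omega> \<in> A k" using XA by blast
  have "\<omega> \<in> coboundaries A k"
  proof (cases "k = ?n")
    case True
    have "integral_form \<omega> = 0" using stokes[of y] y YB[of "k - 1"] True by auto
    then show ?thesis using ex_A A\<omega> True by auto
  next
    case False
    then have "cocycles A k = coboundaries A k" using ex_A assms by auto
    moreover have "\<omega> \<in> cocycles A k" using A\<omega> X\<omega> by (simp add: cocycles_def)
    ultimately show ?thesis by simp
  qed
  then obtain a where a: "a \<in> A (k - 1)" "\<omega> = ext_deriv a" using assms(2) coboundaryE by blast
  have aB: "a \<in> B (k - 1)" and yB: "y \<in> B (k - 1)" using a y AB YB by blast+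
  then have ay: "a - y \<in> B (k - 1)" "ext_deriv (a - y) = 0"
    using d[OF aB yB] a(2) y(2) complex_diff[OF B] by auto
  show "\<omega> \<in> coboundaries X k"
  \<comment> \<open>A primitive of \<open>a - y\<close> would have degree -1 here; instead the two
    primitives coincide by injectivity in degree 0.\<close>
  proof (cases "k = 1")
    case True
    then have "a - y \<in> B 0" using ay(1) by simp
    then have "a - y = 0" using injective_0 ay(2) by blast
    then have "a \<in> X (k - 1)" using a(1) y(1) inter[of "k - 1"] by auto
    then show ?thesis using coboundary[of k a X] assms(2) a(2) by simp
  next
    case False
    then have "k - 1 \<in> {1..<?n}" using assms by auto
    then have "cocycles B (k - 1) = coboundaries B (k - 1)" using ex_B by blast
    moreover have "a - y \<in> cocycles B (k - 1)" using ay by (simp add: cocycles_def)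
    ultimately have "a - y \<in> coboundaries B (k - 1)" by blast
    moreover have k1: "1 \<le> k - 1" using assms(2) False by linarith
    ultimately obtain b where b: "b \<in> B (k - 1 - 1)" "a - y = ext_deriv b"
      by (rule coboundaryE)
    obtain a' y' where a'y': "a' \<in> A (k - 1 - 1)" "y' \<in> Y (k - 1 - 1)" "b = a' + y'" using sum[OF b(1)] by blast
    have a'B: "a' \<in> B (k - 1 - 1)" and y'B: "y' \<in> B (k - 1 - 1)" using a'y' AB YB by blast+
    \<comment> \<open>Both sides are still primitives of \<open>\<omega>\<close>; the left one lies
      in \<open>A\<close>, the right one in \<open>Y\<close>.\<close>
    have eq: "a - ext_deriv a' = y + ext_deriv y'"
      using b(2) unfolding a'y'(3) ext_deriv_add[OF B a'B y'B] by (simp add: algebra_simps)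
    have da': "ext_deriv a' \<in> A (k - 1)" by (rule complex_d_pred[OF A a'y'(1) k1])
    have dy': "ext_deriv y' \<in> Y (k - 1)" by (rule complex_d_pred[OF Y a'y'(2) k1])
    have "a - ext_deriv a' \<in> A (k - 1)" using a(1) da' by (rule complex_diff[OF A])
    moreover have "a - ext_deriv a' \<in> Y (k - 1)" unfolding eq using y(1) dy' by (rule complex_add[OF Y])
    ultimately have "a - ext_deriv a' \<in> X (k - 1)" using inter by blast
    moreover have "ext_deriv (a - ext_deriv a') = \<omega>"
      using d[OF aB, of "ext_deriv a'"] da' AB[of "k - 1"] complex_dd[OF A a'y'(1)] a(2) by auto
    ultimately show ?thesis using coboundary[of k "a - ext_deriv a'" X] assms(2) by simp
  qed
next
  let ?n = "CARD('n)"
  note ex_A = exact_A[unfolded exact_complex_def] and ex_B = assms(1)[unfolded exact_complex_def]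
  fix \<omega> assume "\<omega> \<in> cocycles Y k"
  then have \<omega>: "\<omega> \<in> Y k" "ext_deriv \<omega> = 0" by (auto simp: cocycles_def)
  then have \<omega>B: "\<omega> \<in> B k" using YB by blast
  \<comment> \<open>Below the top degree \<open>a0 = 0\<close> works. In top degree the integral
    obstructs exactness, so a form of \<open>A\<close> with the same integral is subtracted.\<close>
  obtain a0 where a0: "a0 \<in> A k" "ext_deriv a0 = 0" "\<omega> - a0 \<in> coboundaries B k"
  proof (cases "k = ?n")
    case True
    have "integral_form \<omega> \<in> integral_form ` A ?n" using ex_A by auto
    then obtain a where a: "a \<in> A ?n" "integral_form a = integral_form \<omega>" by auto
    have aB: "a \<in> B ?n" using a AB by blast
    have "integral_form (\<omega> - a) = 0" using integral_diff[of \<omega> a] \<omega>B aB a(2) True by simp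
    moreover have "\<omega> - a \<in> B ?n" using complex_diff[OF B] \<omega>B aB True by simp
    ultimately have "\<omega> - a \<in> coboundaries B ?n" using ex_B by blast
    then show ?thesis using that[of a] a(1) top_closed[OF aB] True by simp
  next
    case False
    then have "cocycles B k = coboundaries B k" using ex_B assms by auto
    moreover have "\<omega> \<in> cocycles B k" using \<omega> \<omega>B by (simp add: cocycles_def)
    ultimately show ?thesis using that[of 0] complex_0[OF A] ext_deriv_0[OF A] by simp
  qed
  obtain b where b: "b \<in> B (k - 1)" "\<omega> - a0 = ext_deriv b" using a0(3) assms(2) coboundaryE by blast
  obtain a y where ay: "a \<in> A (k - 1)" "y \<in> Y (k - 1)" "b = a + y" using sum[OF b(1)] by blast
  have aB: "a \<in> B (k - 1)" and yB: "y \<in> B (k - 1)" using ay AB YB by blast+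
  have eq: "\<omega> - ext_deriv y = a0 + ext_deriv a"
    using b(2) unfolding ay(3) ext_deriv_add[OF B aB yB] by (simp add: algebra_simps)
  have dy: "ext_deriv y \<in> Y k" by (rule complex_d_pred[OF Y ay(2) assms(2)])
  have da: "ext_deriv a \<in> A k" by (rule complex_d_pred[OF A ay(1) assms(2)])
  have "\<omega> - ext_deriv y \<in> Y k" using \<omega>(1) dy by (rule complex_diff[OF Y])
  moreover have "\<omega> - ext_deriv y \<in> A k" unfolding eq using a0(1) da by (rule complex_add[OF A])
  ultimately have "\<omega> - ext_deriv y \<in> X k" using inter by blast
  moreover have "ext_deriv (\<omega> - ext_deriv y) = 0"
    using ext_deriv_diff[OF Y \<omega>(1) dy] complex_dd[OF Y ay(2)] \<omega>(2) by simp
  ultimately have "\<omega> - ext_deriv y \<in> cocycles X k" by (simp add: cocycles_def)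
  moreover have "\<omega> - (\<omega> - ext_deriv y) \<in> coboundaries Y k"
    using coboundary[of k y Y] assms(2) ay(2) by simp
  ultimately show "\<exists>\<eta>\<in>cocycles X k. \<omega> - \<eta> \<in> coboundaries Y k" by blast
qed

text \<open>For closed \<open>a + y\<close>, the form \<open>ext_deriv a\<close> lies in
  \<open>X\<close> and bounds in \<open>Y\<close>. Injectivity in degree \<open>Suc k\<close> makes
  it bound in \<open>X\<close>, which allows \<open>a\<close> and \<open>y\<close> to be corrected
  to closed forms; surjectivity in degree \<open>k\<close> then moves the class of the second one
  into \<open>A\<close>, where it bounds.\<close>

lemma iso_imp_exact:
  assumes "\<And>k. 1 \<le> k \<Longrightarrow> k \<le> CARD('n) \<Longrightarrow> inclusion_induces_iso X Y k"
  shows "exact_complex B"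
proof -
  let ?n = "CARD('n)"
  note ex_A = exact_A[unfolded exact_complex_def]
  have inj: "cocycles X k \<inter> coboundaries Y k \<subseteq> coboundaries X k" if "1 \<le> k" "k \<le> ?n" for k
    using assms[OF that] unfolding inclusion_induces_iso_iff[OF X Y XY] by blast
  have surj: "\<exists>\<eta>\<in>cocycles X k. \<omega> - \<eta> \<in> coboundaries Y k" if "1 \<le> k" "k \<le> ?n" "\<omega> \<in> cocycles Y k" for k \<omega>
    using assms[OF that(1,2)] that(3) unfolding inclusion_induces_iso_iff[OF X Y XY] by blast
  have cobA: "coboundaries A k \<subseteq> coboundaries B k" and cobY: "coboundaries Y k \<subseteq> coboundaries B k" for k
    by (intro coboundaries_mono AB YB)+
  have exact_0: "cocycles B 0 = {0}"
    using injective_0 subspace_0[OF subspace_cocycles[OF B]] by (auto simp: cocycles_def)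
  have exact_k: "cocycles B k = coboundaries B k" if k: "1 \<le> k" "k < ?n" for k
  proof (rule equalityI[OF subsetI coboundaries_subset_cocycles[OF B]])
    fix \<omega> assume "\<omega> \<in> cocycles B k"
    then have \<omega>: "\<omega> \<in> B k" "ext_deriv \<omega> = 0" by (auto simp: cocycles_def)
    obtain a y where ay: "a \<in> A k" "y \<in> Y k" "\<omega> = a + y" using sum[OF \<omega>(1)] by blast
    have aB: "a \<in> B k" and yB: "y \<in> B k" using ay AB YB by blast+
    have "ext_deriv a + ext_deriv y = 0" using \<omega>(2) unfolding ay(3) ext_deriv_add[OF B aB yB] .
    then have da: "ext_deriv a = - ext_deriv y" by (rule eq_neg_iff_add_eq_0[THEN iffD2])
    have minus: "ext_deriv ((-1) *\<^sub>R y) = - ext_deriv y"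
      using ext_deriv_scale[OF Y ay(2), of "-1"] by (simp only: scaleR_minus1_left)
    have "ext_deriv a \<in> A (Suc k)" by (rule complex_d[OF A ay(1)])
    moreover have "ext_deriv a \<in> Y (Suc k)"
      unfolding da minus[symmetric] by (rule complex_d[OF Y complex_scale[OF Y ay(2)]])
    ultimately have "ext_deriv a \<in> cocycles X (Suc k)"
      using inter[of "Suc k"] complex_dd[OF A ay(1)] by (auto simp: cocycles_def)
    moreover have "ext_deriv a \<in> coboundaries Y (Suc k)"
    proof -
      have "(-1) *\<^sub>R y \<in> Y (Suc k - 1)" using complex_scale[OF Y ay(2)] by (simp only: diff_Suc_1)
      then show ?thesis unfolding da minus[symmetric] by (rule coboundary[rotated]) simp
    qed
    \<comment> \<open>Here \<open>k < CARD('n)\<close> matters: injectivity is assumed up to degree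
      \<open>CARD('n)\<close> only.\<close>
    ultimately have "ext_deriv a \<in> coboundaries X (Suc k)" using inj[of "Suc k"] k by auto
    then obtain x where "x \<in> X (Suc k - 1)" and x2: "ext_deriv a = ext_deriv x"
      by (rule coboundaryE) simp
    then have x: "x \<in> X k" "ext_deriv a = ext_deriv x" by (simp_all only: diff_Suc_1)
    have xA: "x \<in> A k" and xY: "x \<in> Y k" using x(1) XA XY by blast+
    have "a - x \<in> cocycles A k"
      using complex_diff[OF A ay(1) xA] ext_deriv_diff[OF A ay(1) xA] x(2) by (simp add: cocycles_def)
    then have 1: "a - x \<in> coboundaries B k" using ex_A k cobA by auto
    have "ext_deriv (y + x) = 0"
      unfolding ext_deriv_add[OF Y ay(2) xY] x(2)[symmetric] da by (rule right_minus)
    then have "y + x \<in> cocycles Y k"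
      using complex_add[OF Y ay(2) xY] by (simp add: cocycles_def)
    from surj[OF k(1) less_imp_le[OF k(2)] this]
    obtain \<eta> where \<eta>: "\<eta> \<in> cocycles X k" "y + x - \<eta> \<in> coboundaries Y k" by blast
    have "\<eta> \<in> cocycles A k" using \<eta>(1) cocycles_mono[of X A, OF XA] by blast
    then have 2: "\<eta> \<in> coboundaries B k" using ex_A k cobA by auto
    have 3: "y + x - \<eta> \<in> coboundaries B k" using \<eta>(2) cobY by blast
    \<comment> \<open>Each of the three pieces bounds: the first and the last in \<open>A\<close>,
      the middle one in \<open>Y\<close>.\<close>
    have "\<omega> = (a - x) + ((y + x - \<eta>) + \<eta>)" using ay(3) by simp
    also have "\<dots> \<in> coboundaries B k"
      by (intro subspace_add[OF subspace_coboundaries[OF B]] 1 2 3)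
    finally show "\<omega> \<in> coboundaries B k" .
  qed
  have stokes': "integral_form \<omega> = 0" if "\<omega> \<in> coboundaries B ?n" for \<omega>
    by (rule coboundaryE[OF that n_pos]) (simp only: stokes)
  have exact_n: "{\<omega> \<in> B ?n. integral_form \<omega> = 0} = coboundaries B ?n"
  proof (intro equalityI subsetI)
    fix \<omega> assume "\<omega> \<in> {\<omega> \<in> B ?n. integral_form \<omega> = 0}"
    then have \<omega>: "\<omega> \<in> B ?n" "integral_form \<omega> = 0" by auto
    obtain a y where ay: "a \<in> A ?n" "y \<in> Y ?n" "\<omega> = a + y" using sum[OF \<omega>(1)] by blast
    have "y \<in> cocycles Y ?n" using ay(2) top_closed YB by (auto simp: cocycles_def)
    from surj[OF n_pos order_refl this]
    obtain \<eta> where \<eta>: "\<eta> \<in> cocycles X ?n" "y - \<eta> \<in> coboundaries Y ?n" by blast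
    have "\<eta> \<in> A ?n" using \<eta>(1) XA by (auto simp: cocycles_def)
    then have a\<eta>: "a + \<eta> \<in> A ?n" using ay(1) by (intro complex_add[OF A])
    have y\<eta>: "y - \<eta> \<in> coboundaries B ?n" using \<eta>(2) cobY by blast
    then have "y - \<eta> \<in> B ?n" using coboundaries_subset_cocycles[OF B] by (auto simp: cocycles_def)
    \<comment> \<open>In top degree every form is closed, so no correction by \<open>x\<close> is
      needed. Moving \<open>\<eta>\<close> over to \<open>a\<close> concentrates the vanishing
      integral in \<open>A\<close>.\<close>
    then have "integral_form (\<omega> - (y - \<eta>)) = 0" using integral_diff[OF \<omega>(1)] \<omega>(2) stokes'[OF y\<eta>] by simp
    moreover have "\<omega> - (y - \<eta>) = a + \<eta>" using ay(3) by simp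
    ultimately have "a + \<eta> \<in> coboundaries A ?n" using ex_A a\<eta> by auto
    then have 1: "a + \<eta> \<in> coboundaries B ?n" using cobA by blast
    have "\<omega> = (a + \<eta>) + (y - \<eta>)" using ay(3) by simp
    then show "\<omega> \<in> coboundaries B ?n" using subspace_add[OF subspace_coboundaries[OF B] 1 y\<eta>] by simp
  next
    fix \<omega> assume "\<omega> \<in> coboundaries B ?n"
    then show "\<omega> \<in> {\<omega> \<in> B ?n. integral_form \<omega> = 0}"
      using stokes' coboundaries_subset_cocycles[OF B] by (auto simp: cocycles_def)
  qed
  have onto: "integral_form ` B ?n = UNIV"
  proof (rule top.extremum_uniqueI)
    have "UNIV = integral_form ` A ?n" using ex_A by (simp only:)
    then show "UNIV \<subseteq> integral_form ` B ?n" using image_mono[OF AB[of ?n], where f = integral_form] by (simp only:)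
  qed
  show ?thesis unfolding exact_complex_def using exact_0 exact_k exact_n onto by simp
qed

end

section \<open>Hierarchical spaces\<close>

lemma cochain_complex_tensor_forms:
  fixes K :: "'n::{finite,linorder} \<Rightarrow> knot_vector"
  assumes K: "\<And>q. open_knot_vector (K q)"
  shows "cochain_complex (tensor_forms K)"
  unfolding cochain_complex_def
proof (intro conjI allI ballI)
  let ?C = "coef_space K (\<lambda>_ _. True)"
  note d = ext_deriv_form_of[OF K]
  have mem_d: "coef_d c \<in> ?C (Suc k)" if "c \<in> ?C k" for c k
    using coef_d_mem[OF K, where W = UNIV and c = c and k = k] that by (simp only: subset_UNIV)
  note add = subspace_add[OF subspace_coef_space] and scale = subspace_scale[OF subspace_coef_space]
  show "subspace (tensor_forms K k)" for k
    unfolding tensor_forms_def by (rule subspace_form_of)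
  fix k \<omega> assume "\<omega> \<in> tensor_forms K k"
  then obtain c where c: "c \<in> ?C k" "\<omega> = form_of K c" by (auto simp: tensor_forms_def)
  show "ext_deriv \<omega> \<in> tensor_forms K (Suc k)"
    unfolding c(2) d[OF c(1)] tensor_forms_def by (intro imageI mem_d c)
  show "ext_deriv (ext_deriv \<omega>) = 0"
    unfolding c(2) d[OF c(1)] d[OF mem_d[OF c(1)]] coef_d_coef_d by simp
  show "ext_deriv (r *\<^sub>R \<omega>) = r *\<^sub>R ext_deriv \<omega>" for r
    unfolding c(2) d[OF c(1)] form_of_scale[symmetric] d[OF scale[OF c(1)]] coef_d_scale ..
  fix \<eta> assume "\<eta> \<in> tensor_forms K k"
  then obtain e where e: "e \<in> ?C k" "\<eta> = form_of K e" by (auto simp: tensor_forms_def)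
  show "ext_deriv (\<omega> + \<eta>) = ext_deriv \<omega> + ext_deriv \<eta>"
    unfolding c(2) e(2) d[OF c(1)] d[OF e(1)] form_of_add[symmetric] d[OF add[OF c(1) e(1)]] coef_d_add ..
qed

lemma integral_form_diff:
  fixes K :: "'n::{finite,linorder} \<Rightarrow> knot_vector"
  assumes K: "\<And>q. open_knot_vector (K q)" and "\<omega> \<in> tensor_forms K k" "\<eta> \<in> tensor_forms K k"
  shows "integral_form (\<omega> - \<eta>) = integral_form \<omega> - integral_form \<eta>"
proof -
  obtain c where c: "\<omega> = form_of K c" using assms by (auto simp: tensor_forms_def)
  obtain e where e: "\<eta> = form_of K e" using assms by (auto simp: tensor_forms_def)
  have "\<omega> - \<eta> = form_of K (c + (-1) *\<^sub>R e)"
    unfolding form_of_add form_of_scale c e by simp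
  then have "integral_form (\<omega> - \<eta>) = coef_total K (c + (-1) *\<^sub>R e)"
    by (simp only: integral_form_of[OF K])
  also have "\<dots> = coef_total K c - coef_total K e"
    by (simp add: coef_total_def sum_subtractf)
  finally show ?thesis by (simp only: c e integral_form_of[OF K])
qed

lemma integral_form_ext_deriv:
  fixes K :: "'n::{finite,linorder} \<Rightarrow> knot_vector"
  assumes K: "\<And>q. open_knot_vector (K q)" and "\<omega> \<in> tensor_forms K k"
  shows "integral_form (ext_deriv \<omega>) = 0"
proof -
  obtain c where c: "c \<in> coef_space K (\<lambda>_ _. True) k" "\<omega> = form_of K c" using assms by (auto simp: tensor_forms_def)
  show ?thesis unfolding c(2) ext_deriv_form_of[OF K c(1)] integral_form_of[OF K] by (rule coef_total_coef_d[OF c(1)])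
qed

lemma tensor_forms_beyond_top:
  fixes K :: "'n::{finite,linorder} \<Rightarrow> knot_vector"
  assumes "\<omega> \<in> tensor_forms K (Suc CARD('n))"
  shows "\<omega> = 0"
proof -
  obtain c where c: "c \<in> coef_space K (\<lambda>_ _. True) (Suc CARD('n))" "\<omega> = form_of K c" using assms by (auto simp: tensor_forms_def)
  have "c \<gamma> i = 0" for \<gamma> i
  proof (rule ccontr)
    assume "c \<gamma> i \<noteq> 0"
    then have "card \<gamma> = Suc CARD('n)" using c(1) by (simp add: coef_space_def)
    moreover have "card \<gamma> \<le> CARD('n)" by (intro card_mono) auto
    ultimately show False by simp
  qed
  then have "c = 0" by (simp add: fun_eq_iff)
  then show ?thesis using c(2) by simp
qed

lemma span_spline_basis_eq: "span (fst ` spline_basis \<Xi> l k) = tensor_forms (\<Xi> l) k"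
  unfolding tensor_forms_def by (rule span_spline_basis)

lemma sub_space_subset_tensor_forms: "sub_space \<Xi> \<Omega> l l' k \<subseteq> tensor_forms (\<Xi> l) k"
  unfolding span_spline_basis_eq[symmetric] sub_space_def sub_basis_def by (intro span_mono) auto

lemma subspace_hier_space: "subspace (hier_space \<Xi> \<Omega> l k)"
  unfolding hier_space_def by (rule subspace_span)

lemma subspace_sub_space: "subspace (sub_space \<Xi> \<Omega> l l' k)"
  unfolding sub_space_def by (rule subspace_span)

lemma ext_deriv_sub_space:
  assumes "\<And>q. open_knot_vector (\<Xi> l q)" "\<omega> \<in> sub_space \<Xi> \<Omega> l l' k"
  shows "ext_deriv \<omega> \<in> sub_space \<Xi> \<Omega> l l' (Suc k)"
proof -
  obtain c where c: "c \<in> coef_space (\<Xi> l) (\<lambda>\<alpha> i. spline_supp (\<Xi> l) \<alpha> i \<subseteq> \<Omega> l') k" "\<omega> = form_of (\<Xi> l) c"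
    using assms(2) unfolding sub_space_eq by auto
  show ?thesis
    unfolding c(2) ext_deriv_form_of[OF assms(1) c(1)] sub_space_eq by (intro imageI coef_d_mem assms(1) c(1))
qed

lemma sub_space_outside:
  assumes "\<And>q. open_knot_vector (\<Xi> l q)" "\<omega> \<in> sub_space \<Xi> \<Omega> l l' k" "x \<notin> closure (\<Omega> l')"
  shows "\<omega> \<gamma> x = 0"
proof -
  obtain c where c: "c \<in> coef_space (\<Xi> l) (\<lambda>\<alpha> i. spline_supp (\<Xi> l) \<alpha> i \<subseteq> \<Omega> l') k" "\<omega> = form_of (\<Xi> l) c"
    using assms(2) unfolding sub_space_eq by auto
  show ?thesis unfolding c(2) by (rule form_of_outside[OF assms(1) c(1) assms(3)])
qed

lemma tensor_forms_local:
  assumes "\<And>q. open_knot_vector (\<Xi> l q)" "\<Omega> l' = interior (closure (\<Omega> l'))"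
    and "\<omega> \<in> tensor_forms (\<Xi> l) k" "\<And>\<gamma> x. x \<in> unit_cube \<Longrightarrow> x \<notin> closure (\<Omega> l') \<Longrightarrow> \<omega> \<gamma> x = 0"
  shows "\<omega> \<in> sub_space \<Xi> \<Omega> l l' k"
proof -
  obtain c where c: "c \<in> coef_space (\<Xi> l) (\<lambda>_ _. True) k" "\<omega> = form_of (\<Xi> l) c"
    using assms(3) by (auto simp: tensor_forms_def)
  show ?thesis
    unfolding c(2) sub_space_eq using assms(4) unfolding c(2) by (intro imageI form_of_local[OF assms(1) c(1) assms(2)])
qed

text \<open>A basis element inherited from an earlier level has support not contained in
  \<open>\<Omega> l\<close>, so an element supported in \<open>\<Omega> (Suc l)\<close> must belong
  to level \<open>l\<close> itself.\<close>

lemma hier_basis_inside: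
  assumes "\<beta> \<in> hier_basis \<Xi> \<Omega> l k" "snd \<beta> \<subseteq> \<Omega> (Suc l)" "\<Omega> (Suc l) \<subseteq> \<Omega> l"
  shows "\<beta> \<in> sub_basis \<Xi> \<Omega> l (Suc l) k"
  using assms by (cases l) (auto simp: sub_basis_def)

locale hierarchical_splines =
  fixes N :: nat
    and \<Xi> :: "nat \<Rightarrow> 'n::{finite,linorder} \<Rightarrow> knot_vector"
    and \<Omega> :: "nat \<Rightarrow> (real ^ ('n::{finite,linorder})) set"
  assumes knots: "\<And>l q. l \<le> N \<Longrightarrow> open_knot_vector (\<Xi> l q)"
    and nested_spaces: "\<And>l. l < N \<Longrightarrow> tensor_spline_space (\<Xi> l) \<subseteq> tensor_spline_space (\<Xi> (Suc l))"
    and nested_domains: "\<And>l. l < N \<Longrightarrow> \<Omega> (Suc l) \<subseteq> \<Omega> l"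
    and regular: "\<And>l. l \<le> N \<Longrightarrow> \<Omega> l = interior (closure (\<Omega> l))"
begin

abbreviation "W \<equiv> hier_space \<Xi> \<Omega>"
abbreviation "X \<equiv> sub_space \<Xi> \<Omega>"

lemma tensor_forms_nested: "l < N \<Longrightarrow> tensor_forms (\<Xi> l) k \<subseteq> tensor_forms (\<Xi> (Suc l)) k"
  unfolding tensor_forms_def by (intro form_of_nested knots nested_spaces) auto

text \<open>Nesting makes the form a fine one, and locality on the fine level puts its coefficients
  on basis forms supported in the same subdomain.\<close>

lemma sub_space_nested:
  assumes "l < N"
  shows "X l (Suc l) k \<subseteq> X (Suc l) (Suc l) k"
proof
  fix \<omega> assume \<omega>: "\<omega> \<in> X l (Suc l) k"
  show "\<omega> \<in> X (Suc l) (Suc l) k"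
  proof (rule tensor_forms_local)
    show "\<omega> \<in> tensor_forms (\<Xi> (Suc l)) k"
      using \<omega> sub_space_subset_tensor_forms[of \<Xi> \<Omega> l "Suc l" k] tensor_forms_nested[OF assms, of k] by blast
    show "\<omega> \<gamma> x = 0" if "x \<notin> closure (\<Omega> (Suc l))" for \<gamma> x
      using assms by (intro sub_space_outside[OF knots \<omega> that]) auto
  qed (use assms knots regular in auto)
qed

text \<open>Refinement loses nothing: a basis form removed at level \<open>Suc l\<close> is
  supported in \<open>\<Omega> (Suc l)\<close>, hence is a combination of the fine basis forms added
  there.\<close>

lemma hier_space_Suc:
  assumes "l < N"
  shows "W l k \<subseteq> W (Suc l) k" "X (Suc l) (Suc l) k \<subseteq> W (Suc l) k"
    and "\<And>\<omega>. \<omega> \<in> W (Suc l) k \<Longrightarrow> \<exists>a\<in>W l k. \<exists>y\<in>X (Suc l) (Suc l) k. \<omega> = a + y"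
proof -
  let ?Y = "X (Suc l) (Suc l) k"
  let ?H = "fst ` {\<beta> \<in> hier_basis \<Xi> \<Omega> l k. \<not> snd \<beta> \<subseteq> \<Omega> (Suc l)}"
  have W: "W (Suc l) k = span (?H \<union> fst ` sub_basis \<Xi> \<Omega> (Suc l) (Suc l) k)"
    unfolding hier_space_def hier_basis.simps image_Un sub_basis_def ..
  show Y: "?Y \<subseteq> W (Suc l) k"
    unfolding W sub_space_def by (rule span_mono) (rule Un_upper2)
  have H: "?H \<subseteq> W (Suc l) k" unfolding W by (rule order_trans[OF Un_upper1 span_superset])
  have "fst ` hier_basis \<Xi> \<Omega> l k \<subseteq> W (Suc l) k"
  proof
    fix \<omega> assume "\<omega> \<in> fst ` hier_basis \<Xi> \<Omega> l k"
    then obtain \<beta> where \<beta>: "\<omega> = fst \<beta>" "\<beta> \<in> hier_basis \<Xi> \<Omega> l k" by (rule imageE)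
    show "\<omega> \<in> W (Suc l) k"
    proof (cases "snd \<beta> \<subseteq> \<Omega> (Suc l)")
      case True
      then have "\<beta> \<in> sub_basis \<Xi> \<Omega> l (Suc l) k"
        using \<beta>(2) nested_domains[OF assms] by (intro hier_basis_inside)
      then have "\<omega> \<in> X l (Suc l) k" unfolding sub_space_def \<beta>(1) by (intro span_base imageI)
      then show ?thesis using Y sub_space_nested[OF assms] by blast
    next
      case False
      then have "\<omega> \<in> ?H" using \<beta> by blast
      then show ?thesis using H by blast
    qed
  qed
  then have "span (fst ` hier_basis \<Xi> \<Omega> l k) \<subseteq> W (Suc l) k"
    by (rule span_minimal) (rule subspace_hier_space)
  then show "W l k \<subseteq> W (Suc l) k" by (simp only: hier_space_def[of \<Xi> \<Omega> l k])
  fix \<omega> assume "\<omega> \<in> W (Suc l) k"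
  then obtain a y where "\<omega> = a + y" "a \<in> span ?H" "y \<in> ?Y"
    unfolding W span_Un sub_space_def by blast
  moreover have "span ?H \<subseteq> W l k" unfolding hier_space_def by (intro span_mono image_mono) (rule Collect_subset)
  ultimately show "\<exists>a\<in>W l k. \<exists>y\<in>?Y. \<omega> = a + y" by blast
qed

lemma sub_space_subset_hier_space:
  assumes "l < N"
  shows "X l (Suc l) k \<subseteq> W l k"
proof (cases l)
  case 0
  then show ?thesis unfolding sub_space_def hier_space_def sub_basis_def by (intro span_mono) auto
next
  case (Suc m)
  have "sub_basis \<Xi> \<Omega> l (Suc l) k \<subseteq> hier_basis \<Xi> \<Omega> l k"
    using nested_domains[OF assms] by (auto simp: sub_basis_def Suc)
  then show ?thesis unfolding sub_space_def hier_space_def by (intro span_mono image_mono)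
qed

lemma hier_space_subset_tensor_forms: "l \<le> N \<Longrightarrow> W l k \<subseteq> tensor_forms (\<Xi> l) k"
proof (induction l)
  case 0
  then show ?case by (simp add: hier_space_def span_spline_basis_eq)
next
  case (Suc l)
  then have l: "l < N" by simp
  show ?case
  proof
    fix \<omega> assume "\<omega> \<in> W (Suc l) k"
    then obtain a y where a: "a \<in> W l k" and y: "y \<in> X (Suc l) (Suc l) k" and \<omega>: "\<omega> = a + y"
      using hier_space_Suc(3)[OF l] by blast
    have "a \<in> tensor_forms (\<Xi> (Suc l)) k"
      using a Suc.IH l tensor_forms_nested[OF l, of k] by auto
    moreover have "y \<in> tensor_forms (\<Xi> (Suc l)) k" using y sub_space_subset_tensor_forms by blast
    ultimately show "\<omega> \<in> tensor_forms (\<Xi> (Suc l)) k"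
      unfolding \<omega> by (rule complex_add[OF cochain_complex_tensor_forms[of "\<Xi> (Suc l)", OF knots[OF Suc.prems]]])
  qed
qed

text \<open>The decomposition into a coarser hierarchical part and a fine local part is respected by
  the derivative. Embedding both parts in one tensor-product space makes the derivative additive on
  them.\<close>

lemma ext_deriv_hier_space: "l \<le> N \<Longrightarrow> \<omega> \<in> W l k \<Longrightarrow> ext_deriv \<omega> \<in> W l (Suc k)"
proof (induction l arbitrary: \<omega>)
  case 0
  then show ?case
    using complex_d[OF cochain_complex_tensor_forms[of "\<Xi> 0", OF knots[of 0]]] by (simp add: hier_space_def span_spline_basis_eq)
next
  case (Suc l)
  then have l: "l < N" by simp
  obtain a y where a: "a \<in> W l k" and y: "y \<in> X (Suc l) (Suc l) k" and \<omega>: "\<omega> = a + y"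
    using hier_space_Suc(3)[OF l Suc.prems(2)] by blast
  have "a \<in> tensor_forms (\<Xi> (Suc l)) k"
    using a hier_space_subset_tensor_forms[of l k] l tensor_forms_nested[OF l, of k] by auto
  moreover have "y \<in> tensor_forms (\<Xi> (Suc l)) k" using y sub_space_subset_tensor_forms by blast
  ultimately have "ext_deriv \<omega> = ext_deriv a + ext_deriv y"
    unfolding \<omega> by (rule ext_deriv_add[OF cochain_complex_tensor_forms[of "\<Xi> (Suc l)", OF knots[OF Suc.prems(1)]]])
  moreover have "ext_deriv a \<in> W (Suc l) (Suc k)"
    using Suc.IH[OF less_imp_le[OF l] a] hier_space_Suc(1)[OF l] by blast
  moreover have "ext_deriv y \<in> W (Suc l) (Suc k)"
    using ext_deriv_sub_space[where \<Xi> = \<Xi> and l = "Suc l", OF knots[OF Suc.prems(1)] y] hier_space_Suc(2)[OF l] by blast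
  ultimately show ?case using subspace_add[OF subspace_hier_space] by metis
qed

text \<open>Linear independence of hierarchical B-splines in disguise: in the inductive step the part of level \<open>Suc l\<close>
  vanishes off \<open>\<Omega> (Suc l)\<close>, hence so does the coarser part.\<close>

lemma hier_space_local:
  assumes "l < N" "\<omega> \<in> W l k" "\<And>\<gamma> x. x \<in> unit_cube \<Longrightarrow> x \<notin> closure (\<Omega> (Suc l)) \<Longrightarrow> \<omega> \<gamma> x = 0"
  shows "\<omega> \<in> X l (Suc l) k"
  using assms
proof (induction l arbitrary: \<omega>)
  case 0
  show ?case
  proof (rule tensor_forms_local)
    show "\<omega> \<in> tensor_forms (\<Xi> 0) k" using 0 by (simp add: hier_space_def span_spline_basis_eq)
  qed (use 0 knots regular in auto)
next
  case (Suc l)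
  then have l: "l < N" by simp
  have k: "open_knot_vector (\<Xi> (Suc l) q)" for q using Suc.prems by (intro knots) auto
  obtain a y where a: "a \<in> W l k" and y: "y \<in> X (Suc l) (Suc l) k" and \<omega>: "\<omega> = a + y"
    using hier_space_Suc(3)[OF l Suc.prems(2)] by blast
  have "a \<in> X l (Suc l) k"
  proof (rule Suc.IH[OF l a])
    fix \<gamma> x assume x: "x \<in> unit_cube" "x \<notin> closure (\<Omega> (Suc l))"
    have "x \<notin> closure (\<Omega> (Suc (Suc l)))"
      using x(2) closure_mono[OF nested_domains[OF Suc.prems(1)]] by blast
    then have "\<omega> \<gamma> x = 0" using Suc.prems(3) x(1) by blast
    moreover have "y \<gamma> x = 0" by (rule sub_space_outside[OF k y x(2)])
    ultimately show "a \<gamma> x = 0" unfolding \<omega> by simp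
  qed
  then have "a \<in> X (Suc l) (Suc l) k" using sub_space_nested[OF l] by blast
  then have "\<omega> \<in> X (Suc l) (Suc l) k" unfolding \<omega> using y by (intro subspace_add subspace_sub_space)
  then have "\<omega> \<in> tensor_forms (\<Xi> (Suc l)) k" using sub_space_subset_tensor_forms by blast
  then show ?case
    using Suc.prems regular[of "Suc (Suc l)"] by (intro tensor_forms_local k) auto
qed

lemma mayer_vietoris_step:
  assumes l: "l < N" and exact: "exact_complex (W l)"
  shows "mayer_vietoris (W l) (X (Suc l) (Suc l)) (X l (Suc l)) (W (Suc l))"
proof -
  let ?T = "tensor_forms (\<Xi> (Suc l))"
  have k: "open_knot_vector (\<Xi> (Suc l) q)" "open_knot_vector (\<Xi> l q)" for q using l by (auto intro: knots)
  note T = cochain_complex_tensor_forms[of "\<Xi> (Suc l)", OF k(1)]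
  have WT: "W (Suc l) k \<subseteq> ?T k" for k using l by (intro hier_space_subset_tensor_forms) simp
  have B: "cochain_complex (W (Suc l))"
    by (rule cochain_complex_subcomplex[OF T WT subspace_hier_space ext_deriv_hier_space]) (use l in simp)
  have A: "cochain_complex (W l)"
    by (rule cochain_complex_subcomplex[OF B hier_space_Suc(1)[OF l] subspace_hier_space ext_deriv_hier_space]) (use l in simp)
  have Y: "cochain_complex (X (Suc l) (Suc l))"
    by (rule cochain_complex_subcomplex[OF B hier_space_Suc(2)[OF l] subspace_sub_space ext_deriv_sub_space[where \<Xi> = \<Xi> and l = "Suc l", OF k(1)]])
  have X: "cochain_complex (X l (Suc l))"
    by (rule cochain_complex_subcomplex[OF Y sub_space_nested[OF l] subspace_sub_space ext_deriv_sub_space[where \<Xi> = \<Xi> and l = l, OF k(2)]])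
  show ?thesis
  proof (rule mayer_vietoris.intro[OF A Y X B hier_space_Suc(1)[OF l] hier_space_Suc(2)[OF l] _ hier_space_Suc(3)[OF l] _ _ _ _ exact])
    show "W l k \<inter> X (Suc l) (Suc l) k = X l (Suc l) k" for k
    proof (intro equalityI subsetI IntI)
      \<comment> \<open>Membership in the fine local space is used only for vanishing off the
        closure; locality on the hierarchical side does the rest.\<close>
      fix \<omega> assume \<omega>: "\<omega> \<in> W l k \<inter> X (Suc l) (Suc l) k"
      show "\<omega> \<in> X l (Suc l) k"
      proof (rule hier_space_local[OF l])
        show "\<omega> \<in> W l k" using \<omega> by blast
        show "\<omega> \<gamma> x = 0" if "x \<notin> closure (\<Omega> (Suc l))" for \<gamma> x
          using \<omega> that by (intro sub_space_outside[of \<Xi> "Suc l" \<omega> \<Omega> "Suc l" k] k(1)) blast+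
      qed
    qed (use sub_space_subset_hier_space[OF l] sub_space_nested[OF l] in blast)+
  next
    fix \<omega> assume "\<omega> \<in> W (Suc l) 0" "ext_deriv \<omega> = 0"
    then have "\<omega> \<in> cocycles ?T 0" using WT by (auto simp: cocycles_def)
    then show "\<omega> = 0" using exact_tensor_forms[of "\<Xi> (Suc l)", OF k(1)] by (simp add: exact_complex_def)
  next
    fix \<omega> assume "\<omega> \<in> W (Suc l) CARD('n)"
    then have "ext_deriv \<omega> \<in> ?T (Suc CARD('n))" using complex_d[OF T] WT by blast
    then show "ext_deriv \<omega> = 0" by (rule tensor_forms_beyond_top)
  next
    fix \<omega> \<eta> assume "\<omega> \<in> W (Suc l) CARD('n)" "\<eta> \<in> W (Suc l) CARD('n)"
    then show "integral_form (\<omega> - \<eta>) = integral_form \<omega> - integral_form \<eta>"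
      using WT by (intro integral_form_diff[of "\<Xi> (Suc l)", OF k(1)]) blast+
  next
    fix \<omega> assume "\<omega> \<in> W (Suc l) (CARD('n) - 1)"
    then show "integral_form (ext_deriv \<omega>) = 0"
      using WT by (intro integral_form_ext_deriv[of "\<Xi> (Suc l)", OF k(1)]) blast
  qed
qed

text \<open>Exactness of \<open>W l\<close>, needed for the step at \<open>l\<close>, is part of the
  assumption in one direction and the induction hypothesis in the other; both start from the
  tensor-product complex \<open>W 0\<close>.\<close>

lemma exact_hier_space_iff:
  "(\<forall>l<N. exact_complex (W (l + 1))) \<longleftrightarrow>
    (\<forall>l<N. \<forall>k\<in>{1..CARD('n)}. inclusion_induces_iso (X l (l + 1)) (X (l + 1) (l + 1)) k)"
proof -
  have W0: "W 0 = tensor_forms (\<Xi> 0)"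
    by (rule ext) (simp add: hier_space_def span_spline_basis_eq)
  have exact_0: "exact_complex (W 0)"
    unfolding W0 by (intro exact_tensor_forms knots) simp
  show ?thesis
  proof (intro iffI allI impI ballI)
    fix l k assume *: "\<forall>l<N. exact_complex (W (l + 1))" and l: "l < N" and k: "k \<in> {1..CARD('n)}"
    have "exact_complex (W l)"
    proof (cases l)
      case 0
      then show ?thesis using exact_0 by simp
    next
      case (Suc m)
      then show ?thesis using * l by auto
    qed
    moreover have "exact_complex (W (Suc l))" using * l by simp
    ultimately show "inclusion_induces_iso (X l (l + 1)) (X (l + 1) (l + 1)) k"
      using mayer_vietoris.exact_imp_iso[OF mayer_vietoris_step[OF l]] k by simp
  next
    fix l assume *: "\<forall>l<N. \<forall>k\<in>{1..CARD('n)}. inclusion_induces_iso (X l (l + 1)) (X (l + 1) (l + 1)) k"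
      and l: "l < N"
    have "exact_complex (W l)" if "l \<le> N" for l
      using that
    proof (induction l)
      case 0
      show ?case by (rule exact_0)
    next
      case (Suc l)
      then have l: "l < N" "exact_complex (W l)" by auto
      show ?case
        by (rule mayer_vietoris.iso_imp_exact[OF mayer_vietoris_step[OF l]]) (use * l(1) in simp)
    qed
    then show "exact_complex (W (l + 1))" using l by simp
  qed
qed

end

theorem theorem5p5:
  fixes N :: nat
    and \<Xi> :: "nat \<Rightarrow> 'n::{finite,linorder} \<Rightarrow> knot_vector"
    and \<Omega> :: "nat \<Rightarrow> (real ^ ('n::{finite,linorder})) set"
  assumes knots: "\<And>l q. l \<le> N \<Longrightarrow> open_knot_vector (\<Xi> l q)"
    and nested_spaces: "\<And>l. l < N \<Longrightarrow> tensor_spline_space (\<Xi> l) \<subseteq> tensor_spline_space (\<Xi> (l + 1))"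
    and Omega_first: "\<Omega> 0 = unit_cube"
    and Omega_last: "\<Omega> (N + 1) = {}"
    and nested_domains: "\<And>l. l \<le> N \<Longrightarrow> \<Omega> (l + 1) \<subseteq> \<Omega> l"
    and Omega_open: "\<And>l. l \<le> N + 1 \<Longrightarrow> open (\<Omega> l)"
    and Omega_regular: "\<And>l. l \<le> N + 1 \<Longrightarrow> \<Omega> l = interior (closure (\<Omega> l))"
    and Omega_mesh: "\<And>l. l \<in> {1..N} \<Longrightarrow>
      \<exists>\<C>\<subseteq>bezier_mesh (\<Xi> (l - 1)). closure (\<Omega> l) = (\<Union>Q\<in>\<C>. closure Q)"
  shows "(\<forall>l<N. exact_complex (hier_space \<Xi> \<Omega> (l + 1))) \<longleftrightarrow>
    (\<forall>l<N. \<forall>k\<in>{1..CARD('n)}.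
       inclusion_induces_iso (sub_space \<Xi> \<Omega> l (l + 1)) (sub_space \<Xi> \<Omega> (l + 1) (l + 1)) k)"
proof -
  have "hierarchical_splines N \<Xi> \<Omega>"
  proof
    show "\<Omega> l = interior (closure (\<Omega> l))" if "l \<le> N" for l using Omega_regular[of l] that by simp
  qed (use knots nested_spaces nested_domains in auto)
  then show ?thesis by (rule hierarchical_splines.exact_hier_space_iff)
qed

end
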